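(* A convex polygon $P$ with $n$ vertices has at most $O(n^3)$ distinct gluing trees arising from Aleksandrov gluings. Moreover, there exist convex polygons with $n$ vertices (for arbitrarily large $n$) having $\Omega(n^2)$ combinatorially distinct Aleksandrov gluings.
   Context: A gluing of $P$ is a length-preserving identification of $\partial P$ with itself (finitely many open intervals glued isometrically in pairs, endpoints identified, transitively). An Aleksandrov gluing is one where at most $2\pi$ total face angle is glued at any point and the result is homeomorphic to a sphere. The gluing tree of a gluing is the labeled tree that is the image of $\partial P$ after identification: its nodes are the images of points of $\partial P$ identified with more or fewer than one other distinct point, together with images of points to which a vertex of $P$ is glued; each node is labeled by the set of vertices and edges of $P$ glued there (a point interior to an edge glued only to itself is a leaf labeled by its edge). Gluings are combinatorially distinct when their gluing trees differ. *)

theory Defs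
  imports "HOL-Analysis.Analysis"
begin

text \<open>A convex polygon with n vertices: vertices v 0, ..., v (n-1) listed in cyclic
  order along the boundary; each is an extreme point (so they are exactly the
  corners of P); P is their convex hull.\<close>

definition nxt :: "nat \<Rightarrow> nat \<Rightarrow> nat" where
  "nxt n i = Suc i mod n"

definition prv :: "nat \<Rightarrow> nat \<Rightarrow> nat" where
  "prv n i = (i + n - 1) mod n"

definition polygon :: "nat \<Rightarrow> (nat \<Rightarrow> complex) \<Rightarrow> complex set" where
  "polygon n v = convex hull (v ` {..<n})"

definition convex_polygon :: "nat \<Rightarrow> (nat \<Rightarrow> complex) \<Rightarrow> bool" where
  "convex_polygon n v \<longleftrightarrow> n \<ge> 3 \<and> inj_on v {..<n}
     \<and> (\<forall>i<n. v i \<notin> convex hull (v ` ({..<n} - {i})))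
     \<and> (\<forall>i<n. closed_segment (v i) (v (nxt n i)) \<subseteq> frontier (polygon n v))"

definition edgev :: "nat \<Rightarrow> (nat \<Rightarrow> complex) \<Rightarrow> nat \<Rightarrow> complex" where
  "edgev n v k = v (nxt n k) - v k"

definition plen :: "nat \<Rightarrow> (nat \<Rightarrow> complex) \<Rightarrow> nat \<Rightarrow> real" where
  "plen n v k = (\<Sum>i<k. cmod (edgev n v i))"

definition perim :: "nat \<Rightarrow> (nat \<Rightarrow> complex) \<Rightarrow> real" where
  "perim n v = plen n v n"

definition modL :: "real \<Rightarrow> real \<Rightarrow> real" where
  "modL L x = x - L * of_int \<lfloor>x / L\<rfloor>"

definition bpt :: "nat \<Rightarrow> (nat \<Rightarrow> complex) \<Rightarrow> real \<Rightarrow> complex" where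
  "bpt n v s = (let s' = modL (perim n v) s;
                    k = (LEAST k. s' < plen n v (Suc k))
                in v k + of_real ((s' - plen n v k) / cmod (edgev n v k)) * edgev n v k)"

text \<open>A gluing is given by a finite list of pairs of open boundary arcs
  (in arclength parameters modulo the perimeter).  An entry (a, c, l, r) glues the
  arc (a, a+l) isometrically to the arc (c, c+l): if r, by t = a+u \<mapsto> c+l-u
  (orientation reversing), otherwise by a+u \<mapsto> c+u.\<close>

type_synonym gluing = "(real \<times> real \<times> real \<times> bool) list"

definition parc :: "real \<Rightarrow> real \<Rightarrow> real \<Rightarrow> real set" where
  "parc L a l = {t. \<exists>u. 0 < u \<and> u < l \<and> t = modL L (a + u)}"

definition gluing_arcs :: "real \<Rightarrow> gluing \<Rightarrow> real set list" where
  "gluing_arcs L gl = concat (map (\<lambda>(a, c, l, r). [parc L a l, parc L c l]) gl)"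

definition is_gluing :: "nat \<Rightarrow> (nat \<Rightarrow> complex) \<Rightarrow> gluing \<Rightarrow> bool" where
  "is_gluing n v gl \<longleftrightarrow>
     (\<forall>(a, c, l, r) \<in> set gl. 0 < l)
     \<and> (let A = gluing_arcs (perim n v) gl in
          (\<forall>i<length A. \<forall>j<length A. i \<noteq> j \<longrightarrow> A ! i \<inter> A ! j = {})
          \<and> finite ({0..<perim n v} - \<Union>(set A)))"

text \<open>Basic identification (closed arcs, so that endpoints are identified by continuity).\<close>
definition glue_step :: "real \<Rightarrow> gluing \<Rightarrow> real \<Rightarrow> real \<Rightarrow> bool" where
  "glue_step L gl s t \<longleftrightarrow> (\<exists>(a, c, l, r) \<in> set gl. \<exists>u. 0 \<le> u \<and> u \<le> l \<and>
      s = modL L (a + u) \<and> t = modL L (if r then c + l - u else c + u))"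

definition pglued :: "nat \<Rightarrow> (nat \<Rightarrow> complex) \<Rightarrow> gluing \<Rightarrow> real \<Rightarrow> real \<Rightarrow> bool" where
  "pglued n v gl = (\<lambda>x y. glue_step (perim n v) gl x y \<or> glue_step (perim n v) gl y x)\<^sup>*\<^sup>*"

definition pclass :: "nat \<Rightarrow> (nat \<Rightarrow> complex) \<Rightarrow> gluing \<Rightarrow> real \<Rightarrow> real set" where
  "pclass n v gl s = {t \<in> {0..<perim n v}. pglued n v gl s t}"

definition ptglued :: "nat \<Rightarrow> (nat \<Rightarrow> complex) \<Rightarrow> gluing \<Rightarrow> complex \<Rightarrow> complex \<Rightarrow> bool" where
  "ptglued n v gl x y \<longleftrightarrow> x = y \<or>
     (\<exists>s t. s \<in> {0..<perim n v} \<and> t \<in> {0..<perim n v} \<and> bpt n v s = x \<and> bpt n v t = y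
            \<and> pglued n v gl s t)"

definition vec_angle :: "complex \<Rightarrow> complex \<Rightarrow> real" where
  "vec_angle a b = arccos ((a \<bullet> b) / (norm a * norm b))"

definition interior_angle :: "nat \<Rightarrow> (nat \<Rightarrow> complex) \<Rightarrow> nat \<Rightarrow> real" where
  "interior_angle n v i = vec_angle (v (prv n i) - v i) (v (nxt n i) - v i)"

definition face_angle :: "nat \<Rightarrow> (nat \<Rightarrow> complex) \<Rightarrow> real \<Rightarrow> real" where
  "face_angle n v s = (if \<exists>i<n. bpt n v s = v i
                        then interior_angle n v (THE i. i < n \<and> bpt n v s = v i) else pi)"

definition aleksandrov_gluing :: "nat \<Rightarrow> (nat \<Rightarrow> complex) \<Rightarrow> gluing \<Rightarrow> bool" where
  "aleksandrov_gluing n v gl \<longleftrightarrow> is_gluing n v gl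
     \<and> (\<forall>s \<in> {0..<perim n v}. (\<Sum>t \<in> pclass n v gl s. face_angle n v t) \<le> 2 * pi)
     \<and> (\<exists>q :: complex \<Rightarrow> real^3.
          continuous_on (polygon n v) q \<and> q ` polygon n v = sphere 0 1
          \<and> (\<forall>x \<in> polygon n v. \<forall>y \<in> polygon n v. q x = q y \<longleftrightarrow> ptglued n v gl x y))"

text \<open>A labeled graph: nodes, edges (2-element sets of nodes), labels
  (set of vertex indices, set of edge indices of P; edge j joins v j and v (j+1 mod n)).\<close>
type_synonym ltree = "real set set \<times> real set set set \<times> (real set \<Rightarrow> nat set \<times> nat set)"

definition is_vertex_param :: "nat \<Rightarrow> (nat \<Rightarrow> complex) \<Rightarrow> real \<Rightarrow> bool" where
  "is_vertex_param n v s \<longleftrightarrow> (\<exists>i<n. bpt n v s = v i)"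

definition special_param :: "nat \<Rightarrow> (nat \<Rightarrow> complex) \<Rightarrow> gluing \<Rightarrow> real \<Rightarrow> bool" where
  "special_param n v gl s \<longleftrightarrow> s \<in> {0..<perim n v} \<and>
     (card (pclass n v gl s) \<noteq> 2 \<or> (\<exists>t \<in> pclass n v gl s. is_vertex_param n v t))"

definition cyc_between :: "real \<Rightarrow> real \<Rightarrow> real \<Rightarrow> real \<Rightarrow> bool" where
  "cyc_between L s t u \<longleftrightarrow> 0 < modL L (u - s) \<and> modL L (u - s) < modL L (t - s)"

definition gluing_tree :: "nat \<Rightarrow> (nat \<Rightarrow> complex) \<Rightarrow> gluing \<Rightarrow> ltree" where
  "gluing_tree n v gl =
    ( {pclass n v gl s | s. special_param n v gl s},
      {{pclass n v gl s, pclass n v gl t} | s t. special_param n v gl s \<and> special_param n v gl t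
          \<and> s \<noteq> t \<and> \<not> (\<exists>u. special_param n v gl u \<and> cyc_between (perim n v) s t u)},
      (\<lambda>C. ({i. i < n \<and> (\<exists>s\<in>C. bpt n v s = v i)},
             {j. j < n \<and> (\<exists>s\<in>C. bpt n v s \<in> open_segment (v j) (v (nxt n j)))})) )"

definition ltree_iso :: "ltree \<Rightarrow> ltree \<Rightarrow> bool" where
  "ltree_iso T1 T2 \<longleftrightarrow> (case T1 of (N1, E1, l1) \<Rightarrow> case T2 of (N2, E2, l2) \<Rightarrow>
     (\<exists>f. bij_betw f N1 N2 \<and> (\<forall>x\<in>N1. \<forall>y\<in>N1. {x, y} \<in> E1 \<longleftrightarrow> {f x, f y} \<in> E2)
          \<and> (\<forall>x\<in>N1. l2 (f x) = l1 x)))"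

end

theory Submission
  imports Defs
begin

text \<open>Upper bound. In an Aleksandrov gluing of a convex n-gon let a class consist of k boundary points.
  The angle condition makes the turning angles of the vertices in it sum to at least (k - 2) pi, while
  all turning angles are positive and sum to 2 pi. For n at least 7 this leaves at most one class with
  k = 3 and none larger; that class contains two vertices, and if its third point is interior to an
  edge, one of the two turns by at least pi / 2, which at most four vertices do. The Jordan curve theorem
  forces every pair of arcs to be glued with reversed orientation, so away from the class with k = 3 the
  gluing is locally, hence on each complementary arc globally, a reflection. Thus the relation is
  determined by O(n) choices of a pair of vertices and one real parameter, and the tree can only change
  when that parameter passes one of O(n^2) breakpoints; three vertices in one class contribute O(n^3) more.

  Lower bound. Halving the perimeter so that vertex i meets vertex j is always an Aleksandrov gluing,
  and its tree has a node whose label contains i and j. A polygon whose parameters s i + s j take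
  quadratically many values modulo the perimeter therefore has quadratically many distinct trees.\<close>

section \<open>Congruence modulo the perimeter and oriented polygons\<close>

text \<open>The obstacle in the upper bound is that arcs are glued with their ends, so there the
  identification can be multivalued and a class can grow through chains. It is replaced by the
  one-sided map \<open>rho\<close>, which records where the boundary just to the right of a point
  goes. \<open>rho\<close> is injective modulo the perimeter, a class of three points is a 3-cycle
  of \<open>rho\<close>, and \<open>y + rho y\<close> is locally constant where \<open>rho\<close>
  is an involution. The cyclic order of the three points of a junction is then forced by the
  reflections on the gaps between them. The bound 7 arises because two classes of three points would
  use up the whole turning and hence contain all vertices, but they have only six points.
  Breakpoints are essentially sums of two vertex parameters: a tree changes only when two vertices
  become glued or a fold point passes a vertex. Between breakpoints the nodes are followed by
  symbolic names. In the lower bound the edge lengths 1 and m + 1 make a sum of two parameters a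
  two-digit number in base m + 1, up to a shift by m.\<close>

lemma modL_eq_iff:
  assumes "L > 0"
  shows "modL L x = modL L y \<longleftrightarrow> (\<exists>k::int. x = y + of_int k * L)"
proof
  assume "modL L x = modL L y"
  then have "x = y + of_int (\<lfloor>x / L\<rfloor> - \<lfloor>y / L\<rfloor>) * L"
    unfolding modL_def by (simp add: algebra_simps)
  then show "\<exists>k::int. x = y + of_int k * L" by blast
next
  assume "\<exists>k::int. x = y + of_int k * L"
  then obtain k :: int where k: "x = y + of_int k * L" by blast
  then have "x / L = y / L + of_int k"
    using assms by (simp add: field_simps)
  then have "\<lfloor>x / L\<rfloor> = \<lfloor>y / L\<rfloor> + k"
    by (metis floor_add_int)
  then show "modL L x = modL L y"
    using k unfolding modL_def by (simp add: algebra_simps)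
qed

lemma modL_bounds:
  assumes "L > 0"
  shows "0 \<le> modL L x" "modL L x < L"
proof -
  have "of_int \<lfloor>x / L\<rfloor> \<le> x / L" "x / L < of_int \<lfloor>x / L\<rfloor> + 1"
    by linarith+
  then have "of_int \<lfloor>x / L\<rfloor> * L \<le> x" "x < (of_int \<lfloor>x / L\<rfloor> + 1) * L"
    using assms by (simp_all only: pos_le_divide_eq pos_divide_less_eq)
  then show "0 \<le> modL L x" "modL L x < L"
    unfolding modL_def by (simp_all add: algebra_simps)
qed

lemma modL_range: "L > 0 \<Longrightarrow> modL L x \<in> {0..<L}"
  using modL_bounds by simp

lemma modL_id: "0 \<le> x \<Longrightarrow> x < L \<Longrightarrow> modL L x = x"
  unfolding modL_def by (simp add: floor_eq_iff)

lemma modL_ex: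
  obtains k :: int where "modL L x = x + of_int k * L"
  unfolding modL_def by (metis (no_types) add_uminus_conv_diff mult.commute mult_minus_left of_int_minus)

lemma modL_modL [simp]: "L > 0 \<Longrightarrow> modL L (modL L x) = modL L x"
  by (simp add: modL_bounds modL_id)

lemma modL_unique:
  assumes "x = y + of_int k * L" "0 \<le> y" "y < L"
  shows "modL L x = y"
  using assms modL_eq_iff[of L x y] modL_id[of y L] by fastforce

lemma modL_cong_add:
  assumes "L > 0" "modL L x = modL L x'" "modL L y = modL L y'"
  shows "modL L (x + y) = modL L (x' + y')"
proof -
  obtain k k' :: int where "x = x' + of_int k * L" "y = y' + of_int k' * L"
    using assms modL_eq_iff by metis
  then have "x + y = (x' + y') + of_int (k + k') * L" by (simp add: algebra_simps)
  then show ?thesis using modL_eq_iff assms(1) by blast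
qed

lemma modL_cong_diff:
  assumes "L > 0" "modL L x = modL L x'" "modL L y = modL L y'"
  shows "modL L (x - y) = modL L (x' - y')"
proof -
  obtain k k' :: int where "x = x' + of_int k * L" "y = y' + of_int k' * L"
    using assms modL_eq_iff by metis
  then have "x - y = (x' - y') + of_int (k - k') * L" by (simp add: algebra_simps)
  then show ?thesis using modL_eq_iff assms(1) by blast
qed

lemma modL_add_self: "L > 0 \<Longrightarrow> modL L (x + L) = modL L x"
  using modL_eq_iff[of L "x + L" x] by (metis mult_1 of_int_1)

lemma modL_eq_imp_eq:
  assumes "L > 0" "modL L x = modL L y" "\<bar>x - y\<bar> < L"
  shows "x = y"
proof -
  obtain k :: int where k: "x = y + of_int k * L" using assms modL_eq_iff by metis
  have "\<bar>of_int k\<bar> * L < 1 * L" using assms k by (simp add: abs_mult)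
  then have "\<bar>of_int k :: real\<bar> < 1" using assms(1) by (simp only: mult_less_cancel_right)
  then have "k = 0" by linarith
  then show ?thesis using k by simp
qed

section \<open>Cross products, supporting lines and the side form of convexity\<close>

definition cross :: "complex \<Rightarrow> complex \<Rightarrow> real" where
  "cross a b = Re a * Im b - Im a * Re b"

lemma cross_simps:
  "cross (a + a') b = cross a b + cross a' b"
  "cross a (b + b') = cross a b + cross a b'"
  "cross (a - a') b = cross a b - cross a' b"
  "cross a (b - b') = cross a b - cross a b'"
  "cross (- a) b = - cross a b"
  "cross a (- b) = - cross a b"
  "cross a a = 0"
  "cross (of_real r * a) b = r * cross a b"
  "cross a (of_real r * b) = r * cross a b"
  "cross (r *\<^sub>R a) b = r * cross a b"
  "cross a (r *\<^sub>R b) = r * cross a b"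
  "cross 0 b = 0" "cross a 0 = 0"
  by (simp_all add: cross_def algebra_simps)

text \<open>The working form of convexity. \<open>convex_polygon\<close> fixes no direction of
  traversal, so the sign \<open>e\<close> records it (1 for counterclockwise, -1 for clockwise) and
  one strict side condition per edge serves both.\<close>

definition oriented :: "real \<Rightarrow> nat \<Rightarrow> (nat \<Rightarrow> complex) \<Rightarrow> bool" where
  "oriented e n v \<longleftrightarrow> n \<ge> 3 \<and> (e = 1 \<or> e = -1) \<and>
     (\<forall>k<n. \<forall>j<n. j \<noteq> k \<longrightarrow> j \<noteq> nxt n k \<longrightarrow> e * cross (v (nxt n k) - v k) (v j - v k) > 0)"

lemma nxt_less: "n > 0 \<Longrightarrow> nxt n k < n"
  by (simp add: nxt_def)

lemma nxt_Suc: "Suc k < n \<Longrightarrow> nxt n k = Suc k"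
  by (simp add: nxt_def)

lemma nxt_last: "Suc k = n \<Longrightarrow> nxt n k = 0"
  by (simp add: nxt_def)

lemma nxt_cases: "k < n \<Longrightarrow> nxt n k = Suc k \<and> Suc k < n \<or> nxt n k = 0 \<and> Suc k = n"
  using nxt_Suc nxt_last by (metis Suc_lessI)

lemma nxt_neq: "n \<ge> 3 \<Longrightarrow> k < n \<Longrightarrow> nxt n k \<noteq> k"
  using nxt_cases[of k n] by auto

lemma nxt_nxt_neq: "n \<ge> 3 \<Longrightarrow> k < n \<Longrightarrow> nxt n (nxt n k) \<noteq> k"
  using nxt_cases[of k n] nxt_cases[of "nxt n k" n] by auto

lemma nxt_inj: "j < n \<Longrightarrow> k < n \<Longrightarrow> nxt n j = nxt n k \<Longrightarrow> j = k"
  using nxt_cases[of k n] nxt_cases[of j n] by auto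

lemma prv_less: "n > 0 \<Longrightarrow> prv n k < n"
  by (simp add: prv_def)

lemma nxt_prv: "k < n \<Longrightarrow> nxt n (prv n k) = k"
proof -
  assume "k < n"
  then show ?thesis
    by (cases k) (auto simp: nxt_def prv_def)
qed

text \<open>A set with empty interior lies in a line, which supports it at each of its points.
  Otherwise frontier and relative frontier agree and the supporting hyperplane theorem
  applies.\<close>

lemma frontier_half_plane:
  assumes "convex S" "closed S" "p \<in> frontier S"
  obtains a :: complex where "a \<noteq> 0" "\<And>y. y \<in> S \<Longrightarrow> a \<bullet> p \<le> a \<bullet> y"
proof (cases "interior S = {}")
  case True
  obtain a b where "a \<noteq> 0" "S \<subseteq> {x. a \<bullet> x = b}"
    using empty_interior_subset_hyperplane[OF assms(1) True] by blast
  moreover have "p \<in> S" using assms by (metis frontier_subset_closed subsetD)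
  ultimately have "a \<bullet> p \<le> a \<bullet> y" if "y \<in> S" for y
    using subsetD[of S "{x. a \<bullet> x = b}" p] subsetD[of S "{x. a \<bullet> x = b}" y] that by simp
  then show ?thesis using that \<open>a \<noteq> 0\<close> by blast
next
  case False
  have p: "p \<in> closure S" "p \<notin> rel_interior S"
    using assms(3) interior_rel_interior[of S] False
    by (auto simp: frontier_def rel_interior_nonempty_interior)
  show ?thesis
    using supporting_hyperplane_relative_frontier[OF assms(1) p] that closure_subset
    by (metis subsetD)
qed

text \<open>In the plane the functionals vanishing on \<open>d\<close> are the multiples of
  \<open>cross d\<close>; this turns supporting functionals into side conditions.\<close>

lemma perp_cross:
  fixes a d :: complex
  assumes "a \<bullet> d = 0" "d \<noteq> 0" "a \<noteq> 0"
  obtains r where "r \<noteq> 0" "\<And>x. a \<bullet> x = r * cross d x"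
proof -
  define r where "r = (Re d * Im a - Im d * Re a) / (Re d ^ 2 + Im d ^ 2)"
  have pos: "Re d ^ 2 + Im d ^ 2 > 0" using assms(2)
    by (metis complex_eq_iff sum_power2_gt_zero_iff zero_complex.simps(1) zero_complex.simps(2))
  have d0: "Re a * Re d = - Im a * Im d"
    using assms(1) by (simp add: inner_complex_def)
  have "Im a * (Re d ^ 2 + Im d ^ 2) = (Re d * Im a - Im d * Re a) * Re d"
    "Re a * (Re d ^ 2 + Im d ^ 2) = - (Re d * Im a - Im d * Re a) * Im d"
    using d0 by algebra+
  then have A: "Im a = r * Re d" "Re a = - r * Im d"
    using pos unfolding r_def
    by (simp_all only: times_divide_eq_left minus_divide_left eq_divide_eq) auto
  then have "r \<noteq> 0" using assms(3) by (auto simp: complex_eq_iff)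
  moreover have "a \<bullet> x = r * cross d x" for x
    by (simp add: A inner_complex_def cross_def algebra_simps)
  ultimately show ?thesis using that by blast
qed

lemma cross_zero_collinear:
  assumes "cross d x = 0" "d \<noteq> 0"
  obtains t where "x = of_real t * d"
proof -
  have pos: "Re d ^ 2 + Im d ^ 2 > 0" using assms(2)
    by (metis complex_eq_iff sum_power2_gt_zero_iff zero_complex.simps(1) zero_complex.simps(2))
  have eq: "Re d * Im x = Im d * Re x" using assms(1) by (simp add: cross_def)
  define t where "t = (Re x * Re d + Im x * Im d) / (Re d ^ 2 + Im d ^ 2)"
  have "Re x * (Re d ^ 2 + Im d ^ 2) = (Re x * Re d + Im x * Im d) * Re d"
    "Im x * (Re d ^ 2 + Im d ^ 2) = (Re x * Re d + Im x * Im d) * Im d"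
    using eq by algebra+
  then have "Re x = t * Re d" "Im x = t * Im d"
    using pos unfolding t_def by (simp_all only: times_divide_eq_left eq_divide_eq) auto
  then have "x = of_real t * d" by (simp add: complex_eq_iff)
  then show ?thesis using that by blast
qed

lemma convex_polygon_closed: "closed (polygon n v)"
  unfolding polygon_def by (simp add: compact_imp_closed finite_imp_compact_convex_hull)

lemma vertex_in_polygon: "k < n \<Longrightarrow> v k \<in> polygon n v"
  unfolding polygon_def by (simp add: hull_inc)

lemma between_not_extreme:
  assumes "i < n" "j < n" "k < n" "i \<noteq> j" "i \<noteq> k"
    and "v i = v j + of_real t * (v k - v j)" "0 \<le> t" "t \<le> 1"
  shows "v i \<in> convex hull (v ` ({..<n} - {i}))"
proof -
  have "v i \<in> closed_segment (v j) (v k)"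
    unfolding in_segment using assms(6-8)
    by (intro exI[of _ t]) (simp add: scaleR_conv_of_real algebra_simps)
  moreover have "closed_segment (v j) (v k) \<subseteq> convex hull (v ` ({..<n} - {i}))"
    using assms by (intro closed_segment_subset_convex_hull hull_inc) auto
  ultimately show ?thesis by blast
qed

text \<open>A functional supporting the polygon at the midpoint of an edge is constant on that edge,
  which gives the weak inequality. It is strict because of three vertices on one line the middle one
  would not be extreme.\<close>

lemma convex_polygon_edge_side:
  assumes cp: "convex_polygon n v" and k: "k < n"
  shows "\<exists>e. (e = 1 \<or> e = -1) \<and> (\<forall>j<n. j \<noteq> k \<longrightarrow> j \<noteq> nxt n k \<longrightarrow>
           (e::real) * cross (v (nxt n k) - v k) (v j - v k) > 0)"
proof -
  have n3: "n \<ge> 3" and inj: "inj_on v {..<n}"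
    and ext: "\<And>i. i < n \<Longrightarrow> v i \<notin> convex hull (v ` ({..<n} - {i}))"
    and fr: "closed_segment (v k) (v (nxt n k)) \<subseteq> frontier (polygon n v)"
    using cp k unfolding convex_polygon_def by auto
  define l where "l = nxt n k"
  have l: "l < n" "l \<noteq> k" using n3 k nxt_less nxt_neq unfolding l_def by auto
  define d where "d = v l - v k"
  have d0: "d \<noteq> 0" using inj l k unfolding d_def by (auto dest: inj_onD)
  define p where "p = midpoint (v k) (v l)"
  have "p \<in> frontier (polygon n v)" using fr unfolding p_def l_def by auto
  then obtain a where a: "a \<noteq> 0" "\<And>y. y \<in> polygon n v \<Longrightarrow> a \<bullet> p \<le> a \<bullet> y"
    using frontier_half_plane convex_polygon_closed
    by (metis convex_convex_hull polygon_def)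
  have ap: "a \<bullet> p = (a \<bullet> v k + a \<bullet> v l) / 2"
    unfolding p_def midpoint_def by (simp add: inner_right_distrib)
  have "a \<bullet> p \<le> a \<bullet> v k" "a \<bullet> p \<le> a \<bullet> v l"
    using a(2) vertex_in_polygon k l by auto
  then have eq: "a \<bullet> v k = a \<bullet> p" "a \<bullet> v l = a \<bullet> p" using ap by auto
  then have "a \<bullet> d = 0" unfolding d_def by (simp add: inner_diff_right)
  then obtain r where r: "r \<noteq> 0" "\<And>x. a \<bullet> x = r * cross d x"
    using perp_cross d0 a(1) by metis
  have weak: "r * cross d (v j - v k) \<ge> 0" if "j < n" for j
    using a(2)[OF vertex_in_polygon[OF that]] eq r(2)[of "v j - v k"]
    by (simp add: inner_diff_right)
  have nz: "cross d (v j - v k) \<noteq> 0" if j: "j < n" "j \<noteq> k" "j \<noteq> l" for j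
  proof
    assume "cross d (v j - v k) = 0"
    then obtain t where t: "v j - v k = of_real t * d"
      using cross_zero_collinear d0 by blast
    consider "t < 0" | "0 \<le> t \<and> t \<le> 1" | "1 < t" by linarith
    then show False
    proof cases
      case 1
      have "v k = v j + of_real (t / (t - 1)) * (v l - v j)"
      proof -
        have "v l - v j = (1 - of_real t) * d" using t unfolding d_def by (simp add: algebra_simps)
        then have "of_real (t / (t - 1)) * (v l - v j) = of_real (t / (t - 1) * (1 - t)) * d" by simp
        also have "t / (t - 1) * (1 - t) = - t" using 1 by (simp add: field_simps)
        finally show ?thesis using t by (simp add: diff_eq_eq)
      qed
      moreover have "0 \<le> t / (t - 1)" "t / (t - 1) \<le> 1" using 1 by (simp_all add: divide_simps)
      ultimately show False using between_not_extreme[of k n j l v] ext[OF k] j l k by metis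
    next
      case 2
      have "v j = v k + of_real t * (v l - v k)" using t unfolding d_def by (simp add: algebra_simps)
      then show False using between_not_extreme[of j n k l v] ext[OF j(1)] j l k 2 by blast
    next
      case 3
      have "v l = v k + of_real (1 / t) * (v j - v k)" using t 3 unfolding d_def by simp
      moreover have "0 \<le> 1 / t" "1 / t \<le> 1" using 3 by (simp_all add: divide_simps)
      ultimately show False using between_not_extreme[of l n k j v] ext[OF l(1)] j l k by metis
    qed
  qed
  have "sgn r * cross d (v j - v k) > 0" if j: "j < n" "j \<noteq> k" "j \<noteq> l" for j
    using weak[OF j(1)] nz[OF j] r(1)
    by (cases "r > 0") (auto simp: sgn_if zero_le_mult_iff)
  moreover have "sgn r = 1 \<or> sgn r = -1" using r(1) by (auto simp: sgn_if)
  ultimately show ?thesis unfolding d_def l_def by blast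
qed

text \<open>A priori each edge has its own sign. Consecutive edges agree because both signs are read
  off from the triangle spanned by their three endpoints.\<close>

lemma convex_polygon_oriented:
  assumes cp: "convex_polygon n v"
  obtains e where "oriented e n v"
proof -
  have n3: "n \<ge> 3" using cp unfolding convex_polygon_def by auto
  define side where "side e k \<longleftrightarrow> (\<forall>j<n. j \<noteq> k \<longrightarrow> j \<noteq> nxt n k \<longrightarrow>
           (e::real) * cross (v (nxt n k) - v k) (v j - v k) > 0)" for e k
  obtain e where e: "e = 1 \<or> e = -1" "side e 0"
    using convex_polygon_edge_side[OF cp, of 0] n3 unfolding side_def by auto
  have "side e k" if "k < n" for k
    using that
  proof (induction k)
    case 0
    then show ?case using e by blast
  next
    case (Suc k)
    then have IH: "side e k" by simp
    have nk: "nxt n k = Suc k" using Suc.prems nxt_Suc by blast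
    define m where "m = nxt n (Suc k)"
    have m: "m < n" "m \<noteq> Suc k" "m \<noteq> k"
      using n3 Suc.prems nxt_less nxt_neq nxt_nxt_neq[of n k] nk unfolding m_def by auto
    obtain e' where e': "e' = 1 \<or> e' = -1" "side e' (Suc k)"
      using convex_polygon_edge_side[OF cp Suc.prems] unfolding side_def by auto
    have "e * cross (v (Suc k) - v k) (v m - v k) > 0"
      using IH m nk unfolding side_def by auto
    moreover have "e' * cross (v m - v (Suc k)) (v k - v (Suc k)) > 0"
      using e'(2) m Suc.prems unfolding side_def m_def by auto
    moreover have "cross (v (Suc k) - v k) (v m - v k) = cross (v m - v (Suc k)) (v k - v (Suc k))"
      by (simp add: cross_def algebra_simps)
    ultimately have "e = e'" using e(1) e'(1) by auto
    then show ?case using e' by simp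
  qed
  then have "oriented e n v" using e(1) n3 unfolding oriented_def side_def by blast
  then show ?thesis using that by blast
qed

lemma cross_inner: "cross w x = Complex (- Im w) (Re w) \<bullet> x"
  by (simp add: cross_def inner_complex_def)

locale opoly =
  fixes n :: nat and v :: "nat \<Rightarrow> complex" and e :: real
  assumes oriented: "oriented e n v"
begin

lemma n3: "n \<ge> 3" and e_cases: "e = 1 \<or> e = -1"
  using oriented unfolding oriented_def by auto

lemma n_pos: "n > 0" using n3 by simp

lemma left_strict:
  "k < n \<Longrightarrow> j < n \<Longrightarrow> j \<noteq> k \<Longrightarrow> j \<noteq> nxt n k \<Longrightarrow> e * cross (edgev n v k) (v j - v k) > 0"
  using oriented unfolding oriented_def edgev_def by auto

lemma left_weak: "k < n \<Longrightarrow> j < n \<Longrightarrow> e * cross (edgev n v k) (v j - v k) \<ge> 0"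
  using left_strict[of k j]
  by (cases "j = k"; cases "j = nxt n k") (auto simp: edgev_def cross_simps)

lemma half_plane: "k < n \<Longrightarrow> x \<in> polygon n v \<Longrightarrow> e * cross (edgev n v k) (x - v k) \<ge> 0"
proof -
  assume k: "k < n" and x: "x \<in> polygon n v"
  define a where "a = e *\<^sub>R Complex (- Im (edgev n v k)) (Re (edgev n v k))"
  have a: "e * cross (edgev n v k) (y - v k) = a \<bullet> y - a \<bullet> v k" for y
    unfolding cross_inner a_def by (simp add: inner_diff_right algebra_simps)
  have "polygon n v \<subseteq> {y. a \<bullet> y \<ge> a \<bullet> v k}"
    unfolding polygon_def using left_weak[OF k] a
    by (intro hull_minimal convex_halfspace_ge) auto
  then show ?thesis using x a by auto
qed

text \<open>Adding the half-plane forms of the two edges at a vertex gives a linear form that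
  exposes it.\<close>

lemma exposing_form:
  assumes "i < n" "j < n" "j \<noteq> i"
  shows "e * cross (edgev n v i + edgev n v (prv n i)) (v j - v i) > 0"
proof -
  define p where "p = prv n i"
  have p: "p < n" "nxt n p = i" "p \<noteq> i"
    using assms n3 prv_less nxt_prv nxt_neq unfolding p_def by (auto, metis)
  have dp: "edgev n v p = v i - v p" using p unfolding edgev_def by simp
  have A: "cross (edgev n v p) (v j - v i) = cross (edgev n v p) (v j - v p)" for j
    unfolding dp by (simp add: cross_def algebra_simps)
  have 1: "e * cross (edgev n v i) (v j - v i) \<ge> 0" "e * cross (edgev n v p) (v j - v i) \<ge> 0"
    using left_weak assms p A by auto
  have "e * cross (edgev n v i) (v j - v i) > 0 \<or> e * cross (edgev n v p) (v j - v i) > 0"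
  proof (cases "j = nxt n i")
    case True
    then have "j \<noteq> p" using nxt_nxt_neq[OF n3 p(1)] p by auto
    then show ?thesis using left_strict[of p j] assms p A by auto
  next
    case False
    then show ?thesis using left_strict[of i j] assms by auto
  qed
  then have "e * cross (edgev n v i) (v j - v i) + e * cross (edgev n v p) (v j - v i) > 0"
    using 1 by linarith
  then show ?thesis unfolding p_def by (simp only: cross_simps(1) distrib_left)
qed

lemma inj_v: "inj_on v {..<n}"
proof (rule inj_onI)
  fix i j assume "i \<in> {..<n}" "j \<in> {..<n}" "v i = v j"
  then show "i = j" using exposing_form[of i j] by (cases "i = j") (auto simp: cross_simps)
qed

lemma v_eq_iff: "i < n \<Longrightarrow> j < n \<Longrightarrow> v i = v j \<longleftrightarrow> i = j"
  using inj_v by (auto dest: inj_onD)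

lemma edge_nz: "k < n \<Longrightarrow> edgev n v k \<noteq> 0"
  using v_eq_iff[of "nxt n k" k] nxt_less[OF n_pos] nxt_neq[OF n3] unfolding edgev_def by auto

lemma extreme: "i < n \<Longrightarrow> v i \<notin> convex hull (v ` ({..<n} - {i}))"
proof
  assume i: "i < n" and h: "v i \<in> convex hull (v ` ({..<n} - {i}))"
  define w where "w = edgev n v i + edgev n v (prv n i)"
  define a where "a = e *\<^sub>R Complex (- Im w) (Re w)"
  have a: "e * cross w (y - v i) = a \<bullet> y - a \<bullet> v i" for y
    unfolding cross_inner a_def by (simp add: inner_diff_right algebra_simps)
  have "convex hull (v ` ({..<n} - {i})) \<subseteq> {y. a \<bullet> y > a \<bullet> v i}"
    using exposing_form[OF i] a unfolding w_def
    by (intro hull_minimal convex_halfspace_gt) force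
  then show False using h by auto
qed

lemma edge_subset_frontier:
  assumes k: "k < n"
  shows "closed_segment (v k) (v (nxt n k)) \<subseteq> frontier (polygon n v)"
proof
  fix x assume x: "x \<in> closed_segment (v k) (v (nxt n k))"
  have sub: "closed_segment (v k) (v (nxt n k)) \<subseteq> polygon n v"
    unfolding polygon_def using k nxt_less[OF n_pos]
    by (intro closed_segment_subset_convex_hull hull_inc) auto
  define a where "a = e *\<^sub>R Complex (- Im (edgev n v k)) (Re (edgev n v k))"
  have a: "e * cross (edgev n v k) (y - v k) = a \<bullet> y - a \<bullet> v k" for y
    unfolding cross_inner a_def by (simp add: inner_diff_right algebra_simps)
  have a0: "a \<noteq> 0" using edge_nz[OF k] e_cases unfolding a_def by (auto simp: complex_eq_iff)
  have "polygon n v \<subseteq> {y. a \<bullet> y \<ge> a \<bullet> v k}" using half_plane[OF k] a by auto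
  then have "interior (polygon n v) \<subseteq> {y. a \<bullet> y > a \<bullet> v k}"
    using interior_mono interior_halfspace_ge[OF a0] by metis
  moreover have "a \<bullet> x = a \<bullet> v k"
  proof -
    obtain u where "x = (1 - u) *\<^sub>R v k + u *\<^sub>R v (nxt n k)" using x unfolding in_segment by blast
    then have "x - v k = u *\<^sub>R edgev n v k"
      unfolding edgev_def by (simp add: scaleR_conv_of_real algebra_simps)
    then have "cross (edgev n v k) (x - v k) = 0" by (simp add: cross_simps)
    then show ?thesis using a[of x] by simp
  qed
  ultimately have "x \<notin> interior (polygon n v)" by auto
  then show "x \<in> frontier (polygon n v)"
    using sub x closure_subset unfolding frontier_def by blast
qed

text \<open>The way back from side conditions, by which the polygons of the lower bound are
  certified.\<close>

lemma convex_polygon: "convex_polygon n v"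
  unfolding convex_polygon_def using n3 inj_v extreme edge_subset_frontier by blast

text \<open>Otherwise the two neighbours of \<open>v i\<close> would lie strictly on opposite sides
  of the line through \<open>v i\<close> and \<open>v j\<close>, which has all vertices on one
  side.\<close>

lemma supporting_line_vertices_adjacent:
  assumes a: "a \<noteq> 0" "\<And>m. m < n \<Longrightarrow> a \<bullet> v i \<le> a \<bullet> v m"
    and ij: "i < n" "j < n" "i \<noteq> j" "a \<bullet> v j = a \<bullet> v i"
  shows "j = nxt n i \<or> i = nxt n j"
proof (rule ccontr)
  assume c: "\<not> (j = nxt n i \<or> i = nxt n j)"
  define d where "d = v j - v i"
  have "d \<noteq> 0" using ij v_eq_iff unfolding d_def by auto
  moreover have "a \<bullet> d = 0" using ij unfolding d_def by (simp add: inner_diff_right)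
  ultimately obtain r where r: "r \<noteq> 0" "\<And>x. a \<bullet> x = r * cross d x"
    using perp_cross a(1) by metis
  have ge: "r * cross d (v m - v i) \<ge> 0" if "m < n" for m
    using a(2)[OF that] r(2)[of "v m - v i"] by (simp add: inner_diff_right)
  define p where "p = prv n i"
  have p: "p < n" "nxt n p = i" using ij n_pos prv_less nxt_prv unfolding p_def by auto
  have "e * cross (edgev n v i) (v j - v i) > 0" using left_strict ij c by auto
  then have 1: "e * cross d (v (nxt n i) - v i) < 0"
    unfolding edgev_def d_def by (simp add: cross_def algebra_simps)
  have "e * cross (edgev n v p) (v j - v p) > 0"
    using left_strict[of p j] ij c p by auto
  then have 2: "e * cross d (v p - v i) > 0"
    unfolding edgev_def d_def p by (simp add: cross_def algebra_simps)
  have 3: "0 \<le> r * cross d (v (nxt n i) - v i)" "0 \<le> r * cross d (v p - v i)"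
    using ge p nxt_less[OF n_pos] by auto
  show False using 1 2 3 e_cases r(1) by (auto simp: zero_le_mult_iff)
qed

text \<open>A functional supporting the polygon at \<open>p\<close> is minimal there, so a convex
  combination representing \<open>p\<close> has weight only on the vertices in \<open>J\<close>
  where the minimum is attained, and these are at most the two ends of an edge.\<close>

lemma frontier_eq: "frontier (polygon n v) = (\<Union>k<n. closed_segment (v k) (v (nxt n k)))"
proof
  show "(\<Union>k<n. closed_segment (v k) (v (nxt n k))) \<subseteq> frontier (polygon n v)"
    using edge_subset_frontier by blast
  show "frontier (polygon n v) \<subseteq> (\<Union>k<n. closed_segment (v k) (v (nxt n k)))"
  proof
    fix p assume p: "p \<in> frontier (polygon n v)"
    obtain a where a: "a \<noteq> 0" "\<And>y. y \<in> polygon n v \<Longrightarrow> a \<bullet> p \<le> a \<bullet> y"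
      using frontier_half_plane[OF _ convex_polygon_closed p] by (metis convex_convex_hull polygon_def)
    have av: "a \<bullet> p \<le> a \<bullet> v m" if "m < n" for m using a(2) vertex_in_polygon that by blast
    define J where "J = {j. j < n \<and> a \<bullet> v j = a \<bullet> p}"
    have "p \<in> polygon n v" using p convex_polygon_closed frontier_subset_closed by blast
    then have "p \<in> convex hull (v ` J)"
    proof -
      assume "p \<in> polygon n v"
      then obtain u where u: "\<forall>x\<in>v ` {..<n}. 0 \<le> u x" "sum u (v ` {..<n}) = 1"
        "(\<Sum>x\<in>v ` {..<n}. u x *\<^sub>R x) = p"
        unfolding polygon_def using convex_hull_finite[of "v ` {..<n}"] by auto
      have "(\<Sum>x\<in>v ` {..<n}. u x * (a \<bullet> x - a \<bullet> p)) = a \<bullet> (\<Sum>x\<in>v ` {..<n}. u x *\<^sub>R x) - (a \<bullet> p) * sum u (v ` {..<n})"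
        by (simp add: inner_sum_right right_diff_distrib sum_subtractf sum_distrib_left mult.commute)
      also have "\<dots> = 0" using u by simp
      finally have "(\<Sum>x\<in>v ` {..<n}. u x * (a \<bullet> x - a \<bullet> p)) = 0" .
      moreover have "u x * (a \<bullet> x - a \<bullet> p) \<ge> 0" if "x \<in> v ` {..<n}" for x
        using that u(1) av by auto
      ultimately have z: "u x * (a \<bullet> x - a \<bullet> p) = 0" if "x \<in> v ` {..<n}" for x
        using that sum_nonneg_eq_0_iff[of "v ` {..<n}" "\<lambda>x. u x * (a \<bullet> x - a \<bullet> p)"] by blast
      have JJ: "v ` J \<subseteq> v ` {..<n}" unfolding J_def by auto
      have z2: "u x = 0" if "x \<in> v ` {..<n} - v ` J" for x
        using that z[of x] unfolding J_def by auto
      have "sum u (v ` J) = 1" "(\<Sum>x\<in>v ` J. u x *\<^sub>R x) = p"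
        using u(2,3) sum.mono_neutral_left[OF _ JJ, of u] z2
          sum.mono_neutral_left[OF _ JJ, of "\<lambda>x. u x *\<^sub>R x"] by auto
      moreover have "finite (v ` J)" unfolding J_def by simp
      ultimately show ?thesis using u(1) JJ
        by (subst convex_hull_finite) (auto intro!: exI[of _ u])
    qed
    moreover have "J \<noteq> {}" using \<open>p \<in> convex hull (v ` J)\<close> by auto
    moreover have "\<exists>k<n. J \<subseteq> {k, nxt n k}"
    proof -
      obtain i where i: "i \<in> J" using \<open>J \<noteq> {}\<close> by blast
      show ?thesis
      proof (cases "J = {i}")
        case True then show ?thesis using i unfolding J_def by auto
      next
        case False
        then obtain j where j: "j \<in> J" "j \<noteq> i" using i by blast
        have "j = nxt n i \<or> i = nxt n j"
          using supporting_line_vertices_adjacent[of a i j] a(1) av i j unfolding J_def by auto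
        then obtain k where k: "k \<in> J" "nxt n k \<in> J" "{i, j} = {k, nxt n k}" using i j by blast
        have kn: "k < n" "nxt n k < n" using k unfolding J_def by auto
        have "a \<bullet> edgev n v k = 0" using k unfolding J_def edgev_def by (simp add: inner_diff_right)
        then obtain r where r: "r \<noteq> 0" "\<And>x. a \<bullet> x = r * cross (edgev n v k) x"
          using perp_cross a(1) edge_nz kn by metis
        have "m \<in> {k, nxt n k}" if m: "m \<in> J" for m
        proof (rule ccontr)
          assume "m \<notin> {k, nxt n k}"
          then have "cross (edgev n v k) (v m - v k) \<noteq> 0"
            using left_strict[of k m] kn m unfolding J_def by auto
          moreover have "a \<bullet> (v m - v k) = 0"
            using m k unfolding J_def by (simp add: inner_diff_right)
          ultimately show False using r by simp
        qed
        then show ?thesis using kn by blast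
      qed
    qed
    ultimately obtain k where "k < n" "p \<in> convex hull (v ` {k, nxt n k})"
      by (meson hull_mono image_mono subsetD)
    then show "p \<in> (\<Union>k<n. closed_segment (v k) (v (nxt n k)))"
      by (auto simp: segment_convex_hull)
  qed
qed

lemma interior_nonempty: "interior (polygon n v) \<noteq> {}"
proof
  assume "interior (polygon n v) = {}"
  then obtain a b where a: "a \<noteq> 0" "polygon n v \<subseteq> {x. a \<bullet> x = b}"
    using empty_interior_subset_hyperplane[of "polygon n v"] unfolding polygon_def
    by (metis convex_convex_hull)
  have eq: "a \<bullet> v j = b" if "j < n" for j using a(2) vertex_in_polygon[OF that] by auto
  have "a \<bullet> edgev n v 0 = 0" using eq nxt_less[OF n_pos] n_pos unfolding edgev_def
    by (simp add: inner_diff_right)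
  then obtain r where r: "r \<noteq> 0" "\<And>x. a \<bullet> x = r * cross (edgev n v 0) x"
    using perp_cross a(1) edge_nz n_pos by metis
  have "a \<bullet> (v 2 - v 0) = 0" using eq n3 by (simp add: inner_diff_right)
  moreover have "cross (edgev n v 0) (v 2 - v 0) \<noteq> 0"
    using left_strict[of 0 2] n3 nxt_Suc[of 0 n] by auto
  ultimately show False using r by simp
qed

end

section \<open>Arc length and polar coordinates\<close>

context opoly
begin

abbreviation "L \<equiv> perim n v"
abbreviation "vp k \<equiv> plen n v k"

lemma elen_pos: "k < n \<Longrightarrow> cmod (edgev n v k) > 0"
  using edge_nz by simp

lemma plen_0 [simp]: "vp 0 = 0"
  by (simp add: plen_def)

lemma plen_Suc: "vp (Suc k) = vp k + cmod (edgev n v k)"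
  by (simp add: plen_def)

lemma plen_less: "i < j \<Longrightarrow> j \<le> n \<Longrightarrow> vp i < vp j"
proof (induction j)
  case (Suc j)
  then have "vp j < vp (Suc j)" using elen_pos[of j] plen_Suc by simp
  then show ?case using Suc by (cases "i = j") auto
qed simp

lemma plen_less_iff: "i \<le> n \<Longrightarrow> j \<le> n \<Longrightarrow> vp i < vp j \<longleftrightarrow> i < j"
  using plen_less by (metis less_asym linorder_neqE_nat)

lemma plen_eq_iff: "i \<le> n \<Longrightarrow> j \<le> n \<Longrightarrow> vp i = vp j \<longleftrightarrow> i = j"
  using plen_less_iff by (metis linorder_neqE_nat less_irrefl)

lemma plen_n: "vp n = L"
  by (simp add: perim_def)

lemma L_pos: "L > 0"
  using plen_less[of 0 n] n_pos plen_n by simp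

lemma modL_shift: "modL L (b + modL L (t - b)) = modL L t"
proof -
  have "modL L (b + modL L (t - b)) = modL L (b + (t - b))"
    using L_pos by (intro modL_cong_add) auto
  then show ?thesis by simp
qed

lemma modL_unshift: "modL L (modL L (b + y) - b) = modL L y"
proof -
  have "modL L (modL L (b + y) - b) = modL L (b + y - b)"
    using L_pos by (intro modL_cong_diff) auto
  then show ?thesis by simp
qed

lemma plen_range: "k < n \<Longrightarrow> vp k \<in> {0..<L}"
  using plen_less_iff[of k n] plen_less_iff[of 0 k] plen_n
  by (cases "k = 0") (auto simp: L_pos less_eq_real_def)

lemma edge_index:
  assumes "0 \<le> s" "s < L"
  obtains k where "k < n" "vp k \<le> s" "s < vp (Suc k)"
proof -
  define k where "k = (LEAST k. s < vp (Suc k))"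
  have ex: "s < vp (Suc (n - 1))" using assms n_pos plen_n by simp
  then have k: "s < vp (Suc k)" unfolding k_def by (rule LeastI[where P = "\<lambda>k. s < vp (Suc k)"])
  have "k \<le> n - 1" unfolding k_def by (rule Least_le[where P = "\<lambda>k. s < vp (Suc k)", OF ex])
  moreover have "vp k \<le> s"
  proof (cases k)
    case (Suc m)
    then show ?thesis using not_less_Least[of m "\<lambda>k. s < vp (Suc k)"] unfolding k_def by simp
  qed (use assms in simp)
  ultimately show ?thesis using that[of k] k n_pos by simp
qed

lemma bpt_on_edge:
  assumes k: "k < n" "vp k \<le> s" "s < vp (Suc k)"
  shows "bpt n v s = v k + of_real ((s - vp k) / cmod (edgev n v k)) * edgev n v k"
proof -
  have "0 \<le> s" using k plen_range[of k] by auto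
  moreover have "s < L" using k plen_less_iff[of "Suc k" n] plen_n by (cases "Suc k = n") auto
  ultimately have m: "modL L s = s" by (rule modL_id)
  have "(LEAST k. s < vp (Suc k)) = k"
  proof (rule Least_equality[where P = "\<lambda>k. s < vp (Suc k)", OF k(3)])
    fix y assume y: "s < vp (Suc y)"
    show "k \<le> y"
    proof (rule ccontr)
      assume "\<not> k \<le> y"
      then have "vp (Suc y) \<le> vp k" using plen_less_iff[of "Suc y" k] k(1) by (cases "Suc y = k") auto
      then show False using y k by linarith
    qed
  qed
  then show ?thesis unfolding bpt_def m Let_def by simp
qed

lemma bpt_modL: "bpt n v (modL L s) = bpt n v s"
  unfolding bpt_def by (simp add: L_pos)

lemma bpt_cong: "modL L s = modL L t \<Longrightarrow> bpt n v s = bpt n v t"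
  by (metis bpt_modL)

lemma bpt_plen: "k < n \<Longrightarrow> bpt n v (vp k) = v k"
  using bpt_on_edge[of k "vp k"] plen_less_iff[of k "Suc k"] by simp

lemma bpt_plen_nxt: "k < n \<Longrightarrow> bpt n v (vp (Suc k)) = v (nxt n k)"
proof -
  assume k: "k < n"
  show ?thesis
  proof (cases "Suc k = n")
    case True
    have "bpt n v (vp (Suc k)) = bpt n v 0"
      using True plen_n bpt_cong[of L 0] L_pos modL_add_self[of L 0] by simp
    also have "\<dots> = v 0" using bpt_plen[of 0] n_pos by simp
    finally show ?thesis using nxt_last[OF True] by simp
  next
    case False
    then show ?thesis using bpt_plen[of "Suc k"] k nxt_Suc[of k n] by simp
  qed
qed

lemma bpt_on_closed_edge:
  assumes k: "k < n" "vp k \<le> s" "s \<le> vp (Suc k)"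
  shows "bpt n v s = v k + of_real ((s - vp k) / cmod (edgev n v k)) * edgev n v k"
proof (cases "s = vp (Suc k)")
  case True
  then show ?thesis using bpt_plen_nxt[OF k(1)] elen_pos[OF k(1)] plen_Suc[of k]
    by (simp add: edgev_def)
qed (use bpt_on_edge k in auto)

text \<open>One period is handled edge by edge and the others by periodicity. Two adjacent periods
  are joined so that also a multiple of \<open>L\<close>, where the last edge meets the first, is an
  interior point.\<close>

lemma continuous_on_bpt: "continuous_on UNIV (bpt n v)"
proof -
  have "continuous_on {0..vp k} (bpt n v)" if "k \<le> n" for k
    using that
  proof (induction k)
    case (Suc k)
    have "continuous_on {vp k..vp (Suc k)}
       (\<lambda>s. v k + of_real ((s - vp k) / cmod (edgev n v k)) * edgev n v k)"
      using elen_pos[of k] Suc.prems by (intro continuous_intros) auto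
    then have "continuous_on {vp k..vp (Suc k)} (bpt n v)"
      by (subst continuous_on_cong[OF refl bpt_on_closed_edge[of k]]) (use Suc.prems in auto)
    then have "continuous_on ({0..vp k} \<union> {vp k..vp (Suc k)}) (bpt n v)"
      using Suc by (intro continuous_on_closed_Un) auto
    moreover have "{0..vp k} \<union> {vp k..vp (Suc k)} = {0..vp (Suc k)}"
      using plen_less[of k "Suc k"] plen_range[of k] Suc.prems by auto
    ultimately show ?case by simp
  qed simp
  from this[of n] have base: "continuous_on {0..L} (bpt n v)" using plen_n by simp
  have shift: "continuous_on {of_int m * L..of_int (m + 1) * L} (bpt n v)" for m :: int
  proof -
    have "continuous_on {of_int m * L..of_int (m + 1) * L} (bpt n v \<circ> (\<lambda>s. s - of_int m * L))"
      by (intro continuous_on_compose continuous_on_subset[OF base] continuous_intros)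
        (auto simp: algebra_simps)
    moreover have "(bpt n v \<circ> (\<lambda>s. s - of_int m * L)) = bpt n v"
    proof
      fix s show "(bpt n v \<circ> (\<lambda>s. s - of_int m * L)) s = bpt n v s"
        using modL_eq_iff[OF L_pos, of s "s - of_int m * L"] bpt_cong[of s "s - of_int m * L"] by auto
    qed
    ultimately show ?thesis by simp
  qed
  show ?thesis
  proof (rule continuous_at_imp_continuous_on, rule ballI)
    fix t :: real
    define m where "m = \<lfloor>t / L\<rfloor>"
    have "of_int m \<le> t / L" "t / L < of_int m + 1" unfolding m_def by linarith+
    then have t: "of_int m * L \<le> t" "t < (of_int m + 1) * L"
      using L_pos by (simp_all only: pos_le_divide_eq pos_divide_less_eq)
    have "continuous_on ({of_int (m - 1) * L..of_int m * L} \<union> {of_int m * L..of_int (m + 1) * L}) (bpt n v)"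
      using shift[of m] shift[of "m - 1"] by (intro continuous_on_closed_Un) auto
    then have "continuous_on {of_int (m - 1) * L<..<of_int (m + 1) * L} (bpt n v)"
      by (rule continuous_on_subset) auto
    moreover have "t \<in> {of_int (m - 1) * L<..<of_int (m + 1) * L}"
      using t L_pos by (auto simp: algebra_simps)
    ultimately show "isCont (bpt n v) t"
      by (simp add: continuous_on_eq_continuous_at)
  qed
qed

lemma bpt_edge_param:
  assumes "k < n" "0 \<le> u" "u \<le> 1"
  shows "bpt n v (vp k + u * cmod (edgev n v k)) = v k + of_real u * edgev n v k"
  using assms bpt_on_closed_edge[of k "vp k + u * cmod (edgev n v k)"] elen_pos[of k] plen_Suc[of k]
  by (simp add: mult_left_le_one_le)

text \<open>If two different edges met, the side form of edge \<open>k\<close> would vanish at the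
  common point. It is nonnegative at both ends of edge \<open>l\<close>, which forces
  \<open>l = nxt n k\<close>, then \<open>w = 0\<close>, and finally \<open>u = 1\<close>.\<close>

lemma half_open_edges_disjoint:
  assumes k: "k < n" "l < n" "0 \<le> u" "u < 1" "0 \<le> w" "w < 1"
    and eq: "v k + of_real u * edgev n v k = v l + of_real w * edgev n v l"
  shows "k = l \<and> u = w"
proof (rule ccontr)
  assume neg: "\<not> (k = l \<and> u = w)"
  have kl: "k \<noteq> l"
  proof
    assume "k = l"
    then have "(of_real u - of_real w) * edgev n v k = 0" using eq by (simp add: algebra_simps)
    then have "u = w" using edge_nz k by simp
    then show False using neg \<open>k = l\<close> by simp
  qed
  define f where "f x = e * cross (edgev n v k) (x - v k)" for x
  have "f (v k + of_real u * edgev n v k) = 0" unfolding f_def by (simp add: cross_simps)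
  moreover have "f (v l + of_real w * edgev n v l) = (1 - w) * f (v l) + w * f (v (nxt n l))"
    unfolding f_def edgev_def by (simp add: cross_simps algebra_simps)
  ultimately have sum0: "(1 - w) * f (v l) + w * f (v (nxt n l)) = 0" using eq by simp
  have nn: "f (v l) \<ge> 0" "f (v (nxt n l)) \<ge> 0"
    using left_weak k nxt_less[OF n_pos] unfolding f_def by auto
  then have fl: "(1 - w) * f (v l) = 0" "w * f (v (nxt n l)) = 0"
    using sum0 k add_nonneg_eq_0_iff[of "(1 - w) * f (v l)" "w * f (v (nxt n l))"] by auto
  then have "f (v l) = 0" using k by simp
  then have l: "l = nxt n k" using left_strict[of k l] k kl unfolding f_def by fastforce
  have "nxt n l \<noteq> k" "nxt n l \<noteq> l"
    using nxt_nxt_neq[OF n3 k(1)] nxt_neq[OF n3 k(2)] l by auto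
  then have "f (v (nxt n l)) > 0"
    using left_strict[of k "nxt n l"] k nxt_less[OF n_pos] l unfolding f_def by auto
  then have "w = 0" using fl by simp
  then have "v k + of_real u * edgev n v k = v k + 1 * edgev n v k"
    using eq l unfolding edgev_def by simp
  then have "(of_real u - 1) * edgev n v k = 0" by (simp add: algebra_simps)
  then show False using edge_nz k by simp
qed

lemma bpt_rep:
  assumes "0 \<le> s" "s < L"
  obtains k u where "k < n" "0 \<le> u" "u < 1" "s = vp k + u * cmod (edgev n v k)"
proof -
  obtain k where k: "k < n" "vp k \<le> s" "s < vp (Suc k)" using edge_index assms by blast
  define u where "u = (s - vp k) / cmod (edgev n v k)"
  have "0 \<le> u" "u < 1" "s = vp k + u * cmod (edgev n v k)"
    using k elen_pos[of k] plen_Suc[of k] unfolding u_def by (simp_all add: divide_simps)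
  then show ?thesis using that k by blast
qed

lemma inj_bpt: "inj_on (bpt n v) {0..<L}"
proof (rule inj_onI)
  fix s t assume st: "s \<in> {0..<L}" "t \<in> {0..<L}" "bpt n v s = bpt n v t"
  obtain k u where k: "k < n" "0 \<le> u" "u < 1" "s = vp k + u * cmod (edgev n v k)"
    using bpt_rep st by (metis atLeastLessThan_iff)
  obtain l w where l: "l < n" "0 \<le> w" "w < 1" "t = vp l + w * cmod (edgev n v l)"
    using bpt_rep st by (metis atLeastLessThan_iff)
  show "s = t"
    using half_open_edges_disjoint[of k l u w] bpt_edge_param[of k u] bpt_edge_param[of l w] st k l
    by simp
qed

lemma bpt_eq_iff: "bpt n v s = bpt n v t \<longleftrightarrow> modL L s = modL L t"
  using inj_bpt modL_range[OF L_pos] by (metis bpt_modL inj_onD)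

lemma bpt_image: "bpt n v ` {0..<L} = frontier (polygon n v)"
proof
  show "bpt n v ` {0..<L} \<subseteq> frontier (polygon n v)"
  proof
    fix x assume "x \<in> bpt n v ` {0..<L}"
    then obtain s where s: "s \<in> {0..<L}" "x = bpt n v s" by blast
    obtain k u where k: "k < n" "0 \<le> u" "u < 1" "s = vp k + u * cmod (edgev n v k)"
      using bpt_rep s by (metis atLeastLessThan_iff)
    have "x = (1 - u) *\<^sub>R v k + u *\<^sub>R v (nxt n k)"
      using bpt_edge_param[of k u] k s by (simp add: edgev_def scaleR_conv_of_real algebra_simps)
    then have "x \<in> closed_segment (v k) (v (nxt n k))" using k unfolding in_segment by auto
    then show "x \<in> frontier (polygon n v)" using edge_subset_frontier k by blast
  qed
  show "frontier (polygon n v) \<subseteq> bpt n v ` {0..<L}"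
  proof
    fix x assume "x \<in> frontier (polygon n v)"
    then obtain k where k: "k < n" "x \<in> closed_segment (v k) (v (nxt n k))"
      using frontier_eq by auto
    then obtain u where u: "0 \<le> u" "u \<le> 1" "x = (1 - u) *\<^sub>R v k + u *\<^sub>R v (nxt n k)"
      unfolding in_segment by auto
    have "x = v k + of_real u * edgev n v k"
      using u by (simp add: edgev_def scaleR_conv_of_real algebra_simps)
    then have "x = bpt n v (vp k + u * cmod (edgev n v k))"
      using bpt_edge_param[of k u] k u by simp
    then show "x \<in> bpt n v ` {0..<L}"
      using bpt_modL modL_range[OF L_pos] by (metis imageI)
  qed
qed

lemma bpt_frontier: "bpt n v s \<in> frontier (polygon n v)"
  using bpt_image bpt_modL modL_range[OF L_pos] by (metis imageI)

lemma bpt_eq_vertex: "s \<in> {0..<L} \<Longrightarrow> i < n \<Longrightarrow> bpt n v s = v i \<longleftrightarrow> s = vp i"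
  using bpt_plen[of i] plen_range[of i] inj_onD[OF inj_bpt, of s "vp i"] by auto

lemma bpt_in_open_edge:
  assumes s: "s \<in> {0..<L}" and j: "j < n"
  shows "bpt n v s \<in> open_segment (v j) (v (nxt n j)) \<longleftrightarrow> vp j < s \<and> s < vp (Suc j)"
proof
  assume "vp j < s \<and> s < vp (Suc j)"
  then have "bpt n v s = v j + of_real ((s - vp j) / cmod (edgev n v j)) * edgev n v j"
    "0 < (s - vp j) / cmod (edgev n v j)" "(s - vp j) / cmod (edgev n v j) < 1"
    using bpt_on_edge[OF j] elen_pos[OF j] plen_Suc[of j] by (auto simp: divide_simps)
  then obtain r where r: "bpt n v s = v j + of_real r * edgev n v j" "0 < r" "r < 1" by blast
  have "bpt n v s = (1 - r) *\<^sub>R v j + r *\<^sub>R v (nxt n j)"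
    using r(1) by (simp add: edgev_def scaleR_conv_of_real algebra_simps)
  moreover have "v j \<noteq> v (nxt n j)" using edge_nz[OF j] unfolding edgev_def by auto
  ultimately show "bpt n v s \<in> open_segment (v j) (v (nxt n j))"
    unfolding in_segment using r by blast
next
  assume "bpt n v s \<in> open_segment (v j) (v (nxt n j))"
  then obtain u where u: "0 < u" "u < 1" "bpt n v s = (1 - u) *\<^sub>R v j + u *\<^sub>R v (nxt n j)"
    unfolding in_segment by auto
  define t where "t = vp j + u * cmod (edgev n v j)"
  have "bpt n v s = v j + of_real u * edgev n v j"
    using u by (simp add: edgev_def scaleR_conv_of_real algebra_simps)
  then have "bpt n v s = bpt n v t"
    using bpt_edge_param[of j u] j u unfolding t_def by simp
  moreover have t: "vp j < t" "t < vp (Suc j)"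
    using u elen_pos[OF j] plen_Suc[of j] unfolding t_def by auto
  moreover have "t \<in> {0..<L}"
    using t plen_range[OF j] plen_less_iff[of "Suc j" n] j plen_n by (cases "Suc j = n") auto
  ultimately show "vp j < s \<and> s < vp (Suc j)" using inj_bpt s by (auto dest: inj_onD)
qed

end

section \<open>Polar coordinates about an interior point\<close>

context opoly
begin

lemma convex_P: "convex (polygon n v)"
  unfolding polygon_def by simp

lemma compact_P: "compact (polygon n v)"
  unfolding polygon_def by (simp add: finite_imp_compact_convex_hull)

definition ctr :: complex where
  "ctr = (SOME c. c \<in> interior (polygon n v))"

lemma ctr_interior: "ctr \<in> interior (polygon n v)"
  unfolding ctr_def using interior_nonempty by (simp add: some_in_eq)

definition polar :: "real \<Rightarrow> real \<Rightarrow> complex" where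
  "polar r s = ctr + r *\<^sub>R (bpt n v s - ctr)"

lemma polar_1 [simp]: "polar 1 s = bpt n v s"
  by (simp add: polar_def)

lemma polar_0 [simp]: "polar 0 s = ctr"
  by (simp add: polar_def)

lemma polar_cong: "modL L s = modL L t \<Longrightarrow> polar r s = polar r t"
  unfolding polar_def using bpt_cong by metis

lemma bpt_in_P: "bpt n v s \<in> polygon n v"
  using bpt_frontier convex_polygon_closed frontier_subset_closed by blast

lemma bpt_not_interior: "bpt n v s \<notin> interior (polygon n v)"
  using bpt_frontier unfolding frontier_def by blast

lemma bpt_neq_ctr: "bpt n v s \<noteq> ctr"
  using bpt_not_interior ctr_interior by metis

lemma polar_interior:
  assumes "0 \<le> r" "r < 1"
  shows "polar r s \<in> interior (polygon n v)"
proof (cases "r = 0")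
  case False
  have "polar r s = (1 - r) *\<^sub>R ctr + r *\<^sub>R bpt n v s"
    unfolding polar_def by (simp add: algebra_simps)
  then have "polar r s \<in> open_segment ctr (bpt n v s)"
    using assms False bpt_neq_ctr[of s] unfolding in_segment
    by (intro conjI exI[of _ r]) auto
  then show ?thesis
    using in_interior_closure_convex_segment[OF convex_P ctr_interior] bpt_in_P closure_subset by blast
qed (simp add: ctr_interior)

lemma polar_in_P: "0 \<le> r \<Longrightarrow> r \<le> 1 \<Longrightarrow> polar r s \<in> polygon n v"
  using polar_interior[of r s] interior_subset bpt_in_P[of s] by (cases "r = 1") auto

text \<open>If the radii differed, rescaling would show a boundary point at a radius below 1, hence
  in the interior.\<close>

lemma polar_inj:
  assumes "0 < r" "r \<le> 1" "0 < r'" "r' \<le> 1" "polar r s = polar r' s'"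
  shows "r = r' \<and> modL L s = modL L s'"
proof -
  have aux: "r' \<le> r" if h: "0 < r" "r \<le> 1" "0 < r'" "r' \<le> 1" "polar r s = polar r' s'" for r r' s s'
  proof (rule ccontr)
    assume c: "\<not> r' \<le> r"
    have "r *\<^sub>R (bpt n v s - ctr) = r' *\<^sub>R (bpt n v s' - ctr)" using h(5) unfolding polar_def by simp
    then have "(1 / r') *\<^sub>R (r *\<^sub>R (bpt n v s - ctr)) = bpt n v s' - ctr" using h by simp
    then have "bpt n v s' = polar (r / r') s" unfolding polar_def by (simp add: algebra_simps)
    moreover have "0 \<le> r / r'" "r / r' < 1" using h c by (auto simp: divide_simps)
    ultimately show False using polar_interior[of "r / r'" s] bpt_not_interior[of s'] by simp
  qed
  have "r = r'" using aux[OF assms] aux[OF assms(3,4,1,2) assms(5)[symmetric]] by simp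
  moreover from this have "bpt n v s = bpt n v s'" using assms unfolding polar_def by simp
  ultimately show ?thesis using bpt_eq_iff by blast
qed

lemma polar_eq_ctr: "0 \<le> r \<Longrightarrow> polar r s = ctr \<longleftrightarrow> r = 0"
  unfolding polar_def using bpt_neq_ctr by auto

lemma polar_surj:
  assumes "x \<in> polygon n v"
  obtains r s where "0 \<le> r" "r \<le> 1" "s \<in> {0..<L}" "x = polar r s"
proof (cases "x = ctr")
  case True
  then show ?thesis using that[of 0 0] L_pos by auto
next
  case False
  obtain d where d: "0 < d" "ctr + d *\<^sub>R (x - ctr) \<in> frontier (polygon n v)"
    and di: "\<And>e. 0 \<le> e \<Longrightarrow> e < d \<Longrightarrow> ctr + e *\<^sub>R (x - ctr) \<in> interior (polygon n v)"
    using ray_to_frontier[OF compact_imp_bounded[OF compact_P] ctr_interior, of "x - ctr"] False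
    by auto
  obtain s where s: "s \<in> {0..<L}" "ctr + d *\<^sub>R (x - ctr) = bpt n v s"
    using d(2) bpt_image by (metis (no_types, lifting) imageE)
  \<comment> \<open>Otherwise the frontier point would lie strictly between the interior point
    \<open>ctr\<close> and the point \<open>x\<close> of the polygon.\<close>
  have "d \<ge> 1"
  proof (rule ccontr)
    assume "\<not> d \<ge> 1"
    then have "ctr + d *\<^sub>R (x - ctr) \<in> open_segment ctr x"
      using d False unfolding in_segment by (auto intro!: exI[of _ d] simp: algebra_simps)
    then have "ctr + d *\<^sub>R (x - ctr) \<in> interior (polygon n v)"
      using in_interior_closure_convex_segment[OF convex_P ctr_interior] assms closure_subset by blast
    then show False using s bpt_not_interior by metis
  qed
  have "x = polar (1 / d) s" unfolding polar_def s(2)[symmetric] using d by simp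
  then show ?thesis using that[of "1 / d" s] \<open>d \<ge> 1\<close> s by simp
qed

lemma continuous_on_polar: "continuous_on S (\<lambda>p. polar (fst p) (snd p))"
proof -
  have "continuous_on S (bpt n v \<circ> snd)"
    by (intro continuous_on_compose continuous_on_snd continuous_on_id
        continuous_on_subset[OF continuous_on_bpt]) auto
  then show ?thesis unfolding polar_def comp_def
    by (intro continuous_intros) auto
qed

text \<open>Polar coordinates are a quotient map from a compact rectangle onto the polygon.\<close>

lemma continuous_on_via_polar:
  fixes q :: "complex \<Rightarrow> 'b::t2_space"
  assumes "continuous_on ({0..1} \<times> {0..L}) (\<lambda>p. q (polar (fst p) (snd p)))"
  shows "continuous_on (polygon n v) q"
proof (rule continuous_on_closed_vimage[OF convex_polygon_closed, THEN iffD2], intro allI impI)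
  fix B :: "'b set" assume B: "closed B"
  define R where "R = ({0..1} \<times> {0..L} :: (real \<times> real) set)"
  define K where "K = (\<lambda>p. q (polar (fst p) (snd p))) -` B \<inter> R"
  have "compact R" unfolding R_def by (intro compact_Times) auto
  moreover have "closed K"
    using assms B continuous_on_closed_vimage[of R] compact_imp_closed[OF \<open>compact R\<close>]
    unfolding K_def R_def by blast
  ultimately have "compact K" unfolding K_def by (metis compact_Int_closed inf.absorb_iff2 inf_sup_ord(2) inf.commute)
  then have "compact ((\<lambda>p. polar (fst p) (snd p)) ` K)"
    using continuous_on_polar by (rule compact_continuous_image[rotated])
  moreover have "(\<lambda>p. polar (fst p) (snd p)) ` K = q -` B \<inter> polygon n v"
  proof
    show "(\<lambda>p. polar (fst p) (snd p)) ` K \<subseteq> q -` B \<inter> polygon n v"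
      unfolding K_def R_def using polar_in_P by auto
    show "q -` B \<inter> polygon n v \<subseteq> (\<lambda>p. polar (fst p) (snd p)) ` K"
    proof
      fix x assume x: "x \<in> q -` B \<inter> polygon n v"
      then obtain r s where "0 \<le> r" "r \<le> 1" "s \<in> {0..<L}" "x = polar r s" using polar_surj by blast
      then show "x \<in> (\<lambda>p. polar (fst p) (snd p)) ` K"
        using x unfolding K_def R_def by (intro image_eqI[of _ _ "(r, s)"]) auto
    qed
  qed
  ultimately show "closed (q -` B \<inter> polygon n v)" using compact_imp_closed by metis
qed

end

section \<open>Gluings to a sphere reverse orientation\<close>

lemma punctured_sphere_plane:
  fixes N :: "real^3"
  assumes "N \<in> sphere 0 1"
  shows "(sphere 0 1 - {N}) homeomorphic (UNIV :: complex set)"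
  using assms by (intro homeomorphic_punctured_sphere_affine) (auto simp: aff_dim_UNIV)

context opoly
begin

text \<open>Two glued pairs of boundary points cannot interleave: a loop through the interior joining
  s to s' would have connected complement in the sphere, contradicting the Jordan curve theorem.
  The third pair u, u' provides the puncture that turns the sphere into a plane.\<close>

lemma no_crossing:
  fixes q :: "complex \<Rightarrow> real^3"
  assumes contq: "continuous_on (polygon n v) q" and imq: "q ` polygon n v = sphere 0 1"
    and fib: "\<And>x y. x \<in> polygon n v \<Longrightarrow> y \<in> polygon n v \<Longrightarrow>
      x \<in> interior (polygon n v) \<Longrightarrow> q x = q y \<Longrightarrow> x = y"
    and ord: "s < t" "t < u" "u < s'" "s' < t'" "t' < u'" "u' < s + L"
    and eqs: "q (bpt n v s) = q (bpt n v s')" "q (bpt n v t) = q (bpt n v t')"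
      "q (bpt n v u) = q (bpt n v u')"
    and cs: "\<And>y. q (bpt n v y) = q (bpt n v s) \<Longrightarrow> modL L y \<in> {modL L s, modL L s'}"
    and cu: "\<And>y. q (bpt n v y) = q (bpt n v u) \<Longrightarrow> modL L y \<in> {modL L u, modL L u'}"
  shows False
proof -
  define N where "N = q (bpt n v u)"
  have "N \<in> sphere 0 1" using imq bpt_in_P unfolding N_def by blast
  then obtain \<Phi> \<Psi> where hom: "homeomorphism (sphere 0 1 - {N}) (UNIV :: complex set) \<Phi> \<Psi>"
    using punctured_sphere_plane unfolding homeomorphic_def by blast
  define W where "W = {x \<in> polygon n v. q x \<noteq> N}"
  define f where "f = \<Phi> \<circ> q"
  have qW: "q ` W \<subseteq> sphere 0 1 - {N}" using imq unfolding W_def by auto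
  have contf: "continuous_on W f"
    unfolding f_def
    using contq homeomorphism_cont1[OF hom] qW
    by (intro continuous_on_compose) (auto simp: W_def intro: continuous_on_subset)
  have finj: "f x = f y \<longleftrightarrow> q x = q y" if "x \<in> W" "y \<in> W" for x y
    using that qW homeomorphism_apply1[OF hom] unfolding f_def comp_def
    by (metis image_subset_iff)
  have fsurj: "\<exists>x\<in>W. f x = z" for z
  proof -
    have "\<Psi> z \<in> sphere 0 1 - {N}" using hom unfolding homeomorphism_def by blast
    then obtain x where x: "x \<in> polygon n v" "q x = \<Psi> z" "q x \<noteq> N" using imq by (metis DiffE imageE insertI1)
    have "f x = z" using homeomorphism_apply2[OF hom, of z] x unfolding f_def by simp
    then show ?thesis using x unfolding W_def by blast
  qed
  \<comment> \<open>Two points have the same image only if both are the centre, or they are the same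
    point off the centre, or both lie on the boundary and are glued.\<close>
  have qeq: "(r = 0 \<and> r' = 0) \<or> (0 < r \<and> r = r' \<and> modL L y = modL L y') \<or>
      (r = 1 \<and> r' = 1 \<and> q (bpt n v y) = q (bpt n v y'))"
    if h: "0 \<le> r" "r \<le> 1" "0 \<le> r'" "r' \<le> 1" "q (polar r y) = q (polar r' y')" for r r' y y'
  proof (cases "r < 1 \<or> r' < 1")
    case True
    then have eq: "polar r y = polar r' y'"
      using fib[of "polar r y" "polar r' y'"] fib[of "polar r' y'" "polar r y"]
        polar_interior polar_in_P h by metis
    show ?thesis
      using polar_inj[of r r' y y'] eq h polar_eq_ctr[of r y] polar_eq_ctr[of r' y'] by force
  next
    case False
    then show ?thesis using h by auto
  qed
  have lifts: "y = y'" if "modL L y = modL L y'" "s \<le> y" "y < s + L" "s \<le> y'" "y' < s + L" for y y'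
    using that modL_eq_imp_eq[OF L_pos, of y y'] by (simp add: abs_less_iff)
  have in_W: "polar r y \<in> W" if "0 \<le> r" "r \<le> 1" "s \<le> y" "y < s + L" "(r, y) \<noteq> (1, u)" "(r, y) \<noteq> (1, u')" for r y
  proof -
    have "q (polar r y) \<noteq> q (polar 1 u)"
    proof
      assume h: "q (polar r y) = q (polar 1 u)"
      have "r = 1 \<and> (modL L y = modL L u \<or> q (bpt n v y) = q (bpt n v u))"
        using qeq[OF _ _ _ _ h] that by auto
      then have "r = 1" "modL L y \<in> {modL L u, modL L u'}" using cu by auto
      then show False using lifts[of y u] lifts[of y u'] that ord by auto
    qed
    then show ?thesis unfolding W_def N_def using polar_in_P that by auto
  qed
  \<comment> \<open>In polar coordinates, the two sectors left after cutting the polygon along the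
    radii at \<open>s\<close> and \<open>s'\<close>, without the two points over the
    puncture.\<close>
  define TA where "TA = ({0<..1} \<times> {s<..<s'} :: (real \<times> real) set) - {(1, u)}"
  define TB where "TB = ({0<..1} \<times> {s'<..<s + L} :: (real \<times> real) set) - {(1, u')}"
  define g where "g = (\<lambda>p. f (polar (fst p) (snd p)))"
  have contg: "continuous_on T g" if "(\<lambda>p. polar (fst p) (snd p)) ` T \<subseteq> W" for T
  proof -
    have "continuous_on T (f \<circ> (\<lambda>p. polar (fst p) (snd p)))"
      using continuous_on_polar contf that
      by (intro continuous_on_compose) (auto intro: continuous_on_subset)
    then show ?thesis unfolding g_def comp_def .
  qed
  \<comment> \<open>The removed point lies on the outer side, so the set is caught between an open
    rectangle and its closure.\<close>
  have conn: "connected (({0<..1::real} \<times> {a<..<b}) - {(1, c)})" if "a < b" for a b c :: real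
  proof (rule connected_intermediate_closure)
    show "connected ({0<..<1::real} \<times> {a<..<b})"
      by (intro connected_Times) auto
    show "({0<..<1::real} \<times> {a<..<b}) \<subseteq> ({0<..1} \<times> {a<..<b}) - {(1, c)}" by auto
    show "({0<..1} \<times> {a<..<b}) - {(1, c)} \<subseteq> closure ({0<..<1::real} \<times> {a<..<b})"
      using that by (auto simp: closure_Times)
  qed
  have TAW: "(\<lambda>p. polar (fst p) (snd p)) ` TA \<subseteq> W"
  proof (rule image_subsetI)
    fix p assume "p \<in> TA"
    then show "polar (fst p) (snd p) \<in> W"
      using in_W[of "fst p" "snd p"] ord unfolding TA_def by (cases p) auto
  qed
  have TBW: "(\<lambda>p. polar (fst p) (snd p)) ` TB \<subseteq> W"
  proof (rule image_subsetI)
    fix p assume "p \<in> TB"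
    then show "polar (fst p) (snd p) \<in> W"
      using in_W[of "fst p" "snd p"] ord unfolding TB_def by (cases p) auto
  qed
  have conn_union: "connected (g ` TA \<union> g ` TB)"
  proof (rule connected_Un)
    show "connected (g ` TA)" "connected (g ` TB)"
      using contg[OF TAW] contg[OF TBW] conn[of s s' u] conn[of s' "s + L" u'] ord
      unfolding TA_def TB_def by (auto intro!: connected_continuous_image)
    \<comment> \<open>The interleaving is used here: \<open>t\<close> and \<open>t'\<close> lie in
      different sectors, and their common image joins the two.\<close>
    have "(1, t) \<in> TA" "(1, t') \<in> TB" using ord unfolding TA_def TB_def by auto
    moreover have "g (1, t) = g (1, t')" unfolding g_def f_def using eqs by simp
    ultimately show "g ` TA \<inter> g ` TB \<noteq> {}" by (metis IntI empty_iff image_eqI)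
  qed
  \<comment> \<open>The loop: inward along the radius at \<open>s\<close>, outward along the radius
    at \<open>s'\<close>, closed because the two ends are glued.\<close>
  define g1 where "g1 = (\<lambda>\<tau>. g (1 - \<tau>, s))"
  define g2 where "g2 = (\<lambda>\<tau>. g (\<tau>, s'))"
  have inWs: "polar r s \<in> W" "polar r s' \<in> W" if "0 \<le> r" "r \<le> 1" for r
    using in_W that ord by auto
  have g_inj: "r = r' \<and> (r = 0 \<or> y = y' \<or> r = 1)"
    if h: "0 \<le> r" "r \<le> 1" "0 \<le> r'" "r' \<le> 1" "y \<in> {s, s'}" "y' \<in> {s, s'}" "g (r, y) = g (r', y')" for r r' y y'
  proof -
    have "q (polar r y) = q (polar r' y')"
      using finj[of "polar r y" "polar r' y'"] inWs h unfolding g_def by auto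
    then show ?thesis using qeq[of r r' y y'] h lifts[of y y'] ord by auto
  qed
  have "continuous_on ({0..1} \<times> {s, s'}) g" using inWs by (intro contg) auto
  then have "continuous_on {0..1} (g \<circ> (\<lambda>\<tau>. (1 - \<tau>, s)))" "continuous_on {0..1} (g \<circ> (\<lambda>\<tau>. (\<tau>, s')))"
    by - (rule continuous_on_compose; force intro!: continuous_intros elim!: continuous_on_subset)+
  moreover have "inj_on g1 {0..1}"
  proof (rule inj_onI)
    fix a b :: real assume "a \<in> {0..1}" "b \<in> {0..1}" "g1 a = g1 b"
    then show "a = b" using g_inj[of "1 - a" "1 - b" s s] unfolding g1_def by simp
  qed
  moreover have "inj_on g2 {0..1}"
  proof (rule inj_onI)
    fix a b :: real assume "a \<in> {0..1}" "b \<in> {0..1}" "g2 a = g2 b"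
    then show "a = b" using g_inj[of a b s' s'] unfolding g2_def by simp
  qed
  ultimately have arcs: "arc g1" "arc g2"
    unfolding arc_def path_def g1_def g2_def comp_def by auto
  have "simple_path (g1 +++ g2)"
  proof (rule simple_path_join_loop[OF arcs])
    show "pathfinish g1 = pathstart g2"
      unfolding pathfinish_def pathstart_def g1_def g2_def g_def by simp
    show "pathfinish g2 = pathstart g1"
      unfolding pathfinish_def pathstart_def g1_def g2_def g_def f_def using eqs by simp
    show "path_image g1 \<inter> path_image g2 \<subseteq> {pathstart g1, pathstart g2}"
    proof
      fix z assume "z \<in> path_image g1 \<inter> path_image g2"
      then obtain a b where ab: "a \<in> {0..1}" "b \<in> {0..1}" "z = g (1 - a, s)" "z = g (b, s')"
        unfolding path_image_def g1_def g2_def by blast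
      then have "1 - a = b \<and> (b = 0 \<or> b = 1)"
        using g_inj[of "1 - a" b s s'] ord by auto
      then show "z \<in> {pathstart g1, pathstart g2}"
        unfolding pathstart_def g1_def g2_def using ab by auto
    qed
  qed
  moreover have "pathfinish (g1 +++ g2) = pathstart (g1 +++ g2)"
    unfolding pathfinish_join pathstart_join
    unfolding pathfinish_def pathstart_def g1_def g2_def g_def f_def using eqs by simp
  ultimately have disc: "\<not> connected (- path_image (g1 +++ g2))" using Jordan_disconnected by blast
  have "path_image (g1 +++ g2) = path_image g1 \<union> path_image g2"
    by (rule path_image_join) (simp add: pathfinish_def pathstart_def g1_def g2_def g_def)
  then have pim: "path_image (g1 +++ g2) = g ` ({0..1} \<times> {s, s'})"
  proof -
    have "path_image g1 = g ` ({0..1} \<times> {s})"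
    proof -
      have "(\<lambda>\<tau>. (1 - \<tau>, s)) ` {0..1} = {0..1::real} \<times> {s}"
      proof (intro set_eqI iffI)
        fix p :: "real \<times> real" assume "p \<in> {0..1} \<times> {s}"
        then show "p \<in> (\<lambda>\<tau>. (1 - \<tau>, s)) ` {0..1}"
          by (intro image_eqI[of _ _ "1 - fst p"]) auto
      qed auto
      then show ?thesis unfolding path_image_def g1_def by (metis image_image)
    qed
    moreover have "path_image g2 = g ` ({0..1} \<times> {s'})"
    proof -
      have "(\<lambda>\<tau>. (\<tau>, s')) ` {0..1} = {0..1::real} \<times> {s'}" by auto
      then show ?thesis unfolding path_image_def g2_def by (metis image_image)
    qed
    ultimately show ?thesis using \<open>path_image (g1 +++ g2) = path_image g1 \<union> path_image g2\<close>
      by auto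
  qed
  \<comment> \<open>By the Jordan theorem the loop separates the plane, yet its complement turns out
    to be the connected union from above.\<close>
  have "- path_image (g1 +++ g2) = g ` TA \<union> g ` TB"
  proof
    show "- path_image (g1 +++ g2) \<subseteq> g ` TA \<union> g ` TB"
    proof
      fix z assume z: "z \<in> - path_image (g1 +++ g2)"
      obtain x where x: "x \<in> W" "f x = z" using fsurj by blast
      then obtain r y0 where r: "0 \<le> r" "r \<le> 1" "x = polar r y0"
        using polar_surj[of x] unfolding W_def by blast
      define y where "y = s + modL L (y0 - s)"
      have y: "s \<le> y" "y < s + L" using modL_bounds[OF L_pos, of "y0 - s"] unfolding y_def by auto
      have "modL L y = modL L (s + (y0 - s))"
        unfolding y_def using L_pos by (intro modL_cong_add) auto
      then have xy: "x = polar r y" using r polar_cong[of y y0] by simp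
      have zg: "z = g (r, y)" using x xy unfolding g_def by simp
      have "r \<noteq> 0"
      proof
        assume "r = 0"
        then have "z = g (0, s)" using zg unfolding g_def by simp
        then show False using z pim by auto
      qed
      moreover have "y \<noteq> s" "y \<noteq> s'" using z pim zg r by auto
      moreover have "(r, y) \<noteq> (1, u)" "(r, y) \<noteq> (1, u')"
        using x xy eqs unfolding W_def N_def by auto
      ultimately have "(r, y) \<in> TA \<union> TB" using r y unfolding TA_def TB_def by auto
      then show "z \<in> g ` TA \<union> g ` TB" using zg by blast
    qed
    show "g ` TA \<union> g ` TB \<subseteq> - path_image (g1 +++ g2)"
    proof
      fix z assume "z \<in> g ` TA \<union> g ` TB"
      then obtain r y where ry: "(r, y) \<in> TA \<union> TB" "z = g (r, y)" by auto
      have b: "0 < r" "r \<le> 1" "s < y" "y < s + L" "y \<noteq> s'"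
        using ry ord unfolding TA_def TB_def by auto
      have "z \<noteq> g (r', y')" if h: "r' \<in> {0..1}" "y' \<in> {s, s'}" for r' y'
      proof
        assume "z = g (r', y')"
        moreover have "polar r y \<in> W" using ry TAW TBW by force
        ultimately have qq: "q (polar r y) = q (polar r' y')"
          using finj[of "polar r y" "polar r' y'"] inWs h ry unfolding g_def by auto
        have "modL L y \<noteq> modL L s" "modL L y \<noteq> modL L s'"
          using lifts[of y s] lifts[of y s'] b ord by auto
        then show False using qeq[OF _ _ _ _ qq] b h cs[of y] eqs by auto
      qed
      then have "z \<notin> g ` ({0..1} \<times> {s, s'})" by fast
      then show "z \<in> - path_image (g1 +++ g2)" unfolding pim by blast
    qed
  qed
  then show False using disc conn_union by simp
qed

end

section \<open>The arcs of a gluing, their partners and the classes of their points\<close>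

locale glued_poly = opoly +
  fixes gl :: gluing
  assumes isg: "is_gluing n v gl"
begin

text \<open>The arcs of the gluing are numbered so that entry j contributes the arcs 2 j and 2 j + 1.\<close>

definition st :: "nat \<Rightarrow> real" where
  "st i = (case gl ! (i div 2) of (a, c, l, r) \<Rightarrow> if even i then a else c)"

definition len :: "nat \<Rightarrow> real" where
  "len i = (case gl ! (i div 2) of (a, c, l, r) \<Rightarrow> l)"

definition rv :: "nat \<Rightarrow> bool" where
  "rv i = (case gl ! (i div 2) of (a, c, l, r) \<Rightarrow> r)"

definition pt :: "nat \<Rightarrow> nat" where
  "pt i = (if even i then i + 1 else i - 1)"

definition tau :: "nat \<Rightarrow> real \<Rightarrow> real" where
  "tau i u = (if rv i then st (pt i) + len i - u else st (pt i) + u)"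

abbreviation "m \<equiv> 2 * length gl"

lemma pt_less: "i < m \<Longrightarrow> pt i < m"
  unfolding pt_def by (auto elim!: evenE oddE)

lemma pt_pt [simp]: "pt (pt i) = i"
  unfolding pt_def by auto

lemma pt_neq [simp]: "pt i \<noteq> i" "i \<noteq> pt i"
  unfolding pt_def by (auto elim!: oddE)

lemma pt_div: "pt i div 2 = i div 2"
  unfolding pt_def by (auto elim!: evenE oddE)

lemma len_pt [simp]: "len (pt i) = len i" and rv_pt [simp]: "rv (pt i) = rv i"
  unfolding len_def rv_def pt_div by auto

lemma len_pos: "i < m \<Longrightarrow> len i > 0"
proof -
  assume "i < m"
  then have "gl ! (i div 2) \<in> set gl" by (simp add: less_mult_imp_div_less)
  moreover have "\<And>p. p \<in> set gl \<Longrightarrow> 0 < fst (snd (snd p))" using isg unfolding is_gluing_def by auto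
  ultimately have "0 < fst (snd (snd (gl ! (i div 2))))" by blast
  then show ?thesis unfolding len_def by (auto split: prod.splits)
qed

lemma gluing_arcs_length: "length (gluing_arcs K g) = 2 * length g"
  unfolding gluing_arcs_def by (induction g) auto

lemma gluing_arcs_nth:
  "i < 2 * length g \<Longrightarrow> gluing_arcs K g ! i =
     (case g ! (i div 2) of (a, c, l, r) \<Rightarrow> parc K (if even i then a else c) l)"
proof (induction g arbitrary: i)
  case (Cons x g)
  obtain a c l r where x: "x = (a, c, l, r)" by (cases x)
  have *: "gluing_arcs K (x # g) = parc K a l # parc K c l # gluing_arcs K g"
    unfolding gluing_arcs_def x by simp
  show ?case
  proof (cases "i < 2")
    case True
    then have "i = 0 \<or> i = 1" by auto
    then show ?thesis using * x by auto
  next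
    case False
    then obtain j where j: "i = Suc (Suc j)" by (metis add_2_eq_Suc le_add_diff_inverse not_less)
    then show ?thesis using Cons.IH[of j] Cons.prems * x by simp
  qed
qed simp

lemma arcs_nth: "i < m \<Longrightarrow> gluing_arcs L gl ! i = parc L (st i) (len i)"
  using gluing_arcs_nth[of i gl L] unfolding st_def len_def by (auto split: prod.splits)

lemma arcs_disjoint: "i < m \<Longrightarrow> j < m \<Longrightarrow> i \<noteq> j \<Longrightarrow> parc L (st i) (len i) \<inter> parc L (st j) (len j) = {}"
  using isg arcs_nth[of i] arcs_nth[of j] gluing_arcs_length[of L gl]
  unfolding is_gluing_def Let_def by metis

lemma arcs_cofinite: "finite ({0..<L} - (\<Union>i<m. parc L (st i) (len i)))"
proof -
  have "set (gluing_arcs L gl) = (\<lambda>i. gluing_arcs L gl ! i) ` {..<m}"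
    unfolding set_conv_nth gluing_arcs_length by auto
  also have "\<dots> = (\<lambda>i. parc L (st i) (len i)) ` {..<m}"
    using arcs_nth by (intro image_cong) auto
  finally show ?thesis using isg unfolding is_gluing_def Let_def by metis
qed

lemma parc_overlap:
  assumes "0 < u" "u < len i" "0 < w" "w < len j" "modL L (st i + u) = modL L (st j + w)" "i < m" "j < m"
  shows "i = j"
  using arcs_disjoint[of i j] assms unfolding parc_def by blast

text \<open>Disjointness read on the real line: going forward from the start of arc
  \<open>i\<close>, all of it is passed before arc \<open>j\<close> starts, and all of arc
  \<open>j\<close> is passed within the same period. If not, a point slightly beyond the offending
  start would lie in both arcs.\<close>

lemma arc_sep:
  assumes "i < m" "j < m" "i \<noteq> j"
  defines "d \<equiv> modL L (st j - st i)"
  shows "len i \<le> d" "d + len j \<le> L"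
proof -
  obtain k :: int where k: "d = st j - st i + of_int k * L" unfolding d_def using modL_ex by blast
  have d: "0 \<le> d" "d < L" unfolding d_def using modL_bounds L_pos by auto
  have pos: "len i > 0" "len j > 0" using len_pos assms by auto
  show "len i \<le> d"
  proof (rule ccontr)
    assume c: "\<not> len i \<le> d"
    define w where "w = min (len i - d) (len j) / 2"
    have "0 < w" "w < len i - d" "w < len j" using c pos unfolding w_def by auto
    moreover have "modL L (st i + (d + w)) = modL L (st j + w)"
      using modL_eq_iff[OF L_pos, of "st i + (d + w)" "st j + w"] k by force
    ultimately show False using parc_overlap[of "d + w" i w j] d assms by auto
  qed
  show "d + len j \<le> L"
  proof (rule ccontr)
    assume c: "\<not> d + len j \<le> L"
    define u where "u = min (len j - (L - d)) (len i) / 2"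
    have "0 < u" "u < len j - (L - d)" "u < len i" using c pos unfolding u_def by auto
    moreover have "modL L (st i + u) = modL L (st j + (u + (L - d)))"
    proof -
      have "st i + u = st j + (u + (L - d)) + of_int (k - 1) * L" using k by (simp add: algebra_simps)
      then show ?thesis using modL_eq_iff[OF L_pos] by blast
    qed
    ultimately show False using parc_overlap[of u i "u + (L - d)" j] d assms by auto
  qed
qed

lemma len_less_L: "i < m \<Longrightarrow> len i < L"
  using arc_sep(1)[of i "pt i"] pt_less[of i] modL_bounds(2)[OF L_pos, of "st (pt i) - st i"]
  by (metis le_less_trans pt_neq(2))

text \<open>Arcs can touch only where one ends and another starts, and \<open>open_end\<close>
  excludes exactly this coincidence.\<close>

lemma arc_coords:
  assumes "i < m" "j < m" "modL L (st i + u) = modL L (st j + w)"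
    and b: "0 \<le> u" "u \<le> len i" "0 \<le> w" "w \<le> len j"
    and open_end: "(u < len i \<and> w < len j) \<or> (0 < u \<and> 0 < w) \<or> (0 < u \<and> u < len i)"
  shows "i = j \<and> u = w"
proof (cases "i = j")
  case True
  then have "modL L u = modL L w" using modL_cong_diff[OF L_pos assms(3), of "st i" "st i"] by simp
  moreover have "\<bar>u - w\<bar> < L" using len_less_L[OF assms(1)] b True by auto
  ultimately show ?thesis using modL_eq_imp_eq[OF L_pos] True by blast
next
  case False
  define d where "d = modL L (st j - st i)"
  obtain k :: int where k: "d = st j - st i + of_int k * L" unfolding d_def using modL_ex by blast
  obtain k' :: int where k': "st i + u = st j + w + of_int k' * L" using assms(3) modL_eq_iff[OF L_pos] by metis
  have eq: "u - w = d + of_int (k' - k) * L" using k k' by (simp add: algebra_simps)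
  have s: "len i \<le> d" "d + len j \<le> L" using arc_sep[OF assms(1,2) False] unfolding d_def by auto
  show ?thesis
  proof (cases "k' - k \<ge> 0")
    case True
    then have "0 \<le> of_int (k' - k) * L" using L_pos by simp
    then have "u - w \<ge> len i" using eq s by linarith
    then show ?thesis using b open_end by auto
  next
    case f: False
    then have "of_int (k' - k) \<le> (-1 :: real)" by linarith
    then have "of_int (k' - k) * L \<le> (-1) * L" using L_pos by (intro mult_right_mono) auto
    then have "u - w \<le> - len j" using eq s by linarith
    then show ?thesis using b open_end by auto
  qed
qed

text \<open>A point outside every half-open arc has a whole interval to its right that meets no open
  arc, but only finitely many points are uncovered.\<close>

lemma arc_cover:
  obtains i u where "i < m" "0 \<le> u" "u < len i" "modL L t = modL L (st i + u)"
proof (rule ccontr)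
  assume "\<not> thesis"
  then have no: "\<And>i u. i < m \<Longrightarrow> 0 \<le> u \<Longrightarrow> u < len i \<Longrightarrow> modL L t \<noteq> modL L (st i + u)"
    using that by blast
  define U where "U i = modL L (t - st i)" for i
  have Ueq: "modL L (st i + (U i + w)) = modL L (t + w)" for i w
  proof -
    have "modL L (st i + (U i + w)) = modL L (st i + (t - st i + w))"
      unfolding U_def using L_pos by (intro modL_cong_add) auto
    then show ?thesis by simp
  qed
  have U: "len i \<le> U i" "U i < L" if "i < m" for i
    using no[OF that, of "U i"] Ueq[of i 0] modL_bounds[OF L_pos, of "t - st i"]
    unfolding U_def by force+
  \<comment> \<open>\<open>L - U i\<close> is the distance from \<open>t\<close> forward to the next
    start of arc \<open>i\<close>; including \<open>L\<close> makes the minimum exist and keeps the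
    step within one period.\<close>
  define E where "E = insert L ((\<lambda>i. L - U i) ` {..<m})"
  define \<epsilon> where "\<epsilon> = Min E"
  have fE: "finite E" "E \<noteq> {}" unfolding E_def by auto
  have \<epsilon>: "\<epsilon> > 0" unfolding \<epsilon>_def using fE L_pos U by (subst Min_gr_iff) (auto simp: E_def)
  have \<epsilon>le: "\<epsilon> \<le> L" "\<And>i. i < m \<Longrightarrow> \<epsilon> \<le> L - U i"
    unfolding \<epsilon>_def using fE(1) by (auto intro!: Min_le simp: E_def)
  have "(\<lambda>w. modL L (t + w)) ` {0<..<\<epsilon>} \<subseteq> {0..<L} - (\<Union>i<m. parc L (st i) (len i))"
  proof (clarify, intro DiffI)
    fix w assume w: "w \<in> {0<..<\<epsilon>}"
    show "modL L (t + w) \<in> {0..<L}" using modL_range L_pos by blast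
    show "modL L (t + w) \<notin> (\<Union>i<m. parc L (st i) (len i))"
    proof
      assume "modL L (t + w) \<in> (\<Union>i<m. parc L (st i) (len i))"
      then obtain i x where i: "i < m" "0 < x" "x < len i" "modL L (t + w) = modL L (st i + x)"
        unfolding parc_def by auto
      have "modL L (st i + (U i + w)) = modL L (st i + x)" using Ueq i by simp
      then have "modL L (U i + w) = modL L x"
        using modL_cong_diff[OF L_pos, of "st i + (U i + w)" "st i + x" "st i" "st i"] by simp
      moreover have "0 \<le> U i + w" "U i + w < L" using \<epsilon>le(2)[OF i(1)] w U[OF i(1)] i by auto
      ultimately have "U i + w = x" using modL_id[of "U i + w" L] modL_id[of x L] len_less_L[OF i(1)] i by auto
      then show False using U[OF i(1)] i w by auto
    qed
  qed
  then have "finite ((\<lambda>w. modL L (t + w)) ` {0<..<\<epsilon>})" using arcs_cofinite finite_subset by blast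
  moreover have "inj_on (\<lambda>w. modL L (t + w)) {0<..<\<epsilon>}"
  proof (rule inj_onI)
    fix w w' assume w: "w \<in> {0<..<\<epsilon>}" "w' \<in> {0<..<\<epsilon>}" "modL L (t + w) = modL L (t + w')"
    then show "w = w'" using modL_eq_imp_eq[OF L_pos, of "t + w" "t + w'"] \<epsilon>le(1) by auto
  qed
  ultimately have "finite {0<..<\<epsilon>}" using finite_imageD by blast
  then show False using \<epsilon> infinite_Ioo[of 0 \<epsilon>] by simp
qed

text \<open>The symmetric form of a gluing step: the index runs over both arcs of every pair, so the
  partner arc supplies the reverse step.\<close>

definition adj :: "real \<Rightarrow> real \<Rightarrow> bool" where
  "adj s t \<longleftrightarrow> (\<exists>i<m. \<exists>u. 0 \<le> u \<and> u \<le> len i \<and> s = modL L (st i + u) \<and> t = modL L (tau i u))"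

lemma glue_step_iff:
  "glue_step L gl s t \<longleftrightarrow> (\<exists>i<m. even i \<and> (\<exists>u. 0 \<le> u \<and> u \<le> len i \<and> s = modL L (st i + u) \<and> t = modL L (tau i u)))"
proof
  assume "glue_step L gl s t"
  then obtain a c l r u where h: "(a, c, l, r) \<in> set gl" "0 \<le> u" "u \<le> l"
      "s = modL L (a + u)" "t = modL L (if r then c + l - u else c + u)"
    unfolding glue_step_def by auto
  obtain j where j: "j < length gl" "gl ! j = (a, c, l, r)" using h(1) by (metis in_set_conv_nth)
  have "st (2 * j) = a" "len (2 * j) = l" "tau (2 * j) u = (if r then c + l - u else c + u)"
    using j unfolding st_def len_def tau_def rv_def pt_def by auto
  then show "\<exists>i<m. even i \<and> (\<exists>u. 0 \<le> u \<and> u \<le> len i \<and> s = modL L (st i + u) \<and> t = modL L (tau i u))"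
    using j h by (intro exI[of _ "2 * j"]) auto
next
  assume "\<exists>i<m. even i \<and> (\<exists>u. 0 \<le> u \<and> u \<le> len i \<and> s = modL L (st i + u) \<and> t = modL L (tau i u))"
  then obtain j u where j: "j < length gl" and h: "0 \<le> u" "u \<le> len (2 * j)"
      "s = modL L (st (2 * j) + u)" "t = modL L (tau (2 * j) u)"
    by (auto elim!: evenE)
  obtain a c l r where g: "gl ! j = (a, c, l, r)" by (cases "gl ! j")
  have "st (2 * j) = a" "len (2 * j) = l" "tau (2 * j) u = (if r then c + l - u else c + u)"
    using g unfolding st_def len_def tau_def rv_def pt_def by auto
  moreover have "(a, c, l, r) \<in> set gl" using g j by (metis nth_mem)
  ultimately show "glue_step L gl s t" unfolding glue_step_def using h by (auto intro!: bexI)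
qed

definition mir :: "nat \<Rightarrow> real \<Rightarrow> real" where
  "mir i u = (if rv i then len i - u else u)"

lemma tau_mir: "tau i u = st (pt i) + mir i u" "tau (pt i) (mir i u) = st i + u"
  unfolding tau_def mir_def by auto

lemma mir_bounds: "0 \<le> u \<Longrightarrow> u \<le> len i \<Longrightarrow> 0 \<le> mir i u" "0 \<le> u \<Longrightarrow> u \<le> len i \<Longrightarrow> mir i u \<le> len i"
  "0 < u \<Longrightarrow> u < len i \<Longrightarrow> 0 < mir i u" "0 < u \<Longrightarrow> u < len i \<Longrightarrow> mir i u < len i"
  unfolding mir_def by auto

lemma adj_sym: "adj s t \<Longrightarrow> adj t s"
proof -
  assume "adj s t"
  then obtain i u where h: "i < m" "0 \<le> u" "u \<le> len i" "s = modL L (st i + u)" "t = modL L (tau i u)"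
    unfolding adj_def by blast
  then show "adj t s" unfolding adj_def
    using pt_less[of i] mir_bounds[of u i] tau_mir[of i u]
    by (intro exI[of _ "pt i"] conjI exI[of _ "mir i u"]) auto
qed

lemma adj_iff: "adj s t \<longleftrightarrow> glue_step L gl s t \<or> glue_step L gl t s"
proof
  assume "adj s t"
  then obtain i u where h: "i < m" "0 \<le> u" "u \<le> len i" "s = modL L (st i + u)" "t = modL L (tau i u)"
    unfolding adj_def by blast
  show "glue_step L gl s t \<or> glue_step L gl t s"
  proof (cases "even i")
    case True
    then show ?thesis using h unfolding glue_step_iff by blast
  next
    case False
    then have "even (pt i)" unfolding pt_def by auto
    then have "glue_step L gl t s" unfolding glue_step_iff
      using h pt_less[of i] mir_bounds[of u i] tau_mir[of i u]
      by (intro exI[of _ "pt i"] conjI exI[of _ "mir i u"]) auto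
    then show ?thesis by blast
  qed
next
  assume "glue_step L gl s t \<or> glue_step L gl t s"
  then show "adj s t" using adj_sym unfolding glue_step_iff adj_def by blast
qed

lemma pglued_eq: "pglued n v gl = adj\<^sup>*\<^sup>*"
  unfolding pglued_def using adj_iff by presburger

lemma adj_in_range: "adj s t \<Longrightarrow> s \<in> {0..<L} \<and> t \<in> {0..<L}"
  unfolding adj_def using modL_range L_pos by blast

lemma pglued_refl: "pglued n v gl s s"
  unfolding pglued_eq by simp

lemma pglued_sym: "pglued n v gl s t \<Longrightarrow> pglued n v gl t s"
  unfolding pglued_eq
  by (induction rule: rtranclp_induct) (auto intro: adj_sym converse_rtranclp_into_rtranclp)

lemma pglued_trans: "pglued n v gl s t \<Longrightarrow> pglued n v gl t u \<Longrightarrow> pglued n v gl s u"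
  unfolding pglued_eq by (rule rtranclp_trans)

lemma pglued_closed:
  assumes "pglued n v gl s t" "s \<in> X" "\<And>x y. x \<in> X \<Longrightarrow> adj x y \<Longrightarrow> y \<in> X"
  shows "t \<in> X"
  using assms(1,2) unfolding pglued_eq by (induction rule: rtranclp_induct) (use assms(3) in auto)

lemma open_arc_adj:
  assumes "i < m" "0 < u" "u < len i" "adj (modL L (st i + u)) t"
  shows "t = modL L (tau i u)"
proof -
  obtain j w where h: "j < m" "0 \<le> w" "w \<le> len j" "modL L (st i + u) = modL L (st j + w)" "t = modL L (tau j w)"
    using assms(4) unfolding adj_def by blast
  then have "i = j \<and> u = w" using arc_coords[of i j u w] assms by auto
  then show ?thesis using h by simp
qed

text \<open>The point and its partner form a set closed under \<open>adj\<close>, since each of them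
  is interior to an arc and thus has a single neighbour.\<close>

lemma open_arc_class:
  assumes "i < m" "0 < u" "u < len i" "pglued n v gl (modL L (st i + u)) t"
  shows "t = modL L (st i + u) \<or> t = modL L (tau i u)"
proof -
  have "t \<in> {modL L (st i + u), modL L (tau i u)}"
  proof (rule pglued_closed[OF assms(4)])
    fix x y assume x: "x \<in> {modL L (st i + u), modL L (tau i u)}" and a: "adj x y"
    show "y \<in> {modL L (st i + u), modL L (tau i u)}"
    proof (cases "x = modL L (st i + u)")
      case True then show ?thesis using open_arc_adj assms a by blast
    next
      case False
      then have "adj (modL L (st (pt i) + mir i u)) y" using x a tau_mir by auto
      then have "y = modL L (tau (pt i) (mir i u))"
        using open_arc_adj[of "pt i" "mir i u"] pt_less mir_bounds assms by auto
      then show ?thesis using tau_mir by simp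
    qed
  qed auto
  then show ?thesis by blast
qed

lemma pglued_arc: "i < m \<Longrightarrow> 0 \<le> u \<Longrightarrow> u \<le> len i \<Longrightarrow> pglued n v gl (modL L (st i + u)) (modL L (tau i u))"
  unfolding pglued_eq adj_def by (rule r_into_rtranclp) blast

lemma ptglued_bpt:
  "ptglued n v gl (bpt n v x) (bpt n v y) \<longleftrightarrow> pglued n v gl (modL L x) (modL L y)"
proof
  assume "ptglued n v gl (bpt n v x) (bpt n v y)"
  then show "pglued n v gl (modL L x) (modL L y)"
    unfolding ptglued_def
  proof
    assume "bpt n v x = bpt n v y"
    then show ?thesis using bpt_eq_iff pglued_refl by metis
  next
    assume "\<exists>s t. s \<in> {0..<L} \<and> t \<in> {0..<L} \<and> bpt n v s = bpt n v x \<and> bpt n v t = bpt n v y \<and> pglued n v gl s t"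
    then obtain s t where "s \<in> {0..<L}" "t \<in> {0..<L}" "modL L s = modL L x" "modL L t = modL L y" "pglued n v gl s t"
      using bpt_eq_iff by blast
    then show ?thesis using modL_id by auto
  qed
next
  assume "pglued n v gl (modL L x) (modL L y)"
  then show "ptglued n v gl (bpt n v x) (bpt n v y)"
    unfolding ptglued_def using modL_range[OF L_pos] bpt_modL by metis
qed

text \<open>In a pair glued without reversal the quarter points of the two arcs occur in the same
  cyclic order, which gives three interleaved glued pairs. They are interior to the arcs, so their
  classes are just these pairs, as \<open>no_crossing\<close> demands.\<close>

lemma aleksandrov_reversing:
  assumes al: "aleksandrov_gluing n v gl" and i: "i < m"
  shows "rv i"
proof (rule ccontr)
  assume rv: "\<not> rv i"
  obtain q :: "complex \<Rightarrow> real^3" where q: "continuous_on (polygon n v) q" "q ` polygon n v = sphere 0 1"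
    "\<And>x y. x \<in> polygon n v \<Longrightarrow> y \<in> polygon n v \<Longrightarrow> q x = q y \<longleftrightarrow> ptglued n v gl x y"
    using al unfolding aleksandrov_gluing_def by blast
  have qb: "q (bpt n v x) = q (bpt n v y) \<longleftrightarrow> pglued n v gl (modL L x) (modL L y)" for x y
    using q(3) bpt_in_P ptglued_bpt by simp
  have fib: "x = y" if "x \<in> polygon n v" "y \<in> polygon n v" "x \<in> interior (polygon n v)" "q x = q y" for x y
  proof -
    have "ptglued n v gl x y" using q(3) that by blast
    then show ?thesis using that(3) bpt_not_interior unfolding ptglued_def by metis
  qed
  define a where "a = st i"
  define l where "l = len i"
  \<comment> \<open>The boundary is unrolled so that the partner arc starts at \<open>a + d\<close>,
    after the arc starting at \<open>a\<close> and within one period.\<close>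
  define d where "d = modL L (st (pt i) - st i)"
  have s: "l \<le> d" "d + l \<le> L" "l > 0"
    using arc_sep[of i "pt i"] pt_less i len_pos unfolding d_def l_def by auto
  have ad: "modL L (a + d + x) = modL L (st (pt i) + x)" for x
  proof -
    have "modL L (a + x + d) = modL L (a + x + (st (pt i) - st i))"
      unfolding d_def using L_pos by (intro modL_cong_add) auto
    then show ?thesis unfolding a_def by (simp add: algebra_simps)
  qed
  have tau: "tau i x = st (pt i) + x" for x using rv unfolding tau_def by simp
  have glue: "q (bpt n v (a + x)) = q (bpt n v (a + d + x))" if "0 \<le> x" "x \<le> l" for x
    using pglued_arc[OF i, of x] that tau ad unfolding qb a_def l_def by simp
  have cls: "modL L y \<in> {modL L (a + x), modL L (a + d + x)}"
    if "0 < x" "x < l" "q (bpt n v y) = q (bpt n v (a + x))" for x y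
    using open_arc_class[OF i, of x "modL L y"] pglued_sym that tau ad unfolding qb a_def l_def by auto
  show False
  proof (rule no_crossing[where q = q and s = "a + l/4" and t = "a + l/2" and u = "a + 3*l/4"
        and s' = "a + d + l/4" and t' = "a + d + l/2" and u' = "a + d + 3*l/4"])
    show "continuous_on (polygon n v) q" "q ` polygon n v = sphere 0 1" using q by auto
    show "x = y" if "x \<in> polygon n v" "y \<in> polygon n v" "x \<in> interior (polygon n v)" "q x = q y" for x y
      using fib that by blast
    show "a + l/4 < a + l/2" "a + l/2 < a + 3*l/4" "a + 3*l/4 < a + d + l/4"
      "a + d + l/4 < a + d + l/2" "a + d + l/2 < a + d + 3*l/4" "a + d + 3*l/4 < a + l/4 + L"
      using s by linarith+
    show "q (bpt n v (a + l/4)) = q (bpt n v (a + d + l/4))"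
      "q (bpt n v (a + l/2)) = q (bpt n v (a + d + l/2))"
      "q (bpt n v (a + 3*l/4)) = q (bpt n v (a + d + 3*l/4))"
      using s by (auto intro!: glue)
    show "modL L y \<in> {modL L (a + l/4), modL L (a + d + l/4)}"
      if "q (bpt n v y) = q (bpt n v (a + l/4))" for y
      using cls[OF _ _ that] s by simp
    show "modL L y \<in> {modL L (a + 3*l/4), modL L (a + d + 3*l/4)}"
      if "q (bpt n v y) = q (bpt n v (a + 3*l/4))" for y
      using cls[OF _ _ that] s by simp
  qed
qed

end

section \<open>The boundary involution\<close>

locale rev_glued_poly = glued_poly +
  assumes all_rv: "\<And>i. i < 2 * length gl \<Longrightarrow> rv i"
begin

text \<open>The boundary to the right of t is glued to the boundary to the left of rho t.\<close>

definition germ :: "real \<Rightarrow> real \<Rightarrow> bool" where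
  "germ t t' \<longleftrightarrow> (\<exists>i<m. \<exists>u. 0 \<le> u \<and> u < len i \<and> modL L t = modL L (st i + u) \<and>
      modL L t' = modL L (st (pt i) + (len i - u)))"

text \<open>Being one-sided, this is single-valued even at arc ends. The choice is unique modulo
  \<open>L\<close> by \<open>germ_unique\<close>, and \<open>modL\<close> normalises it.\<close>

definition rho :: "real \<Rightarrow> real" where
  "rho t = modL L (SOME t'. germ t t')"

lemma germ_unique: "germ t t1 \<Longrightarrow> germ t t2 \<Longrightarrow> modL L t1 = modL L t2"
proof -
  assume "germ t t1" "germ t t2"
  then obtain i u j w where h: "i < m" "0 \<le> u" "u < len i" "modL L t = modL L (st i + u)"
    "modL L t1 = modL L (st (pt i) + (len i - u))"
    "j < m" "0 \<le> w" "w < len j" "modL L t = modL L (st j + w)"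
    "modL L t2 = modL L (st (pt j) + (len j - w))"
    unfolding germ_def by blast
  then have "i = j \<and> u = w" using arc_coords[of i j u w] by auto
  then show ?thesis using h by simp
qed

lemma germ_inj: "germ t1 t \<Longrightarrow> germ t2 t \<Longrightarrow> modL L t1 = modL L t2"
proof -
  assume "germ t1 t" "germ t2 t"
  then obtain i u j w where h: "i < m" "0 \<le> u" "u < len i" "modL L t1 = modL L (st i + u)"
    "modL L t = modL L (st (pt i) + (len i - u))"
    "j < m" "0 \<le> w" "w < len j" "modL L t2 = modL L (st j + w)"
    "modL L t = modL L (st (pt j) + (len j - w))"
    unfolding germ_def by blast
  then have "pt i = pt j \<and> len i - u = len j - w"
    using arc_coords[of "pt i" "pt j" "len i - u" "len j - w"] pt_less by auto
  then have "i = j" "u = w" by (metis pt_pt) (metis \<open>pt i = pt j \<and> len i - u = len j - w\<close> len_pt diff_left_imp_eq)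
  then show ?thesis using h by simp
qed

lemma germ_cong: "germ t t' \<Longrightarrow> modL L t = modL L s \<Longrightarrow> modL L t' = modL L s' \<Longrightarrow> germ s s'"
  unfolding germ_def by metis

lemma germ_rho: "germ t (rho t)"
proof -
  obtain i u where "i < m" "0 \<le> u" "u < len i" "modL L t = modL L (st i + u)" using arc_cover by blast
  then have "\<exists>t'. germ t t'" unfolding germ_def by blast
  then have "germ t (SOME t'. germ t t')" by (rule someI_ex)
  then show ?thesis using germ_cong[of t _ t "rho t"] L_pos unfolding rho_def by simp
qed

lemma rho_eqI: "germ t t' \<Longrightarrow> rho t = modL L t'"
  using germ_unique[OF germ_rho, of t t'] L_pos unfolding rho_def by simp

lemma rho_range: "rho t \<in> {0..<L}"
  unfolding rho_def using modL_range L_pos by blast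

lemma modL_rho [simp]: "modL L (rho t) = rho t"
  unfolding rho_def using L_pos by simp

lemma rho_cong: "modL L t = modL L s \<Longrightarrow> rho t = rho s"
  using germ_cong[OF germ_rho, of t s "rho t"] rho_eqI[of s "rho t"] by simp

lemma rho_inj: "rho t = rho s \<Longrightarrow> modL L t = modL L s"
  using germ_inj[OF germ_rho[of t]] germ_rho[of s] by simp

text \<open>Moving right inside an arc moves the image left by the same amount. The moved image is
  interior to the partner arc, so there the relation holds in both directions.\<close>

lemma germ_right:
  assumes "germ t t'"
  shows "\<exists>\<epsilon>>0. \<forall>w. 0 < w \<and> w < \<epsilon> \<longrightarrow> germ (t + w) (t' - w) \<and> germ (t' - w) (t + w)"
proof -
  obtain i u where h: "i < m" "0 \<le> u" "u < len i" "modL L t = modL L (st i + u)"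
    "modL L t' = modL L (st (pt i) + (len i - u))" using assms unfolding germ_def by blast
  have "germ (t + w) (t' - w) \<and> germ (t' - w) (t + w)" if w: "0 < w" "w < len i - u" for w
  proof -
    have 1: "modL L (t + w) = modL L (st i + (u + w))"
      using modL_cong_add[OF L_pos h(4), of w w] by (simp add: algebra_simps)
    have 2: "modL L (t' - w) = modL L (st (pt i) + (len i - u - w))"
      using modL_cong_diff[OF L_pos h(5), of w w] by (simp add: algebra_simps)
    have "germ (t + w) (t' - w)" unfolding germ_def
      using h w 1 2 by (intro exI[of _ i] conjI exI[of _ "u + w"]) (auto simp: algebra_simps)
    moreover have "germ (t' - w) (t + w)" unfolding germ_def
      using h w 1 2 pt_less
      by (intro exI[of _ "pt i"] conjI exI[of _ "len i - u - w"]) (auto simp: algebra_simps)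
    ultimately show ?thesis by blast
  qed
  then show ?thesis using h by (intro exI[of _ "len i - u"]) auto
qed

lemma rho_right:
  obtains \<epsilon> where "\<epsilon> > 0" "\<And>w. 0 < w \<Longrightarrow> w < \<epsilon> \<Longrightarrow> rho (t + w) = modL L (rho t - w)"
    "\<And>w. 0 < w \<Longrightarrow> w < \<epsilon> \<Longrightarrow> rho (rho t - w) = modL L (t + w)"
  using germ_right[OF germ_rho[of t]] rho_eqI by metis

lemma rho_left:
  assumes "rho t' = modL L t"
  obtains \<epsilon> where "\<epsilon> > 0" "\<And>w. 0 < w \<Longrightarrow> w < \<epsilon> \<Longrightarrow> rho (t - w) = modL L (t' + w)"
proof -
  obtain \<epsilon> where e: "\<epsilon> > 0" "\<And>w. 0 < w \<Longrightarrow> w < \<epsilon> \<Longrightarrow> rho (rho t' - w) = modL L (t' + w)"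
    using rho_right by metis
  have "rho (rho t' - w) = rho (t - w)" for w
    using assms L_pos by (intro rho_cong modL_cong_diff) auto
  then show ?thesis using that e by metis
qed

text \<open>\<open>y + rho y\<close> is constant modulo \<open>L\<close> on the right of every
  point, and on the left of those where \<open>rho\<close> is an involution, hence on the whole
  interval. At \<open>a\<close> the value comes from the right germ; at \<open>b\<close> it comes
  from the left, where the partner is the preimage \<open>t'\<close> of \<open>b\<close>.\<close>

lemma reflection_on_interval:
  assumes ab: "a < b" and inv: "\<And>y. a < y \<Longrightarrow> y < b \<Longrightarrow> rho (rho y) = modL L y"
  shows "\<And>y. a < y \<Longrightarrow> y < b \<Longrightarrow> modL L (y + rho y) = modL L (a + rho a)"
    and "rho t' = modL L b \<Longrightarrow> modL L (b + t') = modL L (a + rho a)"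
proof -
  define f where "f y = modL L (y + rho y)" for y
  have right: "\<exists>\<epsilon>>0. \<forall>w. 0 < w \<and> w < \<epsilon> \<longrightarrow> f (y + w) = f y" for y
  proof -
    obtain \<epsilon> where e: "\<epsilon> > 0" "\<And>w. 0 < w \<Longrightarrow> w < \<epsilon> \<Longrightarrow> rho (y + w) = modL L (rho y - w)"
      using rho_right by metis
    have "f (y + w) = f y" if "0 < w" "w < \<epsilon>" for w
    proof -
      have "f (y + w) = modL L (y + w + (rho y - w))"
        unfolding f_def e(2)[OF that] using L_pos by (intro modL_cong_add) auto
      then show ?thesis unfolding f_def by simp
    qed
    then show ?thesis using e(1) by blast
  qed
  have left: "\<exists>\<epsilon>>0. \<forall>w. 0 < w \<and> w < \<epsilon> \<longrightarrow> f (y - w) = modL L (y + t')" if r: "rho t' = modL L y" for y t'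
  proof -
    obtain \<epsilon> where e: "\<epsilon> > 0" "\<And>w. 0 < w \<Longrightarrow> w < \<epsilon> \<Longrightarrow> rho (y - w) = modL L (t' + w)"
      using rho_left[OF r] by metis
    have "f (y - w) = modL L (y + t')" if "0 < w" "w < \<epsilon>" for w
    proof -
      have "f (y - w) = modL L (y - w + (t' + w))"
        unfolding f_def e(2)[OF that] using L_pos by (intro modL_cong_add) auto
      then show ?thesis by simp
    qed
    then show ?thesis using e(1) by blast
  qed
  have const: "f x = f y" if "x \<in> {a<..<b}" "y \<in> {a<..<b}" for x y
  proof (rule connected_local_const[where A = "{a<..<b}" and f = f])
    show "connected {a<..<b}" by simp
    show "\<forall>x\<in>{a<..<b}. \<forall>\<^sub>F y in at x within {a<..<b}. f x = f y"
    proof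
      fix x assume x: "x \<in> {a<..<b}"
      obtain e1 where e1: "e1 > 0" "\<And>w. 0 < w \<Longrightarrow> w < e1 \<Longrightarrow> f (x + w) = f x" using right by metis
      obtain e2 where e2: "e2 > 0" "\<And>w. 0 < w \<Longrightarrow> w < e2 \<Longrightarrow> f (x - w) = f x"
        using left[OF inv[of x]] x unfolding f_def by auto
      have "f x = f y" if "y \<noteq> x" "dist y x < min e1 e2" for y
        using e1(2)[of "y - x"] e2(2)[of "x - y"] that by (cases "y < x") (auto simp: dist_real_def)
      then show "\<forall>\<^sub>F y in at x within {a<..<b}. f x = f y"
        unfolding eventually_at using e1 e2 by (intro exI[of _ "min e1 e2"]) auto
    qed
  qed (use that in auto)
  obtain e1 where e1: "e1 > 0" "\<And>w. 0 < w \<Longrightarrow> w < e1 \<Longrightarrow> f (a + w) = f a" using right by metis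
  define w1 where "w1 = min e1 (b - a) / 2"
  have w1: "0 < w1" "w1 < e1" "w1 < b - a" using e1(1) ab unfolding w1_def by auto
  have all: "f y = f a" if "a < y" "y < b" for y
    using const[of y "a + w1"] e1(2)[of w1] w1 that by auto
  then show "\<And>y. a < y \<Longrightarrow> y < b \<Longrightarrow> modL L (y + rho y) = modL L (a + rho a)"
    unfolding f_def by blast
  assume "rho t' = modL L b"
  then obtain e2 where e2: "e2 > 0" "\<And>w. 0 < w \<Longrightarrow> w < e2 \<Longrightarrow> f (b - w) = modL L (b + t')"
    using left by metis
  define w2 where "w2 = min e2 (b - a) / 2"
  have "0 < w2" "w2 < e2" "w2 < b - a" using e2(1) ab unfolding w2_def by auto
  then have "f a = modL L (b + t')" using e2(2)[of w2] all[of "b - w2"] by auto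
  then show "modL L (b + t') = modL L (a + rho a)" unfolding f_def by simp
qed

lemma adj_rho: "s \<in> {0..<L} \<Longrightarrow> adj s (rho s)"
proof -
  assume s: "s \<in> {0..<L}"
  obtain i u where h: "i < m" "0 \<le> u" "u < len i" "modL L s = modL L (st i + u)"
    "modL L (rho s) = modL L (st (pt i) + (len i - u))" using germ_rho[of s] unfolding germ_def by blast
  have "tau i u = st (pt i) + (len i - u)" using all_rv[OF h(1)] unfolding tau_def by simp
  then show ?thesis unfolding adj_def using h s modL_id[of s L] by (intro exI[of _ i] conjI exI[of _ u]) auto
qed

lemma adj_imp_rho:
  assumes "adj s t"
  shows "t = rho s \<or> s = rho t"
proof -
  obtain i u where h: "i < m" "0 \<le> u" "u \<le> len i" "s = modL L (st i + u)" "t = modL L (tau i u)"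
    using assms unfolding adj_def by blast
  have tau: "tau i u = st (pt i) + (len i - u)" using all_rv[OF h(1)] unfolding tau_def by simp
  show ?thesis
  proof (cases "u < len i")
    case True
    then have "germ s t" unfolding germ_def using h tau L_pos by auto
    then show ?thesis using rho_eqI h L_pos by auto
  next
    case False
    then have "germ t s" unfolding germ_def using h tau L_pos pt_less[OF h(1)] len_pos[OF h(1)]
      by (intro exI[of _ "pt i"] conjI exI[of _ 0]) auto
    then show ?thesis using rho_eqI h L_pos by auto
  qed
qed

text \<open>\<open>adj\<close> links a point only to its image or to a preimage under
  \<open>rho\<close>. On a finite invariant set the injective \<open>rho\<close> is a permutation,
  so preimages stay inside as well.\<close>

lemma rho_closed:
  assumes X: "finite X" "X \<subseteq> {0..<L}" "rho ` X \<subseteq> X" and p: "pglued n v gl s t" "s \<in> X"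
  shows "t \<in> X"
proof (rule pglued_closed[OF p])
  fix x y assume x: "x \<in> X" and a: "adj x y"
  have inj: "inj_on rho X"
    using X(2) rho_inj by (intro inj_onI) (metis modL_id atLeastLessThan_iff subsetD)
  then have "rho ` X = X" using X endo_inj_surj by blast
  then show "y \<in> X" using adj_imp_rho[OF a] x
  proof (elim disjE)
    assume "x = rho y"
    moreover obtain z where "z \<in> X" "x = rho z" using \<open>rho ` X = X\<close> x by blast
    ultimately have "modL L y = modL L z" using rho_inj by metis
    then have "y = z" using adj_in_range[OF a] X(2) \<open>z \<in> X\<close> modL_id[of y L] modL_id[of z L] by auto
    then show ?thesis using \<open>z \<in> X\<close> by simp
  qed (use X in auto)
qed

abbreviation "cls s \<equiv> pclass n v gl s"

lemma cls_iff: "t \<in> cls s \<longleftrightarrow> t \<in> {0..<L} \<and> pglued n v gl s t"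
  unfolding pclass_def by simp

lemma cls_self: "s \<in> {0..<L} \<Longrightarrow> s \<in> cls s"
  unfolding cls_iff using pglued_refl by blast

lemma cls_eq: "t \<in> cls s \<Longrightarrow> cls t = cls s"
proof -
  assume "t \<in> cls s"
  then have "pglued n v gl s t" by (simp add: cls_iff)
  then have "pglued n v gl t y \<longleftrightarrow> pglued n v gl s y" for y
    using pglued_sym[of s t] pglued_trans[of s t y] pglued_trans[of t s y] by argo
  then show ?thesis unfolding pclass_def by simp
qed

lemma rho_in_cls: "t \<in> cls s \<Longrightarrow> rho t \<in> cls s"
proof -
  assume "t \<in> cls s"
  moreover have "pglued n v gl t (rho t)"
    using adj_rho calculation cls_iff unfolding pglued_eq by blast
  ultimately show ?thesis using cls_iff pglued_trans rho_range by blast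
qed

lemma rho_inj_range: "s \<in> {0..<L} \<Longrightarrow> t \<in> {0..<L} \<Longrightarrow> rho s = rho t \<Longrightarrow> s = t"
  using rho_inj[of s t] modL_id[of s L] modL_id[of t L] by auto

text \<open>A point interior to an arc has at most one partner. The other points form the finite set
  \<open>F\<close>, which \<open>rho\<close> maps into itself, because an image interior to an arc
  comes from a point interior to the partner arc.\<close>

lemma finite_cls: "s \<in> {0..<L} \<Longrightarrow> finite (cls s)"
proof -
  assume s: "s \<in> {0..<L}"
  define F where "F = {0..<L} - (\<Union>i<m. parc L (st i) (len i))"
  show ?thesis
  proof (cases "s \<in> F")
    case False
    then obtain i u where h: "i < m" "0 < u" "u < len i" "s = modL L (st i + u)"
      using s unfolding F_def parc_def by auto
    then have "cls s \<subseteq> {s, modL L (tau i u)}" using open_arc_class cls_iff by blast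
    then show ?thesis using finite_subset by blast
  next
    case True
    have "rho t \<in> F" if t: "t \<in> F" for t
    proof (rule ccontr)
      assume "rho t \<notin> F"
      then obtain j w where j: "j < m" "0 < w" "w < len j" "rho t = modL L (st j + w)"
        using rho_range[of t] unfolding F_def parc_def by auto
      obtain i u where h: "i < m" "0 \<le> u" "u < len i" "modL L t = modL L (st i + u)"
        "modL L (rho t) = modL L (st (pt i) + (len i - u))" using germ_rho[of t] unfolding germ_def by blast
      have "modL L (st (pt i) + (len i - u)) = modL L (st j + w)" using h(5) j(4) L_pos by simp
      then have "pt i = j \<and> len i - u = w"
        using arc_coords[of "pt i" j "len i - u" w] pt_less[of i] h(1-3) j(1-3) by simp
      then have "0 < u" using j len_pt[of i] by auto
      moreover have "modL L t = t" using t modL_id unfolding F_def by auto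
      ultimately have "\<exists>x. 0 < x \<and> x < len i \<and> t = modL L (st i + x)" using h(3,4) by metis
      then have "t \<in> parc L (st i) (len i)" unfolding parc_def by simp
      then show False using t h(1) unfolding F_def by auto
    qed
    then have "rho ` F \<subseteq> F" by blast
    moreover have fin: "finite F" using arcs_cofinite unfolding F_def .
    moreover have "F \<subseteq> {0..<L}" unfolding F_def by blast
    ultimately have "t \<in> F" if "t \<in> cls s" for t
      using rho_closed[of F s t] True that by (simp add: cls_iff)
    then show ?thesis using fin by (meson finite_subset subsetI)
  qed
qed

text \<open>If \<open>rho\<close> were not an involution at \<open>t\<close>, then \<open>t\<close>,
  \<open>rho t\<close> and \<open>rho (rho t)\<close> would be three members of the class.\<close>

lemma rho_rho_of_small:
  assumes t: "t \<in> {0..<L}" and c: "card (cls t) \<le> 2"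
  shows "rho (rho t) = t" "cls t = {t, rho t}"
proof -
  show inv: "rho (rho t) = t"
  proof (rule ccontr)
    assume a: "rho (rho t) \<noteq> t"
    then have "rho t \<noteq> t" by metis
    moreover from this have "rho (rho t) \<noteq> rho t" using rho_inj_range t rho_range by metis
    ultimately have "card {t, rho t, rho (rho t)} = 3" using a by auto
    moreover have "{t, rho t, rho (rho t)} \<subseteq> cls t" using rho_in_cls cls_self[OF t] by auto
    ultimately have "3 \<le> card (cls t)" using card_mono[OF finite_cls[OF t]] by metis
    then show False using c by simp
  qed
  have "cls t \<subseteq> {t, rho t}"
    using rho_closed[of "{t, rho t}" t] t rho_range inv cls_iff by auto
  then show "cls t = {t, rho t}" using rho_in_cls cls_self[OF t] by auto
qed

text \<open>A shorter cycle of \<open>rho\<close> would be a finite invariant set and thus already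
  the whole class.\<close>

lemma three_cycle:
  assumes t: "t \<in> {0..<L}" and c: "card (cls t) = 3"
  shows "cls t = {t, rho t, rho (rho t)}" "rho (rho (rho t)) = t" "rho t \<noteq> t" "rho (rho t) \<noteq> t"
    "rho (rho t) \<noteq> rho t"
proof -
  show 1: "rho t \<noteq> t"
  proof
    assume "rho t = t"
    then have "cls t \<subseteq> {t}" using rho_closed[of "{t}" t] t cls_iff by auto
    then show False using c card_mono[of "{t}" "cls t"] by auto
  qed
  show 2: "rho (rho t) \<noteq> t"
  proof
    assume "rho (rho t) = t"
    then have "cls t \<subseteq> {t, rho t}" using rho_closed[of "{t, rho t}" t] t rho_range cls_iff by auto
    then have "card (cls t) \<le> card {t, rho t}" by (intro card_mono) auto
    also have "\<dots> \<le> 2" by (simp add: card_insert_if)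
    finally show False using c by simp
  qed
  show 3: "rho (rho t) \<noteq> rho t" using 1 rho_inj_range t rho_range by metis
  have card3: "card {t, rho t, rho (rho t)} = 3" using 1 2 3 by auto
  have "{t, rho t, rho (rho t)} \<subseteq> cls t" using rho_in_cls cls_self[OF t] by auto
  then show 4: "cls t = {t, rho t, rho (rho t)}"
    using card_subset_eq[OF finite_cls[OF t]] card3 c by metis
  have "rho (rho (rho t)) \<in> {t, rho t, rho (rho t)}"
    using 4 rho_in_cls cls_self[OF t] by blast
  then show "rho (rho (rho t)) = t" using 1 2 3 rho_inj_range t rho_range by (metis empty_iff insert_iff)
qed

end

section \<open>Turning angles and junctions\<close>

text \<open>The signed angle from \<open>a\<close> to \<open>b\<close>. Unlike
  \<open>vec_angle\<close> it is additive modulo 2 pi, which \<open>cis\<close> makes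
  visible.\<close>

definition ang :: "complex \<Rightarrow> complex \<Rightarrow> real" where
  "ang a b = Arg (b / a)"

lemma Im_divide_cross: "Im (b / a) = cross a b / (cmod a)^2"
  by (simp add: Im_divide cross_def cmod_power2 algebra_simps)

lemma cross_pos_nz: "cross a b > 0 \<Longrightarrow> a \<noteq> 0 \<and> b \<noteq> 0"
  by (auto simp: cross_def)

lemma ang_bounds: "cross a b > 0 \<Longrightarrow> 0 < ang a b \<and> ang a b < pi"
  unfolding ang_def using cross_pos_nz[of a b] by (subst Arg_lt_pi) (simp add: Im_divide_cross)

lemma vec_angle_ang:
  assumes "cross a b > 0"
  shows "vec_angle a b = ang a b"
proof -
  have nz: "a \<noteq> 0" "b \<noteq> 0" using cross_pos_nz assms by auto
  have "cos (Arg (b / a)) = Re (b / a) / cmod (b / a)"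
    using nz cos_Arg[of "b / a"] by simp
  also have "Re (b / a) = (a \<bullet> b) / (cmod a)^2"
    by (simp add: Re_divide inner_complex_def cmod_power2 algebra_simps)
  also have "(a \<bullet> b) / (cmod a)^2 / cmod (b / a) = (a \<bullet> b) / (norm a * norm b)"
    using nz by (simp add: norm_divide power2_eq_square field_simps)
  finally have "vec_angle a b = arccos (cos (ang a b))" unfolding vec_angle_def ang_def by simp
  then show ?thesis using ang_bounds[OF assms] arccos_cos by simp
qed

lemma vec_angle_sym: "vec_angle a b = vec_angle b a"
  unfolding vec_angle_def by (simp add: inner_commute mult.commute)

lemma vec_angle_cnj: "vec_angle (cnj a) (cnj b) = vec_angle a b"
  unfolding vec_angle_def by (simp add: inner_complex_def)

text \<open>Lifts identities of angles modulo 2 pi to identities of real numbers.\<close>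

lemma cis_eq_1_small:
  assumes "cis x = 1" "\<bar>x\<bar> < 2 * pi"
  shows "x = 0"
proof -
  have "cos x = 1" using assms(1) by (metis cis.sel(1) one_complex.sel(1))
  then obtain k :: int where k: "x = of_int k * 2 * pi" using cos_one_2pi_int by blast
  then have "\<bar>of_int k\<bar> * (2 * pi) < 1 * (2 * pi)" using assms(2) by (simp add: abs_mult)
  then have "\<bar>of_int k :: real\<bar> < 1" by (simp only: mult_less_cancel_right) auto
  then show ?thesis using k by simp
qed

lemma cis_ang: "a \<noteq> 0 \<Longrightarrow> b \<noteq> 0 \<Longrightarrow> cis (ang a b) = sgn (b / a)"
  unfolding ang_def by (simp add: cis_Arg)

lemma ang_add:
  assumes "cross a b > 0" "cross b c > 0" "cross a c > 0"
  shows "ang a c = ang a b + ang b c"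
proof -
  have nz: "a \<noteq> 0" "b \<noteq> 0" "c \<noteq> 0" using cross_pos_nz assms by auto
  have "cis (ang a b + ang b c) = sgn (b / a * (c / b))"
    using nz by (simp add: cis_mult[symmetric] cis_ang sgn_mult sgn_zero_iff)
  also have "\<dots> = cis (ang a c)" using nz by (simp add: cis_ang)
  finally have "cis (ang a b + ang b c - ang a c) = 1" by (simp add: cis_divide[symmetric])
  moreover have "\<bar>ang a b + ang b c - ang a c\<bar> < 2 * pi"
    using ang_bounds[OF assms(1)] ang_bounds[OF assms(2)] ang_bounds[OF assms(3)] by linarith
  ultimately show ?thesis using cis_eq_1_small by fastforce
qed

text \<open>The three quotients of side vectors multiply to -1, so the sum is pi modulo 2 pi; all
  three angles lie between 0 and pi.\<close>

lemma triangle_angle_sum: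
  assumes "cross (y - x) (z - x) > 0"
  shows "ang (y - x) (z - x) + ang (z - y) (x - y) + ang (x - z) (y - z) = pi"
proof -
  have c: "cross (z - y) (x - y) > 0" "cross (x - z) (y - z) > 0"
    using assms by (simp_all add: cross_def algebra_simps)
  have nz: "x \<noteq> y" "y \<noteq> z" "x \<noteq> z" using cross_pos_nz[OF assms] cross_pos_nz[OF c(1)] by auto
  let ?S = "ang (y - x) (z - x) + ang (z - y) (x - y) + ang (x - z) (y - z)"
  have "cis ?S = sgn ((z - x) / (y - x) * ((x - y) / (z - y)) * ((y - z) / (x - z)))"
    using nz by (simp add: cis_mult[symmetric] cis_ang sgn_mult sgn_zero_iff)
  also have "(z - x) / (y - x) * ((x - y) / (z - y)) * ((y - z) / (x - z)) = -1"
  proof -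
    have "a / b * (- b / c) * (- c / - a) = -1" if "a \<noteq> 0" "b \<noteq> 0" "c \<noteq> 0" for a b c :: complex
      using that by simp
    from this[of "z - x" "y - x" "z - y"] show ?thesis using nz by simp
  qed
  finally have "cis (?S - pi) = 1" by (simp add: cis_divide[symmetric] sgn_minus)
  moreover have "\<bar>?S - pi\<bar> < 2 * pi"
    using ang_bounds[OF assms] ang_bounds[OF c(1)] ang_bounds[OF c(2)] by linarith
  ultimately show ?thesis using cis_eq_1_small by fastforce
qed

lemma prv_Suc: "Suc i < n \<Longrightarrow> prv n (Suc i) = i"
  by (simp add: prv_def)

lemma prv_0: "n > 0 \<Longrightarrow> prv n 0 = n - 1"
  by (simp add: prv_def)

lemma (in opoly) interior_angle_bounds:
  assumes "i < n"
  shows "0 < interior_angle n v i" "interior_angle n v i < pi"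
proof -
  define p where "p = prv n i"
  have p: "p < n" "nxt n p = i" "p \<noteq> i"
    using assms n3 prv_less nxt_prv nxt_neq unfolding p_def by (auto, metis)
  have "p \<noteq> nxt n i" using nxt_nxt_neq[OF n3 assms] p by metis
  then have c: "e * cross (v (nxt n i) - v i) (v p - v i) > 0"
    using left_strict[of i p] p assms unfolding edgev_def by auto
  show "0 < interior_angle n v i" "interior_angle n v i < pi"
  proof (atomize (full), cases "e = 1")
    case True
    then show "0 < interior_angle n v i \<and> interior_angle n v i < pi"
      using ang_bounds vec_angle_ang c vec_angle_sym unfolding interior_angle_def p_def by auto
  next
    case False
    then have "cross (v p - v i) (v (nxt n i) - v i) > 0"
      using c e_cases by (simp add: cross_def algebra_simps)
    then show "0 < interior_angle n v i \<and> interior_angle n v i < pi"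
      using ang_bounds vec_angle_ang unfolding interior_angle_def p_def by auto
  qed
qed

text \<open>Fan triangulation from \<open>v 0\<close> into \<open>N = n - 2\<close> triangles:
  \<open>A i\<close>, \<open>B i\<close>, \<open>C i\<close> are the angles at \<open>v 0\<close>,
  \<open>v i\<close>, \<open>v (Suc i)\<close> in triangle \<open>i\<close>.\<close>

lemma angle_sum_ccw:
  assumes o: "oriented 1 n v"
  shows "(\<Sum>i<n. interior_angle n v i) = (real n - 2) * pi"
proof -
  interpret opoly n v 1 by unfold_locales (rule o)
  obtain N where N: "n = Suc (Suc N)" "N \<ge> 1" using n3 by (metis Suc_le_D le_SucE numeral_3_eq_3 Suc_le_mono One_nat_def)
  have strict: "cross (v (Suc k) - v k) (v j - v k) > 0" if "Suc k < n" "j < n" "j \<noteq> k" "j \<noteq> Suc k" for k j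
    using left_strict[of k j] that nxt_Suc[of k n] unfolding edgev_def by simp
  have last: "cross (v 0 - v (Suc N)) (v j - v (Suc N)) > 0" if "j < n" "j \<noteq> 0" "j \<noteq> Suc N" for j
    using left_strict[of "Suc N" j] that nxt_last[of "Suc N" n] N unfolding edgev_def by simp
  define A where "A i = ang (v i - v 0) (v (Suc i) - v 0)" for i
  define B where "B i = ang (v (Suc i) - v i) (v 0 - v i)" for i
  define C where "C i = ang (v 0 - v (Suc i)) (v i - v (Suc i))" for i
  have c0: "cross (v i - v 0) (v (Suc i) - v 0) > 0" if "1 \<le> i" "i \<le> N" for i
    using strict[of i 0] that N by (simp add: cross_def algebra_simps)
  have c1: "cross (v (Suc i) - v i) (v 0 - v i) > 0" if "1 \<le> i" "i \<le> N" for i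
    using strict[of i 0] that N by auto
  have c2: "cross (v 0 - v (Suc i)) (v i - v (Suc i)) > 0" if "1 \<le> i" "i \<le> N" for i
    using strict[of i 0] that N by (simp add: cross_def algebra_simps)
  have tri: "A i + B i + C i = pi" if "1 \<le> i" "i \<le> N" for i
    using triangle_angle_sum[of "v i" "v 0" "v (Suc i)"] c0[OF that] unfolding A_def B_def C_def by simp
  have fan: "ang (v 1 - v 0) (v (Suc k) - v 0) = (\<Sum>i=1..k. A i)" if "1 \<le> k" "k \<le> N" for k
    using that
  proof (induction k)
    case (Suc k)
    show ?case
    proof (cases "k = 0")
      case True then show ?thesis unfolding A_def by simp
    next
      case False
      have "ang (v 1 - v 0) (v (Suc (Suc k)) - v 0) = ang (v 1 - v 0) (v (Suc k) - v 0) + A (Suc k)"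
        unfolding A_def using Suc.prems N False strict[of 0] c0[of "Suc k"] by (intro ang_add) auto
      then show ?thesis using Suc False by simp
    qed
  qed simp
  define al where "al i = interior_angle n v i" for i
  have al0: "al 0 = (\<Sum>i=1..N. A i)"
  proof -
    have "al 0 = vec_angle (v 1 - v 0) (v (Suc N) - v 0)"
      unfolding al_def interior_angle_def using N nxt_Suc[of 0 n] prv_0[of n] vec_angle_sym by simp
    also have "\<dots> = ang (v 1 - v 0) (v (Suc N) - v 0)"
      using strict[of 0 "Suc N"] N by (intro vec_angle_ang) auto
    finally show ?thesis using fan[of N] N by simp
  qed
  have al1: "al 1 = B 1"
  proof -
    have "al 1 = vec_angle (v 2 - v 1) (v 0 - v 1)"
      unfolding al_def interior_angle_def using N nxt_Suc[of 1 n] prv_Suc[of 0 n] vec_angle_sym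
      by (simp add: numeral_2_eq_2)
    then show ?thesis using c1[of 1] N unfolding B_def
      by (subst (asm) vec_angle_ang) (auto simp: numeral_2_eq_2)
  qed
  have alm: "al (Suc i) = B (Suc i) + C i" if "1 \<le> i" "Suc i \<le> N" for i
  proof -
    have "al (Suc i) = vec_angle (v (Suc (Suc i)) - v (Suc i)) (v i - v (Suc i))"
      unfolding al_def interior_angle_def using N that nxt_Suc[of "Suc i" n] prv_Suc[of i n] vec_angle_sym
      by simp
    also have "\<dots> = ang (v (Suc (Suc i)) - v (Suc i)) (v i - v (Suc i))"
      using strict[of "Suc i" i] N that by (intro vec_angle_ang) auto
    also have "\<dots> = B (Suc i) + C i"
      unfolding B_def C_def using strict[of "Suc i" i] c1[of "Suc i"] c2[of i] N that by (intro ang_add) auto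
    finally show ?thesis .
  qed
  have all: "al (Suc N) = C N"
  proof -
    have "al (Suc N) = vec_angle (v 0 - v (Suc N)) (v N - v (Suc N))"
      unfolding al_def interior_angle_def using N nxt_last[of "Suc N" n] prv_Suc[of N n] vec_angle_sym by simp
    then show ?thesis using c2[of N] N unfolding C_def by (subst (asm) vec_angle_ang) auto
  qed
  have part: "(\<Sum>i=1..k. al i) = (\<Sum>i=1..k. B i) + (\<Sum>i=1..k-1. C i)" if "1 \<le> k" "k \<le> N" for k
    using that
  proof (induction k)
    case (Suc k)
    show ?case
    proof (cases "k = 0")
      case True then show ?thesis using al1 by simp
    next
      case False
      then have "(\<Sum>i=1..k-1. C i) + C k = (\<Sum>i=1..k. C i)" by (cases k) auto
      then show ?thesis using Suc False alm[of k] by simp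
    qed
  qed simp
  have "(\<Sum>i<n. al i) = al 0 + (\<Sum>i=1..N. al i) + al (Suc N)"
  proof -
    have "{..<n} = insert 0 (insert (Suc N) {1..N})" using N by auto
    then show ?thesis by simp
  qed
  also have "\<dots> = (\<Sum>i=1..N. A i) + (\<Sum>i=1..N. B i) + ((\<Sum>i=1..N-1. C i) + C N)"
    using al0 part[of N] all N by simp
  also have "(\<Sum>i=1..N-1. C i) + C N = (\<Sum>i=1..N. C i)" using N by (cases N) auto
  also have "(\<Sum>i=1..N. A i) + (\<Sum>i=1..N. B i) + (\<Sum>i=1..N. C i) = (\<Sum>i=1..N. pi)"
    unfolding sum.distrib[symmetric] using tri by (intro sum.cong) auto
  finally show ?thesis unfolding al_def using N by simp
qed

text \<open>Complex conjugation reverses the orientation and preserves all angles.\<close>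

lemma (in opoly) angle_sum: "(\<Sum>i<n. interior_angle n v i) = (real n - 2) * pi"
proof (cases "e = 1")
  case True
  then show ?thesis using angle_sum_ccw oriented by simp
next
  case False
  then have e: "e = -1" using e_cases by simp
  have "oriented 1 n (\<lambda>k. cnj (v k))"
    using oriented unfolding oriented_def e by (auto simp: cross_def algebra_simps)
  then have "(\<Sum>i<n. interior_angle n (\<lambda>k. cnj (v k)) i) = (real n - 2) * pi" by (rule angle_sum_ccw)
  moreover have "interior_angle n (\<lambda>k. cnj (v k)) i = interior_angle n v i" for i
    unfolding interior_angle_def using vec_angle_cnj by (metis complex_cnj_diff)
  ultimately show ?thesis by simp
qed

text \<open>The relation of a boundary that is zipped on the arc from b + l to b + L, its ends being
  glued together, and is then halved: on the arc from b to b + l the reflection x \<mapsto> c - x modulo l.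
  The three points b, b + l, b + c form one class. For l = L this is a perimeter halving.\<close>

definition folded :: "real \<Rightarrow> real \<Rightarrow> real \<Rightarrow> real \<Rightarrow> real \<Rightarrow> real \<Rightarrow> bool" where
  "folded L b l c s t \<longleftrightarrow> s = t \<or>
     (let x = modL L (s - b); y = modL L (t - b) in
        x \<in> {0, l} \<and> y \<in> {0, l} \<or>
        x \<le> l \<and> y \<le> l \<and> (x + y = c \<or> x + y = c + l) \<or>
        x \<ge> l \<and> y \<ge> l \<and> x + y = L + l)"

section \<open>Turning angles and the face angle at a class\<close>

context opoly
begin

definition turn :: "nat \<Rightarrow> real" where
  "turn i = pi - interior_angle n v i"

lemma turn_bounds: "i < n \<Longrightarrow> 0 < turn i" "i < n \<Longrightarrow> turn i < pi"
  unfolding turn_def using interior_angle_bounds by auto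

lemma turn_sum: "(\<Sum>i<n. turn i) = 2 * pi"
  unfolding turn_def by (simp add: sum_subtractf angle_sum algebra_simps)

text \<open>Turning angles are positive, so only the full set of vertices reaches 2 pi. The bounds
  on class sizes rest on this strictness.\<close>

lemma turn_sum_strict:
  assumes "V \<subset> {..<n}"
  shows "(\<Sum>i\<in>V. turn i) < 2 * pi"
proof -
  obtain j where j: "j < n" "j \<notin> V" using assms by blast
  have "(\<Sum>i\<in>V. turn i) < (\<Sum>i<n. turn i)"
    using assms j turn_bounds by (intro sum_strict_mono2[of _ _ j]) (auto simp: less_imp_le)
  then show ?thesis using turn_sum by simp
qed

definition big :: "nat set" where
  "big = {i. i < n \<and> turn i \<ge> pi / 2}"

lemma card_big: "card big \<le> 4"
proof -
  have "real (card big) * (pi / 2) = (\<Sum>i\<in>big. pi / 2)" by simp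
  also have "\<dots> \<le> (\<Sum>i\<in>big. turn i)" by (intro sum_mono) (auto simp: big_def)
  also have "\<dots> \<le> (\<Sum>i<n. turn i)"
    using turn_bounds by (intro sum_mono2) (auto simp: big_def less_imp_le)
  also have "\<dots> = 4 * (pi / 2)" using turn_sum by simp
  finally have "real (card big) \<le> 4" by (simp only: mult_le_cancel_right) auto
  then show ?thesis by simp
qed

definition vset :: "real set \<Rightarrow> nat set" where
  "vset C = {i. i < n \<and> vp i \<in> C}"

lemma finite_vset [simp]: "finite (vset C)"
  unfolding vset_def by simp

lemma face_angle_vertex: "i < n \<Longrightarrow> face_angle n v (vp i) = interior_angle n v i"
proof -
  assume i: "i < n"
  have "(THE j. j < n \<and> bpt n v (vp i) = v j) = i"
    using i v_eq_iff bpt_plen by (intro the_equality) auto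
  then show ?thesis unfolding face_angle_def using i bpt_plen by auto
qed

lemma face_angle_other: "t \<in> {0..<L} \<Longrightarrow> t \<notin> vp ` {..<n} \<Longrightarrow> face_angle n v t = pi"
proof -
  assume t: "t \<in> {0..<L}" "t \<notin> vp ` {..<n}"
  have "\<not> (\<exists>i<n. bpt n v t = v i)"
  proof
    assume "\<exists>i<n. bpt n v t = v i"
    then obtain i where "i < n" "t = vp i" using bpt_eq_vertex[OF t(1)] by blast
    then show False using t(2) by blast
  qed
  then show ?thesis unfolding face_angle_def by (rule if_not_P)
qed

lemma inj_vp: "inj_on vp {..<n}"
  using plen_eq_iff by (auto intro!: inj_onI)

lemma face_angle_sum:
  assumes C: "finite C" "C \<subseteq> {0..<L}"
  shows "(\<Sum>t\<in>C. face_angle n v t) = real (card C) * pi - (\<Sum>i\<in>vset C. turn i)"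
proof -
  have "(\<Sum>t\<in>C. pi - face_angle n v t) = (\<Sum>t\<in>vp ` vset C. pi - face_angle n v t)"
  proof (intro sum.mono_neutral_right)
    show "\<forall>t\<in>C - vp ` vset C. pi - face_angle n v t = 0"
    proof
      fix t assume t: "t \<in> C - vp ` vset C"
      then have "t \<notin> vp ` {..<n}" unfolding vset_def by blast
      then show "pi - face_angle n v t = 0" using face_angle_other C t by auto
    qed
  qed (use C in \<open>auto simp: vset_def\<close>)
  also have "\<dots> = (\<Sum>i\<in>vset C. pi - face_angle n v (vp i))"
    using inj_vp by (subst sum.reindex) (auto simp: vset_def intro: inj_on_subset)
  also have "\<dots> = (\<Sum>i\<in>vset C. turn i)"
    by (intro sum.cong) (auto simp: turn_def face_angle_vertex vset_def)
  finally show ?thesis by (simp add: sum_subtractf)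
qed

lemma card_vset: "finite C \<Longrightarrow> card (vset C) \<le> card C"
proof -
  assume "finite C"
  moreover have "vp ` vset C \<subseteq> C" unfolding vset_def by auto
  moreover have "card (vp ` vset C) = card (vset C)"
    using inj_vp by (intro card_image) (auto simp: vset_def intro: inj_on_subset)
  ultimately show ?thesis using card_mono by metis
qed

end

section \<open>Class sizes and the two shapes of a gluing\<close>

locale alek_poly = rev_glued_poly +
  assumes n7: "n \<ge> 7"
    and angles: "\<And>s. s \<in> {0..<perim n v} \<Longrightarrow> (\<Sum>t\<in>pclass n v gl s. face_angle n v t) \<le> 2 * pi"
begin

lemma cls_subset: "cls s \<subseteq> {0..<L}"
  unfolding pclass_def by blast

lemma turn_ge:
  assumes "s \<in> {0..<L}"
  shows "(real (card (cls s)) - 2) * pi \<le> (\<Sum>i\<in>vset (cls s). turn i)"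
  using angles[OF assms] face_angle_sum[OF finite_cls[OF assms] cls_subset]
  by (simp add: algebra_simps)

lemma turn_sum_le: "V \<subseteq> {..<n} \<Longrightarrow> (\<Sum>i\<in>V. turn i) \<le> 2 * pi"
  using turn_sum_strict[of V] turn_sum by (cases "V = {..<n}") (auto simp: psubset_eq)

lemma vset_subset: "vset C \<subseteq> {..<n}"
  unfolding vset_def by auto

text \<open>Four points already require a turning of 2 pi and hence all vertices in the class. The
  same total forbids more than four points, so there would be at most four vertices.\<close>

lemma cls_card_le_3: "s \<in> {0..<L} \<Longrightarrow> card (cls s) \<le> 3"
proof (rule ccontr)
  assume s: "s \<in> {0..<L}" and c: "\<not> card (cls s) \<le> 3"
  have "(real (card (cls s)) - 2) * pi \<le> 2 * pi"
    using turn_ge[OF s] turn_sum_le[OF vset_subset[of "cls s"]] by linarith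
  then have "real (card (cls s)) - 2 \<le> 2" by (simp only: mult_le_cancel_right) auto
  then have 4: "card (cls s) \<le> 4" by simp
  have "2 * pi \<le> (real (card (cls s)) - 2) * pi" using c by (intro mult_right_mono) auto
  then have "\<not> (\<Sum>i\<in>vset (cls s). turn i) < 2 * pi" using turn_ge[OF s] by linarith
  then have "vset (cls s) = {..<n}" using turn_sum_strict vset_subset by blast
  then show False using card_vset[OF finite_cls[OF s]] 4 n7 by simp
qed

text \<open>Two such classes together need a turning of 2 pi and hence all of the at least seven
  vertices, but they offer six points.\<close>

lemma unique_junction:
  assumes s: "s \<in> {0..<L}" "card (cls s) = 3" and t: "t \<in> {0..<L}" "card (cls t) = 3"
  shows "cls t = cls s"
proof (rule ccontr)
  assume ne: "cls t \<noteq> cls s"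
  have disj: "vset (cls s) \<inter> vset (cls t) = {}"
    using ne cls_eq unfolding vset_def by blast
  have "(\<Sum>i\<in>vset (cls s) \<union> vset (cls t). turn i) \<ge> 2 * pi"
    using turn_ge[OF s(1)] turn_ge[OF t(1)] s t disj by (simp add: sum.union_disjoint)
  then have "vset (cls s) \<union> vset (cls t) = {..<n}"
    using turn_sum_strict vset_subset by (meson Un_least not_less psubsetI)
  then have "n \<le> card (vset (cls s)) + card (vset (cls t))"
    by (metis card_Un_le card_lessThan)
  then show False
    using card_vset[OF finite_cls[OF s(1)]] card_vset[OF finite_cls[OF t(1)]] s t n7 by simp
qed

lemma junction_vertices:
  assumes s: "s \<in> {0..<L}" "card (cls s) = 3"
  shows "card (vset (cls s)) \<ge> 2"
proof (rule ccontr)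
  assume "\<not> card (vset (cls s)) \<ge> 2"
  then consider "card (vset (cls s)) = 0" | "card (vset (cls s)) = 1" by linarith
  then have "(\<Sum>i\<in>vset (cls s). turn i) < pi"
  proof cases
    case 2
    then obtain i where "vset (cls s) = {i}" using card_1_singletonE by blast
    then show ?thesis using turn_bounds(2)[of i] vset_subset[of "cls s"] by auto
  qed simp
  then show False using turn_ge[OF s(1)] s(2) by simp
qed

lemma shift_inj: "s \<in> {0..<L} \<Longrightarrow> t \<in> {0..<L} \<Longrightarrow> modL L (s - b) = modL L (t - b) \<longleftrightarrow> s = t"
  using modL_shift[of b s] modL_shift[of b t] modL_id[of s L] modL_id[of t L]
  by (metis atLeastLessThan_iff)

text \<open>Without a junction \<open>rho\<close> is an involution everywhere, so a single
  reflection describes the whole boundary; its constant is the image of 0.\<close>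

lemma halving_structure:
  assumes small: "\<And>s. s \<in> {0..<L} \<Longrightarrow> card (cls s) \<le> 2"
  obtains c where "0 \<le> c" "c < L"
    "\<And>s t. s \<in> {0..<L} \<Longrightarrow> t \<in> {0..<L} \<Longrightarrow> pglued n v gl s t \<longleftrightarrow> folded L 0 L c s t"
proof -
  define c where "c = rho 0"
  have c: "0 \<le> c" "c < L" using rho_range[of 0] unfolding c_def by auto
  have rr: "rho (rho y) = modL L y" for y
    using rho_rho_of_small(1)[OF modL_range[OF L_pos] small[OF modL_range[OF L_pos]], of y]
      rho_cong[of "modL L y" y] L_pos by simp
  have sum: "modL L (y + rho y) = c" if "y \<in> {0..<L}" for y
    using reflection_on_interval(1)[OF L_pos rr, of y] that c modL_id[of c L]
    by (cases "y = 0") (auto simp: c_def)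
  have rho: "t = rho s \<longleftrightarrow> s + t = c \<or> s + t = c + L" if st: "s \<in> {0..<L}" "t \<in> {0..<L}" for s t
  proof
    assume t: "t = rho s"
    obtain k :: int where k: "c = s + t + of_int k * L"
      using modL_ex[of L "s + t"] sum[OF st(1)] t by metis
    \<comment> \<open>Since \<open>s + t\<close> lies in [0, 2 L) and \<open>c\<close> in [0, L),
      the multiple \<open>k\<close> can only be 0 or -1.\<close>
    have "of_int k * L < 1 * L" "(-2) * L < of_int k * L"
      using k st c unfolding atLeastLessThan_iff by linarith+
    then have "of_int k < (1::real)" "(-2) < (of_int k :: real)"
      using L_pos by (simp_all only: mult_less_cancel_right)
    then have "k = 0 \<or> k = -1" by linarith
    then show "s + t = c \<or> s + t = c + L" using k by auto
  next
    assume h: "s + t = c \<or> s + t = c + L"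
    have "modL L (s + t) = c"
      using h modL_add_self[OF L_pos, of c] modL_id[of c L] c by auto
    then have "modL L (s + t) = modL L (s + rho s)" using sum[OF st(1)] by simp
    then have "modL L t = modL L (rho s)"
      using modL_cong_diff[OF L_pos, of "s + t" "s + rho s" s s] by simp
    then show "t = rho s" using st modL_id[of t L] by simp
  qed
  have "pglued n v gl s t \<longleftrightarrow> folded L 0 L c s t" if st: "s \<in> {0..<L}" "t \<in> {0..<L}" for s t
  proof -
    have "pglued n v gl s t \<longleftrightarrow> t = s \<or> t = rho s"
      using rho_rho_of_small(2)[OF st(1) small[OF st(1)]] cls_iff[of t s] st by auto
    also have "\<dots> \<longleftrightarrow> folded L 0 L c s t"
      unfolding rho[OF st] folded_def Let_def using st modL_id[of s L] modL_id[of t L] by auto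
    finally show ?thesis .
  qed
  then show ?thesis using that c by blast
qed

text \<open>The junction cuts the boundary into three gaps on which \<open>rho\<close> is an
  involution and hence a reflection. The 3-cycle on the junction supplies the three
  constants.\<close>

lemma junction_structure:
  assumes b: "b \<in> {0..<L}" and C: "card (cls b) = 3"
    and a: "a \<in> cls b" and x: "x \<in> cls b"
  defines "l \<equiv> modL L (a - b)" and "c \<equiv> modL L (x - b)"
  assumes ord: "0 < c" "c < l"
  shows "\<And>s t. s \<in> {0..<L} \<Longrightarrow> t \<in> {0..<L} \<Longrightarrow> pglued n v gl s t \<longleftrightarrow> folded L b l c s t"
proof -
  define w where "w t = modL L (t - b)" for t
  have w_b: "w b = 0" unfolding w_def by (simp add: modL_id L_pos)
  have w_a: "w a = l" and w_x: "w x = c" unfolding w_def l_def c_def by auto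
  have l: "l < L" unfolding l_def using modL_bounds L_pos by blast
  have w_range: "0 \<le> w t" "w t < L" for t unfolding w_def using modL_bounds L_pos by auto
  have w_inj: "s \<in> {0..<L} \<Longrightarrow> t \<in> {0..<L} \<Longrightarrow> w s = w t \<longleftrightarrow> s = t" for s t
    unfolding w_def by (rule shift_inj)
  have ax: "a \<in> {0..<L}" "x \<in> {0..<L}" using a x cls_subset by blast+
  have abx: "a \<noteq> b" "x \<noteq> b" "a \<noteq> x" using w_a w_x w_b ord by auto
  have clsb: "cls b = {b, x, a}"
  proof -
    have "{b, x, a} \<subseteq> cls b" using a x cls_self[OF b] by auto
    moreover have "card {b, x, a} = 3" using abx by auto
    ultimately show ?thesis using card_subset_eq[OF finite_cls[OF b], of "{b, x, a}"] C by metis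
  qed
  have w_J: "t \<in> cls b \<longleftrightarrow> w t \<in> {0, c, l}" if "t \<in> {0..<L}" for t
    using clsb w_inj[OF that b] w_inj[OF that ax(1)] w_inj[OF that ax(2)] w_a w_b w_x by auto
  have small: "card (cls t) \<le> 2" if t: "t \<in> {0..<L}" "t \<notin> cls b" for t
    using cls_card_le_3[OF t(1)] unique_junction[OF b C t(1)] cls_self[OF t(1)] t(2) by force
  have w_add: "w (modL L (b + y)) = y" if "0 \<le> y" "y < L" for y
  proof -
    have "modL L (modL L (b + y) - b) = modL L (b + y - b)" using L_pos by (intro modL_cong_diff) auto
    then show ?thesis unfolding w_def using modL_id that by simp
  qed
  have t_eq: "modL L (b + w t) = modL L t" for t unfolding w_def by (rule modL_shift)
  have inv: "rho (rho (b + y)) = modL L (b + y)" if y: "0 < y" "y < L" "y \<noteq> c" "y \<noteq> l" for y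
  proof -
    have r: "modL L (b + y) \<in> {0..<L}" using modL_range L_pos by blast
    have "w (modL L (b + y)) = y" using w_add y by simp
    then have "modL L (b + y) \<notin> cls b" using w_J[OF r] y by auto
    then have "rho (rho (modL L (b + y))) = modL L (b + y)" using rho_rho_of_small(1)[OF r small[OF r]] by blast
    moreover have "rho (modL L (b + y)) = rho (b + y)" by (rule rho_cong) (simp add: L_pos)
    ultimately show ?thesis by simp
  qed
  have inv': "rho (rho y) = modL L y" if "b < y" "y < b + L" "y \<noteq> b + c" "y \<noteq> b + l" for y
    using inv[of "y - b"] that by simp
  note cyc = three_cycle[OF b C]
  have rb: "rho b = x" "rho x = a" "rho a = b"
  proof -
    \<comment> \<open>In the other cyclic order the gap from \<open>b\<close> to \<open>x\<close>
      would be reflected with constant \<open>b + a\<close> by its left end and \<open>x + a\<close>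
      by its right end, which makes \<open>c\<close> zero modulo \<open>L\<close>.\<close>
    have "rho b \<noteq> a"
    proof
      assume ra: "rho b = a"
      have "x \<in> {b, rho b, rho (rho b)}" using x cyc(1) by simp
      then have r2: "rho a = x" using ra abx by simp
      have bc: "modL L (b + c) = x" using t_eq[of x] w_x modL_id[of x L] ax by simp
      have "modL L (b + c + a) = modL L (b + rho b)"
      proof (rule reflection_on_interval(2))
        show "b < b + c" using ord by simp
        show "rho a = modL L (b + c)" using r2 bc by simp
        show "rho (rho y) = modL L y" if "b < y" "y < b + c" for y
          using inv'[of y] that ord l by simp
      qed
      then have "modL L c = modL L 0"
        using modL_cong_diff[OF L_pos, of "b + c + a" "b + a" "b + a" "b + a"] ra by simp
      then show False using modL_id[of c L] modL_id[of 0 L] ord l L_pos by simp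
    qed
    moreover have "rho b \<in> {b, x, a}" using clsb cyc(1) by blast
    ultimately show r1: "rho b = x" using cyc(3) by blast
    have "a \<in> {b, rho b, rho (rho b)}" using a cyc(1) by simp
    then show r2: "rho x = a" using r1 abx by simp
    show "rho a = b" using cyc(2) r1 r2 by simp
  qed
  have bx: "modL L (b + c) = modL L x" "modL L (b + l) = modL L a" using t_eq[of x] t_eq[of a] w_x w_a by auto
  have gap: "w (rho t) = k"
    if t: "t \<in> {0..<L}" and yz: "y < w t" "w t < z" "0 \<le> y" "z \<le> L"
      "\<And>u. y < u \<Longrightarrow> u < z \<Longrightarrow> u \<noteq> c \<and> u \<noteq> l" and k: "0 \<le> k" "k < L"
      "modL L (k + w t) = modL L (y + w (rho (b + y)))" for t y z k
  proof -
    have "modL L (b + w t + rho (b + w t)) = modL L (b + y + rho (b + y))"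
    proof (rule reflection_on_interval(1)[of "b + y" "b + z" "b + w t"])
      show "rho (rho u) = modL L u" if "b + y < u" "u < b + z" for u
        using inv'[of u] yz(5)[of "u - b"] yz(3,4) that by auto
    qed (use yz in auto)
    moreover have "rho (b + w t) = rho t" by (rule rho_cong) (rule t_eq)
    ultimately have r: "modL L (b + w t + rho t) = modL L (b + y + rho (b + y))" by simp
    have sh: "modL L (z + (w (rho s) + b)) = modL L (z + rho s)" for z s
      using t_eq[of "rho s"] by (intro modL_cong_add L_pos) (simp_all add: add.commute)
    have "modL L (b + w t + (w (rho t) + b)) = modL L (b + y + (w (rho (b + y)) + b))"
      unfolding sh by (rule r)
    then have "modL L (w t + w (rho t)) = modL L (y + w (rho (b + y)))"
      using modL_cong_diff[OF L_pos, of "b + w t + (w (rho t) + b)" _ "2 * b" "2 * b"] by (simp add: algebra_simps)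
    then have "modL L (w t + w (rho t)) = modL L (k + w t)" using k by simp
    then have "modL L (w (rho t)) = modL L k"
      using modL_cong_diff[OF L_pos, of "w t + w (rho t)" "k + w t" "w t" "w t"] by simp
    then show ?thesis using modL_id[of k L] k modL_id[of "w (rho t)" L] w_range by simp
  qed
  \<comment> \<open>The left ends 0, \<open>c\<close>, \<open>l\<close> of the gaps have images
    \<open>c\<close>, \<open>l\<close>, 0. This gives the constants \<open>c\<close>,
    \<open>c + l\<close> and, one period up, \<open>L + l\<close>.\<close>
  have rho_vals: "rho (b + 0) = x" "rho (b + c) = a" "rho (b + l) = b"
    using rb rho_cong[OF bx(1)] rho_cong[OF bx(2)] by auto
  have g1: "w (rho t) = c - w t" if "t \<in> {0..<L}" "0 < w t" "w t < c" for t
    using gap[of t 0 c "c - w t"] that ord l rho_vals w_x by auto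
  have g2: "w (rho t) = c + l - w t" if "t \<in> {0..<L}" "c < w t" "w t < l" for t
    using gap[of t c l "c + l - w t"] that ord l rho_vals w_a by auto
  have g3: "w (rho t) = L + l - w t" if "t \<in> {0..<L}" "l < w t" for t
  proof -
    have "modL L (L + l - w t + w t) = modL L (l + w (rho (b + l)))"
      using rho_vals w_b modL_add_self[OF L_pos, of l] by (simp add: add.commute)
    then show ?thesis using gap[of t l L "L + l - w t"] that ord l w_range[of t] by auto
  qed
  fix s t assume st: "s \<in> {0..<L}" "t \<in> {0..<L}"
  have F: "folded L b l c s t \<longleftrightarrow> w s = w t \<or> (w s \<in> {0, l} \<and> w t \<in> {0, l} \<or>
        w s \<le> l \<and> w t \<le> l \<and> (w s + w t = c \<or> w s + w t = c + l) \<or>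
        w s \<ge> l \<and> w t \<ge> l \<and> w s + w t = L + l)"
    unfolding folded_def Let_def w_def[symmetric] w_inj[OF st] ..
  show "pglued n v gl s t \<longleftrightarrow> folded L b l c s t"
  proof (cases "s \<in> cls b")
    case True
    then have "pglued n v gl s t \<longleftrightarrow> w t \<in> {0, c, l}"
      using cls_eq[OF True] cls_iff[of t s] w_J[OF st(2)] st by auto
    moreover have "w s \<in> {0, c, l}" using w_J[OF st(1)] True by simp
    ultimately show ?thesis unfolding F using ord l w_range[of t] by auto
  next
    case False
    then have ws: "w s \<noteq> 0" "w s \<noteq> c" "w s \<noteq> l" using w_J[OF st(1)] by auto
    have "pglued n v gl s t \<longleftrightarrow> t = s \<or> t = rho s"
      using rho_rho_of_small(2)[OF st(1) small[OF st(1) False]] cls_iff[of t s] st by auto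
    also have "\<dots> \<longleftrightarrow> w t = w s \<or> w t = w (rho s)"
      using w_inj[OF st(2) st(1)] w_inj[OF st(2) rho_range[of s]] by simp
    finally have P: "pglued n v gl s t \<longleftrightarrow> w t = w s \<or> w t = w (rho s)" .
    consider "0 < w s" "w s < c" | "c < w s" "w s < l" | "l < w s"
      using ws w_range[of s] by linarith
    then show ?thesis
    proof cases
      case 1 then show ?thesis unfolding P F g1[OF st(1) 1] using ord l ws w_range[of t] by auto
    next
      case 2 then show ?thesis unfolding P F g2[OF st(1) 2] using ord l ws w_range[of t] by auto
    next
      case 3 then show ?thesis unfolding P F g3[OF st(1) 3] using ord l ws w_range[of t] w_range[of s] by auto
    qed
  qed
qed

end

section \<open>Moving the folding parameter\<close>

text \<open>The relation folded in the coordinate x = t - b.\<close>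

definition frel :: "real \<Rightarrow> real \<Rightarrow> real \<Rightarrow> real \<Rightarrow> real \<Rightarrow> bool" where
  "frel L l y u w \<longleftrightarrow> u = w \<or> u \<in> {0, l} \<and> w \<in> {0, l} \<or>
     u \<le> l \<and> w \<le> l \<and> (u + w = y \<or> u + w = y + l) \<or>
     u \<ge> l \<and> w \<ge> l \<and> u + w = L + l"

definition fcls :: "real \<Rightarrow> real \<Rightarrow> real \<Rightarrow> real \<Rightarrow> real set" where
  "fcls L l y u = {w \<in> {0..<L}. frel L l y u w}"

definition fspecial :: "real \<Rightarrow> real \<Rightarrow> real set \<Rightarrow> real \<Rightarrow> real set" where
  "fspecial L l W y = {u \<in> {0..<L}. card (fcls L l y u) \<noteq> 2 \<or> fcls L l y u \<inter> W \<noteq> {}}"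

text \<open>The parameters at which one of the two folds identifies points of \<open>W\<close>; the
  families belong to the sums \<open>y\<close> and \<open>y + l\<close>. For \<open>x = z\<close> a
  fold point itself meets \<open>W\<close>.\<close>

definition breaks :: "real \<Rightarrow> real set \<Rightarrow> real set" where
  "breaks l W = (\<lambda>(x, z). x + z) ` (W \<times> W) \<union> (\<lambda>(x, z). x + z - l) ` (W \<times> W)"

lemma breaks_iff: "x \<in> breaks l W \<longleftrightarrow> (\<exists>a\<in>W. \<exists>b\<in>W. x = a + b \<or> x = a + b - l)"
  unfolding breaks_def by auto

lemma finite_breaks: "finite W \<Longrightarrow> finite (breaks l W)"
  unfolding breaks_def by simp

lemma card_breaks: "finite W \<Longrightarrow> card (breaks l W) \<le> 2 * card W ^ 2"
proof -
  assume W: "finite W"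
  have "card (breaks l W) \<le> card ((\<lambda>(x, z). x + z) ` (W \<times> W)) + card ((\<lambda>(x, z). x + z - l) ` (W \<times> W))"
    unfolding breaks_def by (rule card_Un_le)
  also have "\<dots> \<le> card (W \<times> W) + card (W \<times> W)"
    using W by (intro add_mono card_image_le) auto
  also have "\<dots> = 2 * card W ^ 2" by (simp add: card_cartesian_product power2_eq_square)
  finally show ?thesis .
qed

text \<open>A symbol (k, x) stands for the point k * y + x, which moves with the folding parameter y:
  k = 0 for fixed points, k = 1 for mirror images of vertices, k = 1/2 for fold points.\<close>

definition pos :: "real \<Rightarrow> real \<times> real \<Rightarrow> real" where
  "pos y s = fst s * y + snd s"

locale fold_cell =
  fixes L l :: real and W :: "real set" and c :: real
  assumes l: "0 < l" "l \<le> L" and W: "0 \<in> W" "l \<in> W" "\<And>x. x \<in> W \<Longrightarrow> 0 \<le> x \<and> x \<le> L"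
    and c: "0 < c" "c < l"
begin

text \<open>The special points that do not move: those of \<open>W\<close>, and on the zipped part
  the fold point and the mirror images of \<open>W\<close>. The intersection removes
  \<open>L\<close>, which belongs to \<open>W\<close> when \<open>l = L\<close>.\<close>

definition Z :: "real set" where
  "Z = (W \<inter> {0..<L}) \<union> {z. l < z \<and> z < L \<and> (L + l - z = z \<or> L + l - z \<in> W)}"

text \<open>A point \<open>x\<close> below the parameter is mirrored to \<open>y - x\<close>, one
  above it to \<open>y + l - x\<close>; the side is taken at \<open>c\<close>. With
  \<open>x = 0\<close> this includes the point \<open>y\<close> itself, which is glued to 0 and
  \<open>l\<close>.\<close>

definition syms :: "(real \<times> real) set" where
  "syms = {0} \<times> Z \<union> {1} \<times> {- x | x. x \<in> W \<and> x < c} \<union> {1} \<times> {l - x | x. x \<in> W \<and> c < x \<and> x < l}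
     \<union> {(1/2, 0), (1/2, l/2)}"

text \<open>Besides avoiding breakpoints, \<open>y\<close> has to separate \<open>W\<close> as
  \<open>c\<close> does, because \<open>syms\<close> is built with the side of
  \<open>c\<close>.\<close>

definition good :: "real \<Rightarrow> bool" where
  "good y \<longleftrightarrow> 0 < y \<and> y < l \<and> y \<notin> breaks l W \<and> (\<forall>x\<in>W. x < y \<longleftrightarrow> x < c) \<and> (\<forall>x\<in>W. y < x \<longleftrightarrow> c < x)"

lemma syms_cases:
  assumes "s \<in> syms"
  obtains z where "s = (0, z)" "z \<in> Z"
  | x where "s = (1, - x)" "x \<in> W" "x < c"
  | x where "s = (1, l - x)" "x \<in> W" "c < x" "x < l"
  | "s = (1/2, 0)" | "s = (1/2, l/2)"
  using assms unfolding syms_def by blast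

lemma syms_fst0: "s \<in> syms \<Longrightarrow> fst s = 0 \<Longrightarrow> \<exists>z. s = (0, z) \<and> z \<in> Z"
  by (erule syms_cases) auto

lemma syms_fst_nonneg: "s \<in> syms \<Longrightarrow> 0 \<le> fst s"
  by (erule syms_cases) auto

lemma Z_le: "z \<in> Z \<Longrightarrow> z \<le> l \<Longrightarrow> z \<in> W"
  unfolding Z_def by auto

lemma Z_range: "z \<in> Z \<Longrightarrow> 0 \<le> z \<and> z < L"
  unfolding Z_def using l by auto

lemma good_not_break:
  assumes "good y" "a \<in> W" "b \<in> W"
  shows "y \<noteq> a + b" "y \<noteq> a + b - l"
  using assms unfolding good_def breaks_iff by auto

lemma good_sides: "good y \<Longrightarrow> x \<in> W \<Longrightarrow> x < c \<Longrightarrow> x < y" "good y \<Longrightarrow> x \<in> W \<Longrightarrow> c < x \<Longrightarrow> y < x"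
  unfolding good_def by auto

text \<open>The relation \<open>frel\<close> between two symbols without reference to the parameter.
  Distinct moving points are never related; this independence of \<open>y\<close> is what keeps the
  tree constant.\<close>

definition prel :: "real \<times> real \<Rightarrow> real \<times> real \<Rightarrow> bool" where
  "prel s t \<longleftrightarrow> s = t \<or>
     fst s = 0 \<and> fst t = 0 \<and> (snd s \<in> {0, l} \<and> snd t \<in> {0, l} \<or> snd s \<ge> l \<and> snd t \<ge> l \<and> snd s + snd t = L + l) \<or>
     fst s = 0 \<and> fst t = 1 \<and> snd s \<le> l \<and> snd s + snd t \<in> {0, l} \<or>
     fst s = 1 \<and> fst t = 0 \<and> snd t \<le> l \<and> snd s + snd t \<in> {0, l}"

lemma pos_moving:
  assumes "good y" "s \<in> syms" "fst s \<noteq> 0"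
  shows "0 < pos y s" "pos y s < l"
proof -
  have y: "0 < y" "y < l" using assms unfolding good_def by auto
  have "0 < pos y s \<and> pos y s < l"
    using assms(2)
  proof (cases rule: syms_cases)
    case (1 z) then show ?thesis using assms by simp
  next
    case (2 x) then show ?thesis using y good_sides[OF assms(1)] W(3) unfolding pos_def by force
  next
    case (3 x) then show ?thesis using y good_sides[OF assms(1)] unfolding pos_def by force
  qed (use y in \<open>auto simp: pos_def\<close>)
  then show "0 < pos y s" "pos y s < l" by auto
qed

text \<open>A coincidence of two different symbols either contradicts the ranges of the points or
  rearranges to \<open>y = a + b\<close> or \<open>y = a + b - l\<close> with \<open>a\<close> and
  \<open>b\<close> in \<open>W\<close>, a breakpoint. Fold points give \<open>a = b\<close>.\<close>

lemma pos_inj: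
  assumes g: "good y" and s: "s \<in> syms" and t: "t \<in> syms" and eq: "pos y s = pos y t"
  shows "s = t"
proof -
  have y: "0 < y" "y < l" using g unfolding good_def by auto
  have half: "False" if h: "u \<in> W" "u \<le> l" "y / 2 = u \<or> (y + l) / 2 = u" for u
    using good_not_break[OF g h(1) h(1)] h(3) by auto
  have Wpos: "x \<ge> 0" if "x \<in> W" for x using W(3) that by blast
  have key: False if s: "s \<in> syms" and t: "t \<in> syms" and eq: "pos y s = pos y t"
    and lt: "fst s < fst t" for s t
    using s
  proof (cases rule: syms_cases)
    case (1 z)
    have zl: "z < l" using pos_moving[OF g t] eq lt 1 unfolding pos_def by simp
    then have zW: "z \<in> W" using Z_le 1 by simp
    show ?thesis using t
    proof (cases rule: syms_cases)
      case (2 x) then show ?thesis using 1 eq good_not_break[OF g zW 2(2)] unfolding pos_def by auto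
    next
      case (3 x) then show ?thesis using 1 eq good_not_break[OF g zW 3(2)] unfolding pos_def by auto
    next
      case 4 then show ?thesis using 1 eq half[OF zW] zl unfolding pos_def by auto
    next
      case 5 then show ?thesis using 1 eq half[OF zW] zl unfolding pos_def by auto
    qed (use lt 1 in auto)
  next
    case 4
    show ?thesis using t
    proof (cases rule: syms_cases)
      case (2 x) then show ?thesis using 4 eq good_not_break[OF g 2(2) 2(2)] unfolding pos_def by auto
    next
      case (3 x) then show ?thesis using 4 eq y unfolding pos_def by auto
    qed (use lt 4 in auto)
  next
    case 5
    show ?thesis using t
    proof (cases rule: syms_cases)
      case (2 x) then show ?thesis using 5 eq y Wpos[OF 2(2)] unfolding pos_def by auto
    next
      case (3 x) then show ?thesis using 5 eq good_not_break[OF g 3(2) 3(2)] unfolding pos_def by auto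
    qed (use lt 5 in auto)
  next
    case (2 x)
    show ?thesis using t lt 2 by (cases rule: syms_cases) auto
  next
    case (3 x)
    show ?thesis using t lt 3 by (cases rule: syms_cases) auto
  qed
  have "fst s = fst t"
    using key[OF s t eq] key[OF t s eq[symmetric]] by (cases "fst s" "fst t" rule: linorder_cases) auto
  then show ?thesis using eq unfolding pos_def by (simp add: prod_eq_iff)
qed

lemma frel_sym: "frel L l y u w \<longleftrightarrow> frel L l y w u"
  unfolding frel_def by (auto simp: add.commute)

lemma prel_sym: "prel s t \<longleftrightarrow> prel t s"
  unfolding prel_def by (auto simp: add.commute)

text \<open>As in \<open>pos_inj\<close>, every relation that holds for special values of
  \<open>y\<close> only is a breakpoint equation or violates the ranges. What remains is listed in
  \<open>prel\<close>.\<close>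

lemma frel_pos:
  assumes g: "good y" and s: "s \<in> syms" and t: "t \<in> syms"
  shows "frel L l y (pos y s) (pos y t) \<longleftrightarrow> prel s t"
proof -
  have y: "0 < y" "y < l" using g unfolding good_def by auto
  have Wpos: "x \<ge> 0" if "x \<in> W" for x using W(3) that by blast
  have main: "frel L l y (pos y s) (pos y t) \<longleftrightarrow> prel s t"
    if s: "s \<in> syms" and t: "t \<in> syms" and le: "fst s \<le> fst t" for s t
  proof (cases "s = t")
    case True then show ?thesis unfolding frel_def prel_def by simp
  next
    case False
    then have ne: "pos y s \<noteq> pos y t" using pos_inj[OF g s t] by blast
    show ?thesis
    proof (cases "fst s = 0")
      case s0: True
      then obtain z where z: "s = (0, z)" "z \<in> Z" using s syms_fst0 by blast
      show ?thesis
      proof (cases "fst t = 0")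
        case True
        then obtain z' where z': "t = (0, z')" "z' \<in> Z" using t syms_fst0 by blast
        have "\<not> (z \<le> l \<and> z' \<le> l \<and> (z + z' = y \<or> z + z' = y + l))"
          using Z_le z z' good_not_break[OF g, of z z'] by auto
        then show ?thesis using ne False unfolding frel_def prel_def z z' pos_def by auto
      next
        case t0: False
        have tp: "0 < pos y t" "pos y t < l" using pos_moving[OF g t t0] by auto
        have F: "frel L l y (pos y s) (pos y t) \<longleftrightarrow> z \<le> l \<and> (z + pos y t = y \<or> z + pos y t = y + l)"
          using ne tp unfolding frel_def z pos_def by auto
        show ?thesis
        proof (cases "fst t = 1")
          case True
          then show ?thesis unfolding F using z False unfolding prel_def pos_def by (cases t) auto
        next
          case t1: False
          have "t = (1/2, 0) \<or> t = (1/2, l/2)" by (rule syms_cases[OF t]) (use t0 t1 in auto)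
          then have "\<not> (z \<le> l \<and> (z + pos y t = y \<or> z + pos y t = y + l))"
            using Z_le[OF z(2)] good_not_break[OF g, of z z] y Z_range[OF z(2)] unfolding pos_def by auto
          then show ?thesis unfolding F using z t0 t1 False unfolding prel_def by auto
        qed
      qed
    next
      case s0: False
      then have t0: "fst t \<noteq> 0" using le syms_fst_nonneg[OF s] by linarith
      have sp: "0 < pos y s" "pos y s < l" using pos_moving[OF g s s0] by auto
      have tp: "0 < pos y t" "pos y t < l" using pos_moving[OF g t t0] by auto
      have F: "frel L l y (pos y s) (pos y t) \<longleftrightarrow> pos y s + pos y t = y \<or> pos y s + pos y t = y + l"
        using ne sp tp unfolding frel_def by auto
      have "\<not> (pos y s + pos y t = y \<or> pos y s + pos y t = y + l)"
        using s
      proof (cases rule: syms_cases)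
        case (1 z) then show ?thesis using s0 by simp
      next
        case (2 x)
        show ?thesis using t
        proof (cases rule: syms_cases)
          case (1 z') then show ?thesis using t0 by simp
        next
          case (2 x') then show ?thesis
            using \<open>s = _\<close> \<open>x \<in> W\<close> good_not_break[OF g \<open>x \<in> W\<close> \<open>x' \<in> W\<close>] y Wpos[of x] Wpos[of x'] unfolding pos_def by auto
        next
          case (3 x') then show ?thesis
            using \<open>s = _\<close> \<open>x \<in> W\<close> good_not_break[OF g \<open>x \<in> W\<close> \<open>x' \<in> W\<close>] y Wpos[of x] Wpos[of x'] unfolding pos_def by auto
        qed (use le 2 in auto)
      next
        case (3 x)
        show ?thesis using t
        proof (cases rule: syms_cases)
          case (1 z') then show ?thesis using t0 by simp
        next
          case (2 x') then show ?thesis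
            using \<open>s = _\<close> \<open>x \<in> W\<close> good_not_break[OF g \<open>x \<in> W\<close> \<open>x' \<in> W\<close>] y Wpos[of x] Wpos[of x'] unfolding pos_def by auto
        next
          case (3 x') then show ?thesis
            using \<open>s = _\<close> \<open>x \<in> W\<close> \<open>x < l\<close> good_not_break[OF g \<open>x \<in> W\<close> \<open>x' \<in> W\<close>] y Wpos[of x] Wpos[of x'] unfolding pos_def by auto
        qed (use le 3 in auto)
      next
        case 4
        show ?thesis using t
        proof (cases rule: syms_cases)
          case (1 z') then show ?thesis using t0 by simp
        next
          case (2 x') then show ?thesis
            using \<open>s = _\<close> good_not_break[OF g \<open>x' \<in> W\<close> \<open>x' \<in> W\<close>] y Wpos[of x'] unfolding pos_def by auto
        next
          case (3 x') then show ?thesis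
            using \<open>s = _\<close> good_not_break[OF g \<open>x' \<in> W\<close> \<open>x' \<in> W\<close>] y Wpos[of x'] unfolding pos_def by auto
        qed (use \<open>s = _\<close> False l in \<open>auto simp: pos_def\<close>)
      next
        case 5
        show ?thesis using t
        proof (cases rule: syms_cases)
          case (1 z') then show ?thesis using t0 by simp
        next
          case (2 x') then show ?thesis
            using \<open>s = _\<close> good_not_break[OF g \<open>x' \<in> W\<close> \<open>x' \<in> W\<close>] y Wpos[of x'] unfolding pos_def by auto
        next
          case (3 x') then show ?thesis
            using \<open>s = _\<close> good_not_break[OF g \<open>x' \<in> W\<close> \<open>x' \<in> W\<close>] y Wpos[of x'] unfolding pos_def by auto
        qed (use \<open>s = _\<close> False l in \<open>auto simp: pos_def\<close>)
      qed
      then show ?thesis unfolding F prel_def using False s0 t0 by auto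
    qed
  qed
  show ?thesis
  proof (cases "fst s \<le> fst t")
    case True then show ?thesis using main[OF s t] by blast
  next
    case False then show ?thesis using main[OF t s] frel_sym prel_sym by (metis nle_le)
  qed
qed

lemma fcls_upper:
  assumes "0 < y" "y < l" "l < u" "u < L"
  shows "fcls L l y u = {u, L + l - u}"
  unfolding fcls_def frel_def using assms by auto

lemma fcls_low:
  assumes "0 < u" "u < y" "y < l"
  shows "fcls L l y u = {u, y - u}"
  unfolding fcls_def frel_def using assms l by auto

lemma fcls_mid:
  assumes "0 < y" "y < u" "u < l"
  shows "fcls L l y u = {u, y + l - u}"
  unfolding fcls_def frel_def using assms l by auto

text \<open>The stock of symbols is the same for all good parameters, so the special points can be
  matched by name.\<close>

lemma fspecial_eq:
  assumes g: "good y"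
  shows "fspecial L l W y = pos y ` syms"
proof
  have y: "0 < y" "y < l" using g unfolding good_def by auto
  show "fspecial L l W y \<subseteq> pos y ` syms"
  proof
    fix u assume "u \<in> fspecial L l W y"
    then have u: "0 \<le> u" "u < L" and sp: "card (fcls L l y u) \<noteq> 2 \<or> fcls L l y u \<inter> W \<noteq> {}"
      unfolding fspecial_def by auto
    have fixd: "u \<in> pos y ` syms" if "u \<in> Z"
      using that unfolding syms_def by (intro image_eqI[of _ _ "(0, u)"]) (auto simp: pos_def)
    have pick: "u \<in> pos y ` syms" if "s \<in> syms" "u = pos y s" for s using that by blast
    consider "u \<in> W" | "l < u" "u \<notin> W" | "u = y" "u \<notin> W" | "0 < u" "u < y" "u \<notin> W" | "y < u" "u < l" "u \<notin> W"
      using u W(1,2) by (metis linorder_neqE_linordered_idom order_le_less)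
    then show "u \<in> pos y ` syms"
    proof cases
      case 1 then show ?thesis using fixd u unfolding Z_def by auto
    next
      case 2
      then have "L + l - u = u \<or> L + l - u \<in> W"
        using sp fcls_upper[OF y 2(1) u(2)] by (auto simp: card_insert_if split: if_splits)
      then show ?thesis using fixd 2 u unfolding Z_def by auto
    next
      case 3
      \<comment> \<open>The third junction point \<open>y\<close> is named as the mirror image of
        0.\<close>
      have "(1, - 0) \<in> syms" using W(1) c unfolding syms_def by blast
      then show ?thesis using 3 by (intro pick[of "(1, - 0)"]) (auto simp: pos_def)
    next
      case 4
      then have "y - u = u \<or> y - u \<in> W"
        using sp fcls_low[OF 4(1,2) y(2)] by (auto simp: card_insert_if split: if_splits)
      then show ?thesis
      proof
        assume "y - u = u"
        then show ?thesis by (intro pick[of "(1/2, 0)"]) (auto simp: pos_def syms_def)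
      next
        assume h: "y - u \<in> W"
        then have "y - u < c" using g 4 unfolding good_def by auto
        then have "(1, - (y - u)) \<in> syms" using h unfolding syms_def by blast
        then show ?thesis by (intro pick[of "(1, - (y - u))"]) (auto simp: pos_def)
      qed
    next
      case 5
      then have "y + l - u = u \<or> y + l - u \<in> W"
        using sp fcls_mid[OF y(1) 5(1,2)] by (auto simp: card_insert_if split: if_splits)
      then show ?thesis
      proof
        assume "y + l - u = u"
        then show ?thesis by (intro pick[of "(1/2, l/2)"]) (auto simp: pos_def syms_def)
      next
        assume h: "y + l - u \<in> W"
        then have "c < y + l - u" "y + l - u < l" using g 5 unfolding good_def by auto
        then have "(1, l - (y + l - u)) \<in> syms" using h unfolding syms_def by blast
        then show ?thesis by (intro pick[of "(1, l - (y + l - u))"]) (auto simp: pos_def)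
      qed
    qed
  qed
  show "pos y ` syms \<subseteq> fspecial L l W y"
  proof
    fix u assume "u \<in> pos y ` syms"
    then obtain s where s: "s \<in> syms" "u = pos y s" by blast
    have spI: "u \<in> fspecial L l W y" if "0 \<le> u" "u < L" "w \<in> W" "frel L l y u w" "0 \<le> w" "w < L" for w
      using that unfolding fspecial_def fcls_def by auto
    have sp1: "u \<in> fspecial L l W y" if "0 \<le> u" "u < L" "fcls L l y u = {u}"
      using that unfolding fspecial_def by auto
    have mv: "0 < u" "u < l" if "fst s \<noteq> 0" using pos_moving[OF g s(1) that] s by auto
    show "u \<in> fspecial L l W y"
      using s(1)
    proof (cases rule: syms_cases)
      case (1 z)
      then have z: "u = z" "0 \<le> z" "z < L" using s Z_range unfolding pos_def by auto
      show ?thesis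
      proof (cases "z \<in> W")
        case True then show ?thesis using spI[of z] z unfolding frel_def by auto
      next
        case False
        then have zz: "l < z" "L + l - z = z \<or> L + l - z \<in> W" using 1 z unfolding Z_def by auto
        from zz(2) show ?thesis
        proof
          assume "L + l - z = z"
          then show ?thesis using sp1 fcls_upper[OF y zz(1)] z by auto
        next
          assume h: "L + l - z \<in> W"
          have "frel L l y u (L + l - z)" unfolding frel_def using z zz(1) by auto
          then show ?thesis using spI[OF _ _ h] z zz(1) l by auto
        qed
      qed
    next
      case (2 x)
      then have "frel L l y u x" using s mv good_sides(1)[OF g 2(2,3)] y unfolding frel_def pos_def by auto
      then show ?thesis using spI[OF _ _ 2(2)] mv l W(3)[OF 2(2)] c 2 by auto
    next
      case (3 x)
      then have "frel L l y u x" using s mv unfolding frel_def pos_def by auto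
      then show ?thesis using spI[OF _ _ 3(2)] mv l W(3)[OF 3(2)] 3 by auto
    next
      case 4
      then have "u = y / 2" using s unfolding pos_def by simp
      then show ?thesis using sp1 fcls_low[of u y] y l by auto
    next
      case 5
      then have "u = (y + l) / 2" using s unfolding pos_def by (simp add: add_divide_distrib)
      then show ?thesis using sp1 fcls_mid[of y u] y l by (auto simp: field_simps)
    qed
  qed
qed

text \<open>Positions are affine in the parameter, so two points that change order meet at a
  parameter in between, against \<open>pos_inj\<close>.\<close>

lemma pos_order:
  assumes g: "\<And>y. y \<in> closed_segment c c' \<Longrightarrow> good y" and s: "s \<in> syms" and t: "t \<in> syms"
    and lt: "pos c s < pos c t"
  shows "pos c' s < pos c' t"
proof (rule ccontr)
  assume n: "\<not> pos c' s < pos c' t"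
  define D where "D y = pos y t - pos y s" for y
  \<comment> \<open>Weight of the zero of the affine function \<open>D\<close> on the
    segment.\<close>
  define r where "r = D c / (D c - D c')"
  have d: "D c > 0" "D c' \<le> 0" using lt n unfolding D_def by auto
  then have r: "0 \<le> r" "r \<le> 1" unfolding r_def by (auto simp: divide_simps)
  define y where "y = (1 - r) * c + r * c'"
  have "D y = (1 - r) * D c + r * D c'" unfolding D_def pos_def y_def by (simp add: algebra_simps)
  also have "\<dots> = D c - r * (D c - D c')" by (simp add: algebra_simps)
  also have "\<dots> = 0" using d unfolding r_def by simp
  finally have "pos y s = pos y t" unfolding D_def by simp
  moreover have "y \<in> closed_segment c c'" unfolding in_segment y_def using r by auto
  ultimately have "s = t" using pos_inj[OF g s t] by blast
  then show False using lt by simp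
qed

text \<open>\<open>h\<close> carries the position of each symbol at \<open>c\<close> to its position
  at \<open>c'\<close>.\<close>

lemma cell_map:
  assumes g: "\<And>y. y \<in> closed_segment c c' \<Longrightarrow> good y"
  obtains h where "bij_betw h (fspecial L l W c) (fspecial L l W c')"
    "\<And>u w. u \<in> fspecial L l W c \<Longrightarrow> w \<in> fspecial L l W c \<Longrightarrow> u < w \<longleftrightarrow> h u < h w"
    "\<And>u w. u \<in> fspecial L l W c \<Longrightarrow> w \<in> fspecial L l W c \<Longrightarrow> frel L l c u w \<longleftrightarrow> frel L l c' (h u) (h w)"
    "\<And>u. u \<in> W \<Longrightarrow> u < L \<Longrightarrow> h u = u"
proof -
  have gc: "good c" "good c'" using g by auto
  have inj: "inj_on (pos c) syms" "inj_on (pos c') syms" using pos_inj gc by (auto intro!: inj_onI)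
  define k where "k = the_inv_into syms (pos c)"
  define h where "h = (\<lambda>u. pos c' (k u))"
  have k: "k (pos c s) = s" if "s \<in> syms" for s unfolding k_def using inj that by (simp add: the_inv_into_f_f)
  have kin: "k u \<in> syms \<and> pos c (k u) = u" if "u \<in> fspecial L l W c" for u
    using that k unfolding fspecial_eq[OF gc(1)] by auto
  have bij: "bij_betw h (fspecial L l W c) (fspecial L l W c')"
  proof -
    have "bij_betw (pos c) syms (fspecial L l W c)" "bij_betw (pos c') syms (fspecial L l W c')"
      unfolding bij_betw_def using inj fspecial_eq gc by auto
    then show ?thesis unfolding h_def k_def
      using bij_betw_trans[OF bij_betw_the_inv_into, of "pos c" syms _ "pos c'"] unfolding comp_def by blast
  qed
  have mono: "h u < h w" if "u \<in> fspecial L l W c" "w \<in> fspecial L l W c" "u < w" for u w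
    unfolding h_def using kin[OF that(1)] kin[OF that(2)] that(3) pos_order[OF g] by metis
  show ?thesis
  proof (rule that[of h, OF bij])
    fix u w assume u: "u \<in> fspecial L l W c" and w: "w \<in> fspecial L l W c"
    show "u < w \<longleftrightarrow> h u < h w"
      using mono[OF u w] mono[OF w u] by (metis linorder_neqE_linordered_idom order_less_asym less_irrefl)
    show "frel L l c u w \<longleftrightarrow> frel L l c' (h u) (h w)"
      using frel_pos[OF gc(1), of "k u" "k w"] frel_pos[OF gc(2), of "k u" "k w"] kin[OF u] kin[OF w]
      unfolding h_def by auto
  next
    fix u assume u: "u \<in> W" "u < L"
    then have "(0, u) \<in> syms" using W(3) unfolding syms_def Z_def by auto
    then have "k u = (0, u)" using k[of "(0, u)"] unfolding pos_def by simp
    then show "h u = u" unfolding h_def pos_def by simp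
  qed
qed

end

lemma cyc_between_iff:
  assumes "0 < L" "s \<in> {0..<L}" "t \<in> {0..<L}" "u \<in> {0..<L}" "s \<noteq> t"
  shows "cyc_between L s t u \<longleftrightarrow> s < u \<and> u < t \<or> t < s \<and> s < u \<or> u < t \<and> t < s"
proof -
  have m: "modL L (y - s) = (if s \<le> y then y - s else y - s + L)" if "y \<in> {0..<L}" for y
  proof (cases "s \<le> y")
    case True then show ?thesis using that assms(2) modL_id[of "y - s" L] by simp
  next
    case False
    then show ?thesis using that assms(2) by (auto intro!: modL_unique[of _ _ "-1"])
  qed
  show ?thesis unfolding cyc_between_def m[OF assms(3)] m[OF assms(4)] using assms by auto
qed

lemma cyc_between_shift:
  assumes "0 < L"
  shows "cyc_between L (modL L (s - b)) (modL L (t - b)) (modL L (u - b)) = cyc_between L s t u"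
proof -
  have "modL L (modL L (y - b) - modL L (s - b)) = modL L (y - s)" for y
    using modL_cong_diff[OF assms, of "modL L (y - b)" "y - b" "modL L (s - b)" "s - b"] assms by simp
  then show ?thesis unfolding cyc_between_def by simp
qed

section \<open>Isomorphism of gluing trees from combinatorial data\<close>

context opoly
begin

lemma vertex_param_iff: "s \<in> {0..<L} \<Longrightarrow> is_vertex_param n v s \<longleftrightarrow> s \<in> vp ` {..<n}"
  unfolding is_vertex_param_def using bpt_eq_vertex[of s] by auto

text \<open>As cyclic intervals between vertices, the edges are respected by every map that
  preserves the cyclic order and fixes the vertices. The last edge wraps around to parameter
  0.\<close>

lemma open_edge_cyc:
  assumes j: "j < n" and s: "s \<in> {0..<L}"
  shows "bpt n v s \<in> open_segment (v j) (v (nxt n j)) \<longleftrightarrow> cyc_between L (vp j) (vp (nxt n j)) s"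
proof -
  have ne: "vp j \<noteq> vp (nxt n j)"
    using plen_eq_iff[of j "nxt n j"] nxt_neq[OF n3 j] nxt_less[OF n_pos, of j] j by auto
  show ?thesis
    unfolding bpt_in_open_edge[OF s j]
      cyc_between_iff[OF L_pos plen_range[OF j] plen_range[OF nxt_less[OF n_pos]] s ne]
    using nxt_cases[OF j]
  proof (elim disjE conjE)
    assume h: "nxt n j = Suc j" "Suc j < n"
    then show "vp j < s \<and> s < vp (Suc j) \<longleftrightarrow>
        vp j < s \<and> s < vp (nxt n j) \<or> vp (nxt n j) < vp j \<and> vp j < s \<or> s < vp (nxt n j) \<and> vp (nxt n j) < vp j"
      using plen_less[of j "Suc j"] by auto
  next
    assume h: "nxt n j = 0" "Suc j = n"
    have "vp j > 0" using h plen_less[of 0 j] n3 by auto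
    then show "vp j < s \<and> s < vp (Suc j) \<longleftrightarrow>
        vp j < s \<and> s < vp (nxt n j) \<or> vp (nxt n j) < vp j \<and> vp j < s \<or> s < vp (nxt n j) \<and> vp (nxt n j) < vp j"
      using s h plen_n by auto
  qed
qed

text \<open>Nodes are classes, edges are pairs of cyclically consecutive special points, and labels
  are positions relative to the vertices; each kind of data is carried over by one of the hypotheses
  on \<open>H\<close>.\<close>

lemma tree_transfer:
  assumes g: "is_gluing n v g1" "is_gluing n v g2"
  defines "S1 \<equiv> {s. special_param n v g1 s}" and "S2 \<equiv> {s. special_param n v g2 s}"
  assumes H: "bij_betw H S1 S2"
    and rel: "\<And>s t. s \<in> S1 \<Longrightarrow> t \<in> S1 \<Longrightarrow> pglued n v g1 s t \<longleftrightarrow> pglued n v g2 (H s) (H t)"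
    and cyc: "\<And>s t u. s \<in> S1 \<Longrightarrow> t \<in> S1 \<Longrightarrow> u \<in> S1 \<Longrightarrow> cyc_between L (H s) (H t) (H u) = cyc_between L s t u"
    and fixv: "\<And>i. i < n \<Longrightarrow> H (vp i) = vp i"
  shows "ltree_iso (gluing_tree n v g1) (gluing_tree n v g2)"
proof -
  interpret A: glued_poly n v e g1 by unfold_locales (rule g)
  interpret B: glued_poly n v e g2 by unfold_locales (rule g)
  have clsA: "pclass n v g1 t = pclass n v g1 s" if "t \<in> pclass n v g1 s" for s t
    using that A.pglued_sym A.pglued_trans unfolding pclass_def by blast
  have clsB: "pclass n v g2 t = pclass n v g2 s" if "t \<in> pclass n v g2 s" for s t
    using that B.pglued_sym B.pglued_trans unfolding pclass_def by blast
  have specA: "t \<in> S1" if "s \<in> S1" "t \<in> pclass n v g1 s" for s t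
    using that clsA[OF that(2)] unfolding S1_def special_param_def by (auto simp: pclass_def)
  have specB: "t \<in> S2" if "s \<in> S2" "t \<in> pclass n v g2 s" for s t
    using that clsB[OF that(2)] unfolding S2_def special_param_def by (auto simp: pclass_def)
  have rng: "s \<in> S1 \<Longrightarrow> s \<in> {0..<L}" "s \<in> S2 \<Longrightarrow> s \<in> {0..<L}" for s
    unfolding S1_def S2_def special_param_def by auto
  have vS: "vp i \<in> S1" "vp i \<in> S2" if "i < n" for i
    using that plen_range[OF that] vertex_param_iff[OF plen_range[OF that]] A.pglued_refl B.pglued_refl
    unfolding S1_def S2_def special_param_def pclass_def by auto
  have Him: "H ` S1 = S2" and Hinj: "inj_on H S1" using H unfolding bij_betw_def by auto
  have clsH: "pclass n v g2 (H s) = H ` pclass n v g1 s" if s: "s \<in> S1" for s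
  proof
    show "pclass n v g2 (H s) \<subseteq> H ` pclass n v g1 s"
    proof
      fix t' assume t': "t' \<in> pclass n v g2 (H s)"
      then have "t' \<in> S2" using specB[of "H s"] Him s by blast
      then obtain t where t: "t \<in> S1" "t' = H t" using Him by blast
      then have "pglued n v g1 s t" using rel[OF s t(1)] t' unfolding pclass_def by simp
      then show "t' \<in> H ` pclass n v g1 s" using t rng(1)[OF t(1)] unfolding pclass_def by blast
    qed
    show "H ` pclass n v g1 s \<subseteq> pclass n v g2 (H s)"
    proof
      fix t' assume "t' \<in> H ` pclass n v g1 s"
      then obtain t where t: "t \<in> pclass n v g1 s" "t' = H t" by blast
      have "t \<in> S1" using specA s t by blast
      then show "t' \<in> pclass n v g2 (H s)"
        using rel[OF s \<open>t \<in> S1\<close>] t Him rng(2)[of "H t"] unfolding pclass_def by auto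
    qed
  qed
  define f where "f C = H ` C" for C
  define N1 where "N1 = {pclass n v g1 s | s. special_param n v g1 s}"
  define N2 where "N2 = {pclass n v g2 s | s. special_param n v g2 s}"
  have N1: "N1 = pclass n v g1 ` S1" and N2: "N2 = pclass n v g2 ` S2"
    unfolding N1_def N2_def S1_def S2_def by auto
  have subS: "C \<subseteq> S1" if "C \<in> N1" for C using that specA unfolding N1 by blast
  have finj: "inj_on f N1"
  proof (rule inj_onI)
    fix C D assume "C \<in> N1" "D \<in> N1" "f C = f D"
    then show "C = D" using inj_on_image_eq_iff[OF Hinj subS subS] unfolding f_def by blast
  qed
  have fim: "f ` N1 = N2"
  proof -
    have "f ` N1 = (\<lambda>s. pclass n v g2 (H s)) ` S1"
      unfolding N1 image_image using clsH unfolding f_def by (intro image_cong) auto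
    also have "\<dots> = N2" unfolding N2 Him[symmetric] image_image ..
    finally show ?thesis .
  qed
  have bij: "bij_betw f N1 N2" using finj fim unfolding bij_betw_def by blast
  define E1 where "E1 = {{pclass n v g1 s, pclass n v g1 t} | s t. special_param n v g1 s \<and> special_param n v g1 t
          \<and> s \<noteq> t \<and> \<not> (\<exists>u. special_param n v g1 u \<and> cyc_between L s t u)}"
  define E2 where "E2 = {{pclass n v g2 s, pclass n v g2 t} | s t. special_param n v g2 s \<and> special_param n v g2 t
          \<and> s \<noteq> t \<and> \<not> (\<exists>u. special_param n v g2 u \<and> cyc_between L s t u)}"
  have E1: "X \<in> E1 \<longleftrightarrow> (\<exists>s\<in>S1. \<exists>t\<in>S1. X = {pclass n v g1 s, pclass n v g1 t} \<and> s \<noteq> t \<and> \<not> (\<exists>u\<in>S1. cyc_between L s t u))" for X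
    unfolding E1_def S1_def by auto
  have E2: "X \<in> E2 \<longleftrightarrow> (\<exists>s\<in>S2. \<exists>t\<in>S2. X = {pclass n v g2 s, pclass n v g2 t} \<and> s \<noteq> t \<and> \<not> (\<exists>u\<in>S2. cyc_between L s t u))" for X
    unfolding E2_def S2_def by auto
  have E2': "X \<in> E2 \<longleftrightarrow> (\<exists>s\<in>S1. \<exists>t\<in>S1. X = {f (pclass n v g1 s), f (pclass n v g1 t)} \<and> s \<noteq> t \<and> \<not> (\<exists>u\<in>S1. cyc_between L s t u))" for X
  proof -
    have "X \<in> E2 \<longleftrightarrow> (\<exists>s\<in>S1. \<exists>t\<in>S1. X = {pclass n v g2 (H s), pclass n v g2 (H t)} \<and> H s \<noteq> H t \<and> \<not> (\<exists>u\<in>S1. cyc_between L (H s) (H t) (H u)))"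
      unfolding E2 Him[symmetric] by blast
    also have "\<dots> \<longleftrightarrow> (\<exists>s\<in>S1. \<exists>t\<in>S1. X = {f (pclass n v g1 s), f (pclass n v g1 t)} \<and> s \<noteq> t \<and> \<not> (\<exists>u\<in>S1. cyc_between L s t u))"
      unfolding f_def
      by (intro bex_cong refl) (simp add: clsH cyc inj_on_eq_iff[OF Hinj] cong: bex_cong)
    finally show ?thesis .
  qed
  have edges: "{x, y} \<in> E1 \<longleftrightarrow> {f x, f y} \<in> E2" if xy: "x \<in> N1" "y \<in> N1" for x y
  proof -
    have key: "{x, y} = {pclass n v g1 s, pclass n v g1 t} \<longleftrightarrow> {f x, f y} = {f (pclass n v g1 s), f (pclass n v g1 t)}"
      if "s \<in> S1" "t \<in> S1" for s t
    proof -
      have sub: "{x, y} \<subseteq> N1" "{pclass n v g1 s, pclass n v g1 t} \<subseteq> N1" using xy that unfolding N1 by auto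
      show ?thesis using inj_on_image_eq_iff[OF finj sub] by simp
    qed
    show ?thesis unfolding E1 E2' by (intro bex_cong refl) (simp only: key)
  qed
  define lab where "lab C = ({i. i < n \<and> (\<exists>s\<in>C. bpt n v s = v i)},
             {j. j < n \<and> (\<exists>s\<in>C. bpt n v s \<in> open_segment (v j) (v (nxt n j)))})" for C
  have labels: "lab (f C) = lab C" if C: "C \<in> N1" for C
  proof -
    have CS: "s \<in> S1" "s \<in> {0..<L}" "H s \<in> S2" "H s \<in> {0..<L}" if "s \<in> C" for s
      using that subS[OF C] rng Him by auto
    have 1: "bpt n v (H s) = v i \<longleftrightarrow> bpt n v s = v i" if "s \<in> C" "i < n" for s i
    proof -
      have "H s = vp i \<longleftrightarrow> s = vp i"
        using fixv[OF that(2)] inj_on_eq_iff[OF Hinj CS(1)[OF that(1)] vS(1)[OF that(2)]] by simp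
      then show ?thesis using bpt_eq_vertex CS[OF that(1)] that(2) by simp
    qed
    have 2: "bpt n v (H s) \<in> open_segment (v j) (v (nxt n j)) \<longleftrightarrow> bpt n v s \<in> open_segment (v j) (v (nxt n j))"
      if "s \<in> C" "j < n" for s j
      using open_edge_cyc[OF that(2)] CS[OF that(1)] cyc[of "vp j" "vp (nxt n j)" s]
        vS(1)[OF that(2)] vS(1)[OF nxt_less[OF n_pos]] fixv[OF that(2)] fixv[OF nxt_less[OF n_pos]] by simp
    show ?thesis unfolding lab_def f_def using 1 2 by auto
  qed
  have T1: "gluing_tree n v g1 = (N1, E1, lab)" and T2: "gluing_tree n v g2 = (N2, E2, lab)"
    unfolding gluing_tree_def N1_def N2_def E1_def E2_def lab_def by auto
  show ?thesis unfolding T1 T2 ltree_iso_def using bij edges labels by auto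
qed

text \<open>The case of equal folding parameters, including those that are breakpoints
  themselves.\<close>

lemma tree_iso_same_relation:
  assumes g: "is_gluing n v g1" "is_gluing n v g2"
    and eq: "\<And>s t. s \<in> {0..<L} \<Longrightarrow> t \<in> {0..<L} \<Longrightarrow> pglued n v g1 s t \<longleftrightarrow> pglued n v g2 s t"
  shows "ltree_iso (gluing_tree n v g1) (gluing_tree n v g2)"
proof (rule tree_transfer[OF g, of "\<lambda>s. s"])
  have "pclass n v g1 s = pclass n v g2 s" if "s \<in> {0..<L}" for s
    unfolding pclass_def using eq that by auto
  then have "special_param n v g1 s \<longleftrightarrow> special_param n v g2 s" for s
    unfolding special_param_def by auto
  then show "bij_betw (\<lambda>s. s) {s. special_param n v g1 s} {s. special_param n v g2 s}"
    by (simp add: bij_betw_def)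
  show "pglued n v g1 s t \<longleftrightarrow> pglued n v g2 s t"
    if "s \<in> {s. special_param n v g1 s}" "t \<in> {s. special_param n v g1 s}" for s t
    using eq that unfolding special_param_def by auto
qed auto

text \<open>Vertices as seen from vertex \<open>i\<close>. The element \<open>l\<close> is inserted
  for the sake of \<open>l = L\<close>, a value that no reduced coordinate attains.\<close>

definition vcoords :: "nat \<Rightarrow> real \<Rightarrow> real set" where
  "vcoords i l = insert l ((\<lambda>k. modL L (vp k - vp i)) ` {..<n})"

lemma card_vcoords: "finite (vcoords i l)" "card (vcoords i l) \<le> n + 1"
proof -
  show "finite (vcoords i l)" unfolding vcoords_def by simp
  have "card (vcoords i l) \<le> Suc (card ((\<lambda>k. modL L (vp k - vp i)) ` {..<n}))"
    unfolding vcoords_def by (rule card_insert_le_m1[THEN order_trans]) (auto simp: card_insert_if)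
  also have "\<dots> \<le> Suc (card {..<n})" by (intro Suc_leI le_imp_less_Suc card_image_le) auto
  finally show "card (vcoords i l) \<le> n + 1" by simp
qed

text \<open>The map \<open>w\<close> carries classes to classes. The extra element \<open>l\<close>
  of \<open>vcoords\<close> does not add special points: it is the coordinate of a vertex or the
  unattained value \<open>L\<close>.\<close>

lemma special_coords:
  assumes rel: "\<And>s t. s \<in> {0..<L} \<Longrightarrow> t \<in> {0..<L} \<Longrightarrow> pglued n v g s t \<longleftrightarrow> folded L b l c s t"
    and i: "i < n" "b = vp i" and l: "l = L \<or> (\<exists>j<n. l = modL L (vp j - vp i))"
    and s: "s \<in> {0..<L}"
  shows "special_param n v g s \<longleftrightarrow> modL L (s - b) \<in> fspecial L l (vcoords i l) c"
proof -
  define w where "w t = modL L (t - b)" for t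
  have w_range: "w t \<in> {0..<L}" for t unfolding w_def using modL_range L_pos by blast
  have w_surj: "\<exists>t\<in>{0..<L}. w t = y" if "y \<in> {0..<L}" for y
    using that modL_unshift[of b y] modL_id[of y L] modL_range[OF L_pos, of "b + y"]
    unfolding w_def by (intro bexI[of _ "modL L (b + y)"]) auto
  have w_inj: "s = t" if "s \<in> {0..<L}" "t \<in> {0..<L}" "w s = w t" for s t
    using modL_shift[of b s] modL_shift[of b t] modL_id[of s L] modL_id[of t L] that
    unfolding w_def by (metis atLeastLessThan_iff)
  have fr: "frel L l c (w s) (w t) \<longleftrightarrow> pglued n v g s t" if "s \<in> {0..<L}" "t \<in> {0..<L}" for s t
    unfolding rel[OF that] folded_def frel_def Let_def w_def[symmetric] using w_inj[OF that] by auto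
  have im: "fcls L l c (w s) = w ` pclass n v g s"
  proof
    show "fcls L l c (w s) \<subseteq> w ` pclass n v g s"
    proof
      fix y assume y: "y \<in> fcls L l c (w s)"
      then obtain t where "t \<in> {0..<L}" "w t = y" using w_surj[of y] unfolding fcls_def by auto
      then show "y \<in> w ` pclass n v g s" using y fr[OF s] unfolding fcls_def pclass_def by auto
    qed
    show "w ` pclass n v g s \<subseteq> fcls L l c (w s)"
      using fr[OF s] w_range unfolding fcls_def pclass_def by auto
  qed
  have "card (fcls L l c (w s)) = card (pclass n v g s)"
    unfolding im using w_inj by (intro card_image inj_onI) (auto simp: pclass_def)
  moreover have "fcls L l c (w s) \<inter> vcoords i l \<noteq> {} \<longleftrightarrow> (\<exists>t\<in>pclass n v g s. is_vertex_param n v t)"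
  proof -
    have "w t \<in> vcoords i l \<longleftrightarrow> is_vertex_param n v t" if t: "t \<in> {0..<L}" for t
    proof -
      have "w t \<in> vcoords i l \<longleftrightarrow> (\<exists>k<n. w t = w (vp k))"
        using l w_range[of t] i unfolding vcoords_def w_def by auto
      also have "\<dots> \<longleftrightarrow> (\<exists>k<n. t = vp k)" using w_inj[OF t plen_range] by auto
      also have "\<dots> \<longleftrightarrow> is_vertex_param n v t" unfolding vertex_param_iff[OF t] by auto
      finally show ?thesis .
    qed
    then show ?thesis unfolding im by (auto simp: pclass_def)
  qed
  ultimately show ?thesis
    using s w_range[of s] unfolding special_param_def fspecial_def w_def by auto
qed

lemma tree_iso_same_cell:
  assumes g: "is_gluing n v g1" "is_gluing n v g2"
    and i: "i < n" and l: "0 < l" "l = L \<or> (\<exists>j<n. l = modL L (vp j - vp i))"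
    and c: "0 < c" "c < l" "0 < c'" "c' < l"
    and r1: "\<And>s t. s \<in> {0..<L} \<Longrightarrow> t \<in> {0..<L} \<Longrightarrow> pglued n v g1 s t \<longleftrightarrow> folded L (vp i) l c s t"
    and r2: "\<And>s t. s \<in> {0..<L} \<Longrightarrow> t \<in> {0..<L} \<Longrightarrow> pglued n v g2 s t \<longleftrightarrow> folded L (vp i) l c' s t"
    and cell: "\<And>y. y \<in> closed_segment c c' \<Longrightarrow> y \<notin> breaks l (vcoords i l)"
  shows "ltree_iso (gluing_tree n v g1) (gluing_tree n v g2)"
proof -
  define W where "W = vcoords i l"
  define b where "b = vp i"
  have lL: "l \<le> L" using l(2) modL_bounds(2)[OF L_pos] by (auto simp: less_imp_le)
  have W0: "0 \<in> W" "l \<in> W" "\<And>x. x \<in> W \<Longrightarrow> 0 \<le> x \<and> x \<le> L"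
  proof -
    have "modL L (vp i - vp i) = 0" by (simp add: modL_id L_pos)
    then have "0 \<in> (\<lambda>k. modL L (vp k - vp i)) ` {..<n}" using i by (intro image_eqI[of _ _ i]) auto
    then show "0 \<in> W" "l \<in> W" unfolding W_def vcoords_def by auto
    show "0 \<le> x \<and> x \<le> L" if "x \<in> W" for x
      using that l(1) lL modL_bounds[OF L_pos] unfolding W_def vcoords_def by (auto simp: less_imp_le)
  qed
  interpret F: fold_cell L l W c
    by unfold_locales (use l lL W0 c in auto)
  have seg: "y \<in> closed_segment c c' \<longleftrightarrow> (c \<le> y \<and> y \<le> c') \<or> (c' \<le> y \<and> y \<le> c)" for y
    by (simp add: closed_segment_eq_real_ivl) (use less_le_trans in force)
  \<comment> \<open>Because 0 belongs to \<open>W\<close>, every point of \<open>W\<close> is a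
    breakpoint, so the parameter cannot cross a vertex inside a cell.\<close>
  have Wb: "x \<in> breaks l W" if "x \<in> W" for x
    unfolding breaks_iff using that W0(1) by force
  have good: "F.good y" if y: "y \<in> closed_segment c c'" for y
    unfolding F.good_def
  proof (intro conjI ballI)
    show "0 < y" "y < l" using y c unfolding seg by auto
    show "y \<notin> breaks l W" using cell[OF y] unfolding W_def .
    fix x assume x: "x \<in> W"
    have "x \<notin> closed_segment c c'" using cell[of x] Wb[OF x] unfolding W_def by blast
    then show "(x < y) = (x < c)" "(y < x) = (c < x)" using y unfolding seg by auto
  qed
  obtain h where h: "bij_betw h (fspecial L l W c) (fspecial L l W c')"
    "\<And>u w. u \<in> fspecial L l W c \<Longrightarrow> w \<in> fspecial L l W c \<Longrightarrow> u < w \<longleftrightarrow> h u < h w"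
    "\<And>u w. u \<in> fspecial L l W c \<Longrightarrow> w \<in> fspecial L l W c \<Longrightarrow> frel L l c u w \<longleftrightarrow> frel L l c' (h u) (h w)"
    "\<And>u. u \<in> W \<Longrightarrow> u < L \<Longrightarrow> h u = u"
    using F.cell_map[OF good] by blast
  define w where "w t = modL L (t - b)" for t
  define wi where "wi y = modL L (b + y)" for y
  have w_range: "w t \<in> {0..<L}" and wi_range: "wi t \<in> {0..<L}" for t
    unfolding w_def wi_def using modL_range L_pos by blast+
  have wwi: "w (wi y) = y" if "y \<in> {0..<L}" for y
    using modL_unshift[of b y] modL_id[of y L] that unfolding w_def wi_def by auto
  have wiw: "wi (w t) = t" if "t \<in> {0..<L}" for t
    using modL_shift[of b t] modL_id[of t L] that unfolding w_def wi_def by auto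
  define S1 where "S1 = {s. special_param n v g1 s}"
  define S2 where "S2 = {s. special_param n v g2 s}"
  have S1: "s \<in> S1 \<longleftrightarrow> s \<in> {0..<L} \<and> w s \<in> fspecial L l W c" for s
    using special_coords[OF r1 i refl l(2), of s] unfolding S1_def W_def w_def b_def special_param_def by auto
  have S2: "s \<in> S2 \<longleftrightarrow> s \<in> {0..<L} \<and> w s \<in> fspecial L l W c'" for s
    using special_coords[OF r2 i refl l(2), of s] unfolding S2_def W_def w_def b_def special_param_def by auto
  have fsr: "u \<in> fspecial L l W y \<Longrightarrow> u \<in> {0..<L}" for u y unfolding fspecial_def by simp
  have bw: "bij_betw w S1 (fspecial L l W c)"
    by (rule bij_betw_byWitness[where f' = wi]) (use S1 wwi wiw wi_range fsr in auto)
  have bwi: "bij_betw wi (fspecial L l W c') S2"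
    by (rule bij_betw_byWitness[where f' = w]) (use S2 wwi wiw wi_range fsr in auto)
  \<comment> \<open>Pass to coordinates based at vertex \<open>i\<close>, follow the symbols, and
    return.\<close>
  define H where "H = wi \<circ> h \<circ> w"
  have Hbij: "bij_betw H S1 S2" unfolding H_def using bij_betw_trans[OF bij_betw_trans[OF bw h(1)] bwi]
    by (simp add: comp_assoc)
  have hin: "h (w s) \<in> fspecial L l W c'" if "s \<in> S1" for s
    using that S1 h(1) unfolding bij_betw_def by blast
  have wH: "w (H s) = h (w s)" if "s \<in> S1" for s
    unfolding H_def using wwi[OF fsr[OF hin[OF that]]] by simp
  have frel_eq: "frel L l y (w s) (w t) \<longleftrightarrow> folded L b l y s t" if "s \<in> {0..<L}" "t \<in> {0..<L}" for s t y
    using wiw[OF that(1)] wiw[OF that(2)] unfolding folded_def frel_def Let_def w_def[symmetric] by metis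
  show ?thesis
  proof (rule tree_transfer[OF g, of H])
    show "bij_betw H {s. special_param n v g1 s} {s. special_param n v g2 s}"
      using Hbij unfolding S1_def S2_def .
    fix s t assume "s \<in> {s. special_param n v g1 s}" "t \<in> {s. special_param n v g1 s}"
    then have st: "s \<in> S1" "t \<in> S1" unfolding S1_def by auto
    then have r: "s \<in> {0..<L}" "t \<in> {0..<L}" using S1 by auto
    have Hr: "H s \<in> {0..<L}" "H t \<in> {0..<L}" unfolding H_def using wi_range by auto
    have "pglued n v g1 s t \<longleftrightarrow> frel L l c (w s) (w t)" using r1[OF r] frel_eq[OF r] unfolding b_def by simp
    also have "\<dots> \<longleftrightarrow> frel L l c' (w (H s)) (w (H t))" using h(3) st S1 wH by simp
    also have "\<dots> \<longleftrightarrow> pglued n v g2 (H s) (H t)" using r2[OF Hr] frel_eq[OF Hr] unfolding b_def by simp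
    finally show "pglued n v g1 s t \<longleftrightarrow> pglued n v g2 (H s) (H t)" .
    fix u assume "u \<in> {s. special_param n v g1 s}"
    then have u: "u \<in> S1" unfolding S1_def by auto
    show "cyc_between L (H s) (H t) (H u) = cyc_between L s t u"
    proof (cases "s = t")
      case True
      then show ?thesis unfolding cyc_between_def using modL_id[of 0 L] L_pos by auto
    next
      case False
      have ne: "w s \<noteq> w t" using False wiw r by metis
      have ne': "h (w s) \<noteq> h (w t)" using ne h(1) st S1 unfolding bij_betw_def by (meson inj_onD)
      have "cyc_between L s t u = cyc_between L (w s) (w t) (w u)"
        unfolding w_def by (rule cyc_between_shift[OF L_pos, symmetric])
      also have "\<dots> = cyc_between L (h (w s)) (h (w t)) (h (w u))"
        unfolding cyc_between_iff[OF L_pos w_range w_range w_range ne]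
          cyc_between_iff[OF L_pos fsr[OF hin[OF st(1)]] fsr[OF hin[OF st(2)]] fsr[OF hin[OF u]] ne']
        using h(2) st u S1 by simp
      also have "\<dots> = cyc_between L (w (H s)) (w (H t)) (w (H u))" using wH st u by simp
      also have "\<dots> = cyc_between L (H s) (H t) (H u)"
        unfolding w_def by (rule cyc_between_shift[OF L_pos])
      finally show ?thesis by simp
    qed
  next
    fix k assume k: "k < n"
    have "w (vp k) \<in> W" unfolding w_def W_def b_def vcoords_def using k by auto
    then have "h (w (vp k)) = w (vp k)" using h(4) w_range[of "vp k"] by auto
    then show "H (vp k) = vp k" unfolding H_def using wiw plen_range[OF k] by simp
  qed
qed

end

section \<open>The cubic upper bound\<close>

text \<open>A point of \<open>B\<close> between two different parameters, or at the left one, would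
  raise the count. One at the right end alone is excluded by the membership condition.\<close>

lemma same_cell:
  fixes B :: "real set"
  assumes B: "finite B" and c: "card {x \<in> B. x < c} = card {x \<in> B. x < c'}" and m: "c \<in> B \<longleftrightarrow> c' \<in> B"
  shows "c = c' \<or> (\<forall>y\<in>closed_segment c c'. y \<notin> B)"
proof -
  have main: "c1 = c2 \<or> (\<forall>y. c1 \<le> y \<and> y \<le> c2 \<longrightarrow> y \<notin> B)"
    if le: "c1 \<le> c2" and h: "card {x \<in> B. x < c1} = card {x \<in> B. x < c2}" "c1 \<in> B \<longleftrightarrow> c2 \<in> B" for c1 c2
  proof (rule ccontr)
    assume "\<not> (c1 = c2 \<or> (\<forall>y. c1 \<le> y \<and> y \<le> c2 \<longrightarrow> y \<notin> B))"
    then obtain y where y: "c1 < c2" "c1 \<le> y" "y \<le> c2" "y \<in> B" using le by auto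
    then obtain z where z: "c1 \<le> z" "z < c2" "z \<in> B" using h(2) by (cases "y = c2") auto
    have "{x \<in> B. x < c1} \<subseteq> {x \<in> B. x < c2}" using y(1) by auto
    moreover have "z \<in> {x \<in> B. x < c2}" "z \<notin> {x \<in> B. x < c1}" using z by auto
    ultimately have "{x \<in> B. x < c1} \<subset> {x \<in> B. x < c2}" by blast
    moreover have "finite {x \<in> B. x < c2}" using B by simp
    ultimately have "card {x \<in> B. x < c1} < card {x \<in> B. x < c2}" by (intro psubset_card_mono)
    then show False using h(1) by linarith
  qed
  show ?thesis
  proof (cases "c \<le> c'")
    case True
    then show ?thesis using main[OF True c m] by (auto simp: closed_segment_eq_real_ivl)
  next
    case False
    then have "c' \<le> c" by simp
    from main[OF this c[symmetric] m[symmetric]] show ?thesis using False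
      by (auto simp: closed_segment_eq_real_ivl)
  qed
qed

context opoly
begin

definition fold_len :: "nat \<Rightarrow> nat \<Rightarrow> nat \<Rightarrow> real" where
  "fold_len k i j = (if k = 0 then L else modL L (vp j - vp i))"

definition fold_breaks :: "nat \<Rightarrow> nat \<Rightarrow> nat \<Rightarrow> real set" where
  "fold_breaks k i j = breaks (fold_len k i j) (vcoords i (fold_len k i j))"

definition folds :: "gluing \<Rightarrow> nat \<Rightarrow> nat \<Rightarrow> nat \<Rightarrow> real \<Rightarrow> bool" where
  "folds g k i j c \<longleftrightarrow> 0 \<le> c \<and> c < fold_len k i j \<and>
     (\<forall>s\<in>{0..<L}. \<forall>t\<in>{0..<L}. pglued n v g s t \<longleftrightarrow> folded L (vp i) (fold_len k i j) c s t)"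

text \<open>Codes: k = 0 for halvings, k = 1 for junctions of three vertices, k = 2 for junctions of two
  vertices with a point in the interior of an edge. The remaining data locate c, exactly in the
  case k = 1 and relative to the breakpoints otherwise.\<close>

definition coded :: "gluing \<Rightarrow> nat \<times> nat \<times> nat \<times> nat \<times> bool \<Rightarrow> bool" where
  "coded g x = (case x of (k, i, j, m, f) \<Rightarrow> aleksandrov_gluing n v g \<and> (\<exists>c. folds g k i j c \<and>
     (if k = 1 then c = modL L (vp m - vp i)
      else m = card {y \<in> fold_breaks k i j. y < c} \<and> f = (c \<in> fold_breaks k i j))))"

text \<open>Halvings are folded from vertex 0. For \<open>k = 2\<close> either of the two vertices
  can be the one in \<open>big\<close>, hence two blocks. The number 2 (n + 1)^2 bounds the
  breakpoints, as \<open>vcoords\<close> has at most n + 1 elements.\<close>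

definition codes :: "(nat \<times> nat \<times> nat \<times> nat \<times> bool) set" where
  "codes = {0} \<times> {0} \<times> {0} \<times> {..2 * (n + 1)^2} \<times> UNIV
     \<union> {1} \<times> {..<n} \<times> {..<n} \<times> {..<n} \<times> {False}
     \<union> {2} \<times> big \<times> {..<n} \<times> {..2 * (n + 1)^2} \<times> UNIV
     \<union> {2} \<times> {..<n} \<times> big \<times> {..2 * (n + 1)^2} \<times> UNIV"

lemma finite_big: "finite big"
  unfolding big_def by simp

lemma finite_codes: "finite codes"
  unfolding codes_def by (intro finite_UnI finite_cartesian_product finite_big) auto

text \<open>The main terms are n^3 from three vertices and, as \<open>big\<close> has at most four
  elements, 16 n (2 (n + 1)^2 + 1) from the blocks with \<open>k = 2\<close>. For n at least 7 the
  last factor is at most 5 n^2 and the total at most 91 n^3; 100 is a round bound.\<close>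

lemma card_codes:
  assumes "n \<ge> 7"
  shows "real (card codes) \<le> 100 * real n ^ 3"
proof -
  let ?M = "2 * (n + 1)^2 + 1"
  have "card codes \<le> card ({0::nat} \<times> {0::nat} \<times> {0::nat} \<times> {..2 * (n + 1)^2} \<times> (UNIV :: bool set))
      + card ({1::nat} \<times> {..<n} \<times> {..<n} \<times> {..<n} \<times> {False})
      + card ({2::nat} \<times> big \<times> {..<n} \<times> {..2 * (n + 1)^2} \<times> (UNIV :: bool set))
      + card ({2::nat} \<times> {..<n} \<times> big \<times> {..2 * (n + 1)^2} \<times> (UNIV :: bool set))"
    unfolding codes_def by (intro order_trans[OF card_Un_le] add_mono order_refl)
  also have "\<dots> = 2 * ?M + n * n * n + 2 * (card big * n * (2 * ?M))"
    by (simp add: card_cartesian_product algebra_simps)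
  also have "\<dots> \<le> 2 * ?M + n * n * n + 2 * (4 * n * (2 * ?M))"
    using card_big by (intro add_mono mult_mono order_refl) auto
  finally have 1: "card codes \<le> 2 * ?M + n * n * n + 16 * n * ?M" by simp
  have nn: "7 * n \<le> n * n" using assms by (intro mult_right_mono) auto
  have "?M \<le> 5 * (n * n)"
  proof -
    have "?M = 2 * (n * n) + 4 * n + 3" by (simp add: power2_eq_square algebra_simps)
    then show ?thesis using nn assms by linarith
  qed
  then have "n * ?M \<le> n * (5 * (n * n))" by (rule mult_le_mono2)
  then have M: "n * ?M \<le> 5 * (n * n * n)" by (simp only: ac_simps)
  have "1 * ?M \<le> n * ?M" using assms by (intro mult_le_mono1) auto
  then have "card codes \<le> 2 * (n * ?M) + n * n * n + 16 * (n * ?M)" using 1 by (simp only: mult.assoc)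
  then have "card codes \<le> 100 * (n * n * n)" using M by linarith
  then have "real (card codes) \<le> real (100 * (n * n * n))" by (rule of_nat_mono)
  then show ?thesis by (simp add: power3_eq_cube)
qed

lemma finite_fold_breaks: "finite (fold_breaks k i j)"
  unfolding fold_breaks_def by (intro finite_breaks card_vcoords)

lemma card_fold_breaks: "card {y \<in> fold_breaks k i j. y < c} \<le> 2 * (n + 1)^2"
proof -
  have "card {y \<in> fold_breaks k i j. y < c} \<le> card (fold_breaks k i j)"
    using finite_fold_breaks by (intro card_mono) auto
  also have "\<dots> \<le> 2 * card (vcoords i (fold_len k i j)) ^ 2"
    unfolding fold_breaks_def using card_breaks card_vcoords(1) by blast
  also have "\<dots> \<le> 2 * (n + 1)^2" using card_vcoords(2) by (intro mult_le_mono2 power_mono) auto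
  finally show ?thesis .
qed

lemma coded_iso:
  assumes x: "x \<in> codes" and g: "coded g1 x" "coded g2 x"
  shows "ltree_iso (gluing_tree n v g1) (gluing_tree n v g2)"
proof -
  obtain k i j m f where X: "x = (k, i, j, m, f)" by (cases x)
  have ij: "i < n" "j < n" using x n_pos unfolding X codes_def big_def by auto
  have ig: "is_gluing n v g1" "is_gluing n v g2"
    using g unfolding coded_def aleksandrov_gluing_def X by auto
  obtain c1 where c1: "folds g1 k i j c1"
    "if k = 1 then c1 = modL L (vp m - vp i)
      else m = card {y \<in> fold_breaks k i j. y < c1} \<and> f = (c1 \<in> fold_breaks k i j)"
    using g(1) unfolding coded_def X by auto
  obtain c2 where c2: "folds g2 k i j c2"
    "if k = 1 then c2 = modL L (vp m - vp i)
      else m = card {y \<in> fold_breaks k i j. y < c2} \<and> f = (c2 \<in> fold_breaks k i j)"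
    using g(2) unfolding coded_def X by auto
  have "c1 = c2 \<or> (\<forall>y\<in>closed_segment c1 c2. y \<notin> fold_breaks k i j)"
    using same_cell[OF finite_fold_breaks, of k i j c1 c2] c1(2) c2(2) by (auto split: if_splits)
  then show ?thesis
  proof
    assume "c1 = c2"
    then have "folds g2 k i j c1" using c2(1) by simp
    then show ?thesis using c1(1) unfolding folds_def
      by (intro tree_iso_same_relation[OF ig]) blast
  next
    assume cell: "\<forall>y\<in>closed_segment c1 c2. y \<notin> fold_breaks k i j"
    define l where "l = fold_len k i j"
    \<comment> \<open>As 0 is a breakpoint, the degenerate parameter 0 belongs to the case
      \<open>c1 = c2\<close>, and inside a cell parameters are positive.\<close>
    have b0: "0 \<in> fold_breaks k i j"
    proof -
      have "modL L (vp i - vp i) = 0" by (simp add: modL_id L_pos)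
      then have "0 \<in> vcoords i l" unfolding vcoords_def using ij(1) by (auto intro!: image_eqI[of _ _ i])
      then show ?thesis unfolding fold_breaks_def l_def[symmetric] breaks_iff by force
    qed
    have "c1 \<noteq> 0" "c2 \<noteq> 0" using cell b0 by auto
    then have c: "0 < c1" "c1 < l" "0 < c2" "c2 < l" using c1(1) c2(1) unfolding folds_def l_def by auto
    show ?thesis
    proof (rule tree_iso_same_cell[OF ig ij(1), of l c1 c2])
      show "l = L \<or> (\<exists>j<n. l = modL L (vp j - vp i))" unfolding l_def fold_len_def using ij by auto
      show "0 < l" using c by simp
      show "y \<notin> breaks l (vcoords i l)" if "y \<in> closed_segment c1 c2" for y
        using cell that unfolding fold_breaks_def l_def by blast
      show "pglued n v g1 s t = folded L (vp i) l c1 s t" if "s \<in> {0..<L}" "t \<in> {0..<L}" for s t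
        using c1(1) that unfolding folds_def l_def by blast
      show "pglued n v g2 s t = folded L (vp i) l c2 s t" if "s \<in> {0..<L}" "t \<in> {0..<L}" for s t
        using c2(1) that unfolding folds_def l_def by blast
    qed (use c in blast)+
  qed
qed

end

section \<open>Every Aleksandrov gluing has a code\<close>

context alek_poly
begin

lemma fold_exists:
  obtains k i j c where "folds gl k i j c" "k = 0 \<and> i = 0 \<and> j = 0 \<or>
    k \<noteq> 0 \<and> i < n \<and> j < n \<and> ((\<exists>m<n. c = modL L (vp m - vp i)) \<or> i \<in> big \<or> j \<in> big)"
proof (cases "\<exists>s\<in>{0..<L}. card (cls s) = 3")
  case False
  have "card (cls s) \<le> 2" if s: "s \<in> {0..<L}" for s
  proof -
    have "card (cls s) \<noteq> 3"
    proof
      assume "card (cls s) = 3"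
      then have "\<exists>s\<in>{0..<L}. card (cls s) = 3" using s by (rule bexI)
      then show False using False by contradiction
    qed
    then show ?thesis using cls_card_le_3[OF s] by linarith
  qed
  then obtain c where "0 \<le> c" "c < L"
    "\<And>s t. s \<in> {0..<L} \<Longrightarrow> t \<in> {0..<L} \<Longrightarrow> pglued n v gl s t \<longleftrightarrow> folded L 0 L c s t"
    using halving_structure by blast
  then have "folds gl 0 0 0 c" unfolding folds_def fold_len_def by simp
  then show ?thesis using that by blast
next
  case True
  note goal = that
  from True obtain s where s: "s \<in> {0..<L}" "card (cls s) = 3" by blast
  have fin: "finite (cls s)" using finite_cls s(1) by blast
  have "\<exists>i j x. i < n \<and> j < n \<and> i \<noteq> j \<and> vp i \<in> cls s \<and> vp j \<in> cls s \<and> x \<in> cls s \<and> x \<noteq> vp i \<and> x \<noteq> vp j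
      \<and> ((\<exists>m<n. x = vp m) \<or> i \<in> big \<or> j \<in> big)"
  proof -
    obtain V where V: "V \<subseteq> vset (cls s)" "card V = 2" "finite V"
      using junction_vertices[OF s] by (metis obtain_subset_with_card_n)
    obtain i j where ij: "V = {i, j}" "i \<noteq> j" using V(2) card_2_iff by metis
    have ijn: "i < n" "j < n" "vp i \<in> cls s" "vp j \<in> cls s" using V(1) unfolding ij vset_def by auto
    have "vp i \<noteq> vp j" using plen_eq_iff ijn ij by auto
    then have "card (cls s - {vp i, vp j}) = 1"
      using s(2) fin ijn by (subst card_Diff_subset) auto
    then obtain x where x: "cls s - {vp i, vp j} = {x}" by (metis card_1_singletonE)
    have "(\<exists>m<n. x = vp m) \<or> i \<in> big \<or> j \<in> big"
    proof (rule ccontr)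
      assume c: "\<not> ((\<exists>m<n. x = vp m) \<or> i \<in> big \<or> j \<in> big)"
      have "vset (cls s) = {i, j}"
      proof
        show "vset (cls s) \<subseteq> {i, j}"
        proof
          fix m assume m: "m \<in> vset (cls s)"
          then have "vp m \<noteq> x" using c unfolding vset_def by auto
          then have "vp m = vp i \<or> vp m = vp j" using m x unfolding vset_def by auto
          then show "m \<in> {i, j}" using plen_eq_iff m ijn unfolding vset_def by auto
        qed
      qed (use V ij in auto)
      \<comment> \<open>With only two vertices in the class their turns must reach pi together, so
        one of them reaches pi / 2.\<close>
      then have "pi \<le> turn i + turn j" using turn_ge[OF s(1)] s(2) ij(2) by simp
      moreover have "turn i < pi / 2" "turn j < pi / 2" using c ijn unfolding big_def by auto
      ultimately show False by linarith
    qed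
    then show ?thesis using ijn ij(2) x by blast
  qed
  then obtain i j x where h: "i < n" "j < n" "i \<noteq> j" "vp i \<in> cls s" "vp j \<in> cls s" "x \<in> cls s"
    "x \<noteq> vp i" "x \<noteq> vp j" "(\<exists>m<n. x = vp m) \<or> i \<in> big \<or> j \<in> big" by blast
  have xr: "x \<in> {0..<L}" using h cls_subset by blast
  \<comment> \<open>\<open>folded\<close> needs the third point between its two ends. This holds for
    one choice of base: if \<open>x\<close> does not precede \<open>vp j\<close> as seen from
    \<open>vp i\<close>, it precedes \<open>vp i\<close> as seen from \<open>vp j\<close>.\<close>
  have base: thesis if h: "i < n" "j < n" "vp i \<in> cls s" "vp j \<in> cls s" "x \<noteq> vp i"
      "(\<exists>m<n. x = vp m) \<or> i \<in> big \<or> j \<in> big" and lt: "modL L (x - vp i) < modL L (vp j - vp i)" for i j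
  proof -
    have c0: "0 < modL L (x - vp i)"
    proof -
      have "modL L (x - vp i) \<noteq> modL L (vp i - vp i)"
        using shift_inj[OF xr plen_range[OF h(1)], of "vp i"] h(5) by blast
      moreover have "modL L (vp i - vp i) = 0" by (simp add: modL_id L_pos)
      ultimately show ?thesis using modL_bounds(1)[OF L_pos, of "x - vp i"] by simp
    qed
    have ci: "cls (vp i) = cls s" using cls_eq h(3) by blast
    have f: "folds gl 1 i j (modL L (x - vp i))"
      unfolding folds_def fold_len_def
      using junction_structure[of "vp i" "vp j" x] plen_range[OF h(1)] ci s(2) h \<open>x \<in> cls s\<close> c0 lt by auto
    show thesis by (rule goal[OF f]) (use h(1,2,6) in auto)
  qed
  show thesis
  proof (cases "modL L (x - vp i) < modL L (vp j - vp i)")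
    case True
    then show ?thesis using base[of i j] h by blast
  next
    case False
    have ne: "modL L (x - vp i) \<noteq> modL L (vp j - vp i)"
      using shift_inj[OF xr plen_range[OF h(2)], of "vp i"] h(8) by blast
    have ne0: "modL L (vp j - vp i) \<noteq> modL L (vp i - vp i)"
    proof -
      have "vp j \<noteq> vp i" using plen_eq_iff[of j i] h(1-3) by simp
      then show ?thesis using shift_inj[OF plen_range[OF h(2)] plen_range[OF h(1)], of "vp i"] by blast
    qed
    have "modL L (vp i - vp i) = 0" by (simp add: modL_id L_pos)
    then have d: "0 < modL L (vp j - vp i)" using ne0 modL_bounds(1)[OF L_pos, of "vp j - vp i"] by simp
    define d where "d = modL L (vp j - vp i)"
    define y where "y = modL L (x - vp i)"
    have yd: "d < y" "y < L" "0 < d" using False ne d modL_bounds(2)[OF L_pos] unfolding d_def y_def by auto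
    have 1: "modL L (x - vp j) = y - d"
    proof -
      have "modL L (x - vp j) = modL L (y - d)"
        using modL_cong_diff[OF L_pos, of "x - vp i" y "vp j - vp i" d] unfolding y_def d_def
        by (simp add: L_pos)
      then show ?thesis using modL_id[of "y - d" L] yd by simp
    qed
    have 2: "modL L (vp i - vp j) = L - d"
    proof -
      have "modL L (vp i - vp j) = modL L (0 - d)"
        using modL_cong_diff[OF L_pos, of 0 0 "vp j - vp i" d] unfolding d_def by (simp add: L_pos)
      also have "\<dots> = L - d" using yd by (intro modL_unique[of _ _ "-1"]) auto
      finally show ?thesis .
    qed
    show ?thesis
    proof (rule base[of j i])
      show "modL L (x - vp j) < modL L (vp i - vp j)" unfolding 1 2 using yd by linarith
    qed (use h in blast)+
  qed
qed

lemma code_exists: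
  assumes "aleksandrov_gluing n v gl"
  shows "\<exists>x\<in>codes. coded gl x"
proof -
  obtain k i j c where f: "folds gl k i j c" and h: "k = 0 \<and> i = 0 \<and> j = 0 \<or>
    k \<noteq> 0 \<and> i < n \<and> j < n \<and> ((\<exists>m<n. c = modL L (vp m - vp i)) \<or> i \<in> big \<or> j \<in> big)"
    using fold_exists by blast
  \<comment> \<open>\<open>folds\<close> depends on \<open>k\<close> only through
    \<open>k = 0\<close>, so the values 1 and 2 can be assigned afterwards.\<close>
  have fk: "folds gl k' i j c" if "k' \<noteq> 0" "k \<noteq> 0" for k'
    using f that unfolding folds_def fold_len_def by simp
  consider "k = 0" "i = 0" "j = 0" | m where "k \<noteq> 0" "i < n" "j < n" "m < n" "c = modL L (vp m - vp i)"
    | "k \<noteq> 0" "i < n" "j < n" "i \<in> big \<or> j \<in> big" using h by blast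
  then show ?thesis
  proof cases
    case 1
    have "coded gl (0, 0, 0, card {y \<in> fold_breaks 0 0 0. y < c}, c \<in> fold_breaks 0 0 0)"
      unfolding coded_def using assms f 1 by auto
    then show ?thesis unfolding codes_def using card_fold_breaks by force
  next
    case (2 m)
    have "coded gl (1, i, j, m, False)" unfolding coded_def using assms fk[of 1] 2 by auto
    then show ?thesis unfolding codes_def using 2 by force
  next
    case 3
    have "coded gl (2, i, j, card {y \<in> fold_breaks 2 i j. y < c}, c \<in> fold_breaks 2 i j)"
      unfolding coded_def using assms fk[of 2] 3 by auto
    moreover have "(2, i, j, card {y \<in> fold_breaks 2 i j. y < c}, c \<in> fold_breaks 2 i j) \<in> codes"
      unfolding codes_def using 3 card_fold_breaks by auto
    ultimately show ?thesis by blast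
  qed
qed

end

lemma gluing_trees_upper_bound:
  assumes n: "n \<ge> 7" and cp: "convex_polygon n v"
  shows "\<exists>T :: ltree set. finite T \<and> real (card T) \<le> 100 * real n ^ 3 \<and>
    (\<forall>gl. aleksandrov_gluing n v gl \<longrightarrow> (\<exists>T'\<in>T. ltree_iso (gluing_tree n v gl) T'))"
proof -
  obtain e where e: "oriented e n v" using convex_polygon_oriented cp by blast
  interpret opoly n v e by unfold_locales (rule e)
  \<comment> \<open>One tree per code; by \<open>coded_iso\<close> the choice of the gluing is
    immaterial, and a code without gluings contributes some arbitrary tree.\<close>
  define rep where "rep x = gluing_tree n v (SOME g. coded g x)" for x
  have "\<exists>T'\<in>rep ` codes. ltree_iso (gluing_tree n v gl) T'" if al: "aleksandrov_gluing n v gl" for gl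
  proof -
    interpret A: glued_poly n v e gl
      by unfold_locales (use al in \<open>simp add: aleksandrov_gluing_def\<close>)
    interpret B: alek_poly n v e gl
      by unfold_locales (use al n A.aleksandrov_reversing in \<open>auto simp: aleksandrov_gluing_def\<close>)
    obtain x where x: "x \<in> codes" "coded gl x" using B.code_exists[OF al] by blast
    have "coded (SOME g. coded g x) x" using x(2) by (rule someI)
    then show ?thesis using coded_iso[OF x(1) x(2)] x(1) unfolding rep_def by blast
  qed
  moreover have "real (card (rep ` codes)) \<le> 100 * real n ^ 3"
    using card_image_le[OF finite_codes, of rep] card_codes[OF n] by linarith
  ultimately show ?thesis using finite_codes by (intro exI[of _ "rep ` codes"]) auto
qed

section \<open>Perimeter halvings\<close>

text \<open>Every vertical chord of the unit disc is wrapped onto a circle of latitude, so that exactly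
  conjugate points of the boundary are identified.\<close>

definition wrap :: "complex \<Rightarrow> real \<times> complex" where
  "wrap z = (Re z, let r = sqrt (1 - (Re z)^2) in of_real r * cis (pi * Im z / r))"

lemma disc_coords:
  assumes "cmod z \<le> 1"
  shows "(Re z)^2 \<le> 1" "\<bar>Im z\<bar> \<le> sqrt (1 - (Re z)^2)" "cmod z = 1 \<longleftrightarrow> \<bar>Im z\<bar> = sqrt (1 - (Re z)^2)"
proof -
  have s: "(Re z)^2 + (Im z)^2 \<le> 1" using assms by (metis abs_le_square_iff abs_norm_cancel abs_one cmod_power2 one_power2)
  then show 1: "(Re z)^2 \<le> 1" by (smt (verit) zero_le_power2)
  show "\<bar>Im z\<bar> \<le> sqrt (1 - (Re z)^2)" using s by (intro real_le_rsqrt) simp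
  have "cmod z = 1 \<longleftrightarrow> (Re z)^2 + (Im z)^2 = 1" by (metis cmod_power2 norm_ge_zero one_power2 power2_eq_iff_nonneg zero_le_one)
  also have "\<dots> \<longleftrightarrow> (sqrt (1 - (Re z)^2))^2 = \<bar>Im z\<bar>^2" using 1 by auto
  also have "\<dots> \<longleftrightarrow> sqrt (1 - (Re z)^2) = \<bar>Im z\<bar>" using 1 by (intro power2_eq_iff_nonneg) auto
  finally show "cmod z = 1 \<longleftrightarrow> \<bar>Im z\<bar> = sqrt (1 - (Re z)^2)" by auto
qed

lemma cis_eq_1_iff_int: "cis x = 1 \<longleftrightarrow> (\<exists>k::int. x = of_int k * (2 * pi))"
proof
  assume "cis x = 1"
  then have "cos x = 1" by (metis cis.sel(1) one_complex.sel(1))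
  then show "\<exists>k::int. x = of_int k * (2 * pi)" using cos_one_2pi_int by (simp add: mult.assoc)
next
  assume "\<exists>k::int. x = of_int k * (2 * pi)"
  then obtain k :: int where "x = 2 * pi * of_int k" by (auto simp: mult.commute)
  then show "cis x = 1" by (simp only: cis.ctr cos_int_2pin sin_int_2pin) (simp add: complex_eq_iff)
qed

lemma cis_eq_iff_int: "cis x = cis y \<longleftrightarrow> (\<exists>k::int. x = y + of_int k * (2 * pi))"
proof -
  have "cis x = cis y \<longleftrightarrow> cis (x - y) = 1" by (simp add: cis_divide[symmetric] divide_eq_1_iff)
  also have "\<dots> \<longleftrightarrow> (\<exists>k::int. x = y + of_int k * (2 * pi))" unfolding cis_eq_1_iff_int by (simp add: algebra_simps)
  finally show ?thesis .
qed

lemma norm_prod_eq_1: "norm (a :: real, w :: complex) = 1 \<longleftrightarrow> a^2 + (cmod w)^2 = 1"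
  by (simp add: norm_Pair)

lemma wrap_image: "wrap ` cball 0 1 = sphere 0 1"
proof
  show "wrap ` cball 0 1 \<subseteq> sphere 0 1"
  proof
    fix p assume "p \<in> wrap ` cball 0 1"
    then obtain z where z: "cmod z \<le> 1" "p = wrap z" by auto
    then have "norm (wrap z) = 1"
      unfolding wrap_def Let_def norm_prod_eq_1 using disc_coords(1)[OF z(1)] by (simp add: norm_mult)
    then show "p \<in> sphere 0 1" using z by simp
  qed
  show "sphere 0 1 \<subseteq> wrap ` cball 0 1"
  proof
    fix p :: "real \<times> complex" assume "p \<in> sphere 0 1"
    then obtain a w where p: "p = (a, w)" "a^2 + (cmod w)^2 = 1" by (cases p) (simp add: norm_prod_eq_1)
    have r: "sqrt (1 - a^2) = cmod w" using p(2) by (intro real_sqrt_unique) auto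
    \<comment> \<open>The inverse of \<open>wrap\<close>: the longitude \<open>Arg w\<close> is
      scaled back to a height on the chord.\<close>
    define z where "z = Complex a (cmod w * Arg w / pi)"
    have "\<bar>Arg w\<bar> \<le> pi" using Arg_bounded[of w] by auto
    then have "\<bar>Arg w / pi\<bar> \<le> 1" by simp
    then have "(cmod w * (Arg w / pi))^2 \<le> (cmod w)^2"
      unfolding power_mult_distrib by (intro mult_left_le) (auto simp: abs_square_le_1)
    then have "(cmod z)^2 \<le> 1^2" using p(2) unfolding cmod_power2 z_def by simp
    then have "cmod z \<le> 1" using power2_le_imp_le[of "cmod z" 1] by simp
    moreover have "wrap z = p"
    proof (cases "w = 0")
      case True then show ?thesis using r unfolding wrap_def z_def p by simp
    next
      case False
      then have "of_real (cmod w) * cis (Arg w) = w" using rcis_cmod_Arg[of w] unfolding rcis_def by simp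
      then show ?thesis using r False unfolding wrap_def z_def p by simp
    qed
    ultimately show "p \<in> wrap ` cball 0 1" by (intro image_eqI[of _ _ z]) auto
  qed
qed

text \<open>A chord of length \<open>2 r\<close> runs exactly once around a circle of radius
  \<open>r\<close>, so only its two ends, which are conjugate, can coincide.\<close>

lemma wrap_fibres:
  assumes "cmod z \<le> 1" "cmod w \<le> 1"
  shows "wrap z = wrap w \<longleftrightarrow> z = w \<or> (cmod z = 1 \<and> w = cnj z)"
proof
  assume eq: "wrap z = wrap w"
  then have re: "Re z = Re w" unfolding wrap_def by simp
  define r where "r = sqrt (1 - (Re z)^2)"
  have b: "\<bar>Im z\<bar> \<le> r" "\<bar>Im w\<bar> \<le> r" using disc_coords(2)[OF assms(1)] disc_coords(2)[OF assms(2)] re unfolding r_def by auto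
  show "z = w \<or> (cmod z = 1 \<and> w = cnj z)"
  proof (cases "r = 0")
    case True
    then show ?thesis using b re by (auto simp: complex_eq_iff)
  next
    case False
    then have r: "r > 0" using b by linarith
    have "cis (pi * Im z / r) = cis (pi * Im w / r)"
      using eq False re unfolding wrap_def Let_def r_def by simp
    then obtain k :: int where "pi * Im z / r = pi * Im w / r + of_int k * (2 * pi)" using cis_eq_iff_int by blast
    then have "pi * (Im z - Im w) = pi * (of_int k * (2 * r))" using r by (simp add: field_simps)
    then have k: "Im z - Im w = of_int k * (2 * r)" by simp
    have "\<bar>of_int k\<bar> * (2 * r) = \<bar>of_int k * (2 * r)\<bar>" using r by (simp add: abs_mult)
    then have "\<bar>of_int k\<bar> * (2 * r) \<le> 1 * (2 * r)" using k b by linarith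
    then have "\<bar>of_int k :: real\<bar> \<le> 1" by (rule mult_right_le_imp_le) (use r in simp)
    then have "k = 0 \<or> k = 1 \<or> k = -1" by linarith
    then show ?thesis
    proof (elim disjE)
      assume "k = 0" then show ?thesis using k re by (simp add: complex_eq_iff)
    next
      assume "k = 1"
      then have "Im z = r" "Im w = - r" using k b by auto
      then show ?thesis using disc_coords(3)[OF assms(1)] re r unfolding r_def by (auto simp: complex_eq_iff)
    next
      assume "k = -1"
      then have "Im z = - r" "Im w = r" using k b by auto
      then show ?thesis using disc_coords(3)[OF assms(1)] re r unfolding r_def by (auto simp: complex_eq_iff)
    qed
  qed
next
  assume "z = w \<or> (cmod z = 1 \<and> w = cnj z)"
  then show "wrap z = wrap w"
  proof
    assume h: "cmod z = 1 \<and> w = cnj z"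
    define r where "r = sqrt (1 - (Re z)^2)"
    have i: "Im z = r \<or> Im z = - r" using disc_coords(3)[OF assms(1)] h unfolding r_def by auto
    show ?thesis
    proof (cases "r = 0")
      case True
      then have "cnj z = z" using i by (auto simp: complex_eq_iff)
      then show ?thesis using h by simp
    next
      case False
      have "cis (pi * Im z / r) = cis (pi * Im (cnj z) / r)"
        using i False by (auto simp: complex_eq_iff)
      then show ?thesis using h unfolding wrap_def Let_def r_def by simp
    qed
  qed simp
qed

text \<open>Where the radius vanishes the longitude has no limit, but the modulus of the second
  component is the radius and tends to 0.\<close>

lemma continuous_wrap: "continuous_on (cball 0 1) wrap"
proof -
  define r where "r z = sqrt (1 - (Re z)^2)" for z
  define f where "f z = of_real (r z) * cis (pi * Im z / r z)" for z
  have contr: "continuous_on UNIV r" unfolding r_def by (intro continuous_intros)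
  have "isCont f z0 \<or> r z0 = 0" for z0
  proof (cases "r z0 = 0")
    case False
    have "isCont r z0" using contr by (simp add: continuous_on_eq_continuous_at)
    then have "isCont f z0" unfolding f_def cis_conv_exp using False
      by (intro continuous_intros) auto
    then show ?thesis ..
  qed simp
  moreover have "continuous (at z0 within cball 0 1) f" if "r z0 = 0" for z0
  proof -
    have "((\<lambda>z. \<bar>r z\<bar>) \<longlongrightarrow> 0) (at z0 within cball 0 1)"
    proof -
      have "isCont r z0" using contr by (simp add: continuous_on_eq_continuous_at)
      then have "(r \<longlongrightarrow> 0) (at z0)" using that by (simp add: isCont_def)
      then have "(r \<longlongrightarrow> 0) (at z0 within cball 0 1)" using tendsto_within_subset by blast
      then show ?thesis by (rule tendsto_rabs_zero)
    qed
    then have "(f \<longlongrightarrow> 0) (at z0 within cball 0 1)"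
      by (rule Lim_null_comparison[rotated]) (simp add: f_def norm_mult)
    moreover have "f z0 = 0" using that unfolding f_def by simp
    ultimately show ?thesis unfolding continuous_within by simp
  qed
  ultimately have "continuous_on (cball 0 1) f"
    unfolding continuous_on_eq_continuous_within using continuous_at_imp_continuous_at_within by blast
  then show ?thesis unfolding wrap_def Let_def r_def[symmetric] f_def[symmetric]
    by (intro continuous_intros)
qed

section \<open>Perimeter halvings as Aleksandrov gluings\<close>

context opoly
begin

text \<open>Folding at the parameters \<open>x\<close> and \<open>x + L / 2\<close>: the glued
  points are \<open>x + u\<close> and \<open>x - u\<close> modulo \<open>L\<close>.\<close>

definition halving :: "real \<Rightarrow> gluing" where
  "halving x = [(x, x + L / 2, L / 2, True)]"

lemma halving_is_gluing: "is_gluing n v (halving x)"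
proof -
  have arcs: "gluing_arcs L (halving x) = [parc L x (L/2), parc L (x + L/2) (L/2)]"
    unfolding gluing_arcs_def halving_def by simp
  have disj: "parc L x (L/2) \<inter> parc L (x + L/2) (L/2) = {}"
  proof (rule ccontr)
    assume "parc L x (L/2) \<inter> parc L (x + L/2) (L/2) \<noteq> {}"
    then obtain u w where u: "0 < u" "u < L/2" "0 < w" "w < L/2" "modL L (x + u) = modL L (x + L/2 + w)"
      unfolding parc_def by blast
    have "\<bar>x + u - (x + L/2 + w)\<bar> < L" using u(1-4) by linarith
    then have "x + u = x + L/2 + w" by (rule modL_eq_imp_eq[OF L_pos u(5)])
    then show False using u by simp
  qed
  have "{0..<L} - (parc L x (L/2) \<union> parc L (x + L/2) (L/2)) \<subseteq> {modL L x, modL L (x + L/2)}"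
  proof
    fix t assume t: "t \<in> {0..<L} - (parc L x (L/2) \<union> parc L (x + L/2) (L/2))"
    define y where "y = modL L (t - x)"
    have y: "0 \<le> y" "y < L" using modL_bounds[OF L_pos] unfolding y_def by auto
    have ty: "t = modL L (x + y)" using modL_shift[of x t] modL_id[of t L] t unfolding y_def by auto
    have "\<not> (0 < y \<and> y < L/2)" using t ty unfolding parc_def by blast
    moreover have "\<not> (L/2 < y)"
    proof
      assume "L/2 < y"
      then have "t \<in> parc L (x + L/2) (L/2)" unfolding parc_def using y ty
        by (auto intro!: exI[of _ "y - L/2"])
      then show False using t by blast
    qed
    ultimately have "y = 0 \<or> y = L/2" using y by linarith
    then show "t \<in> {modL L x, modL L (x + L/2)}" using ty by (metis add_0_right insertCI)
  qed
  then have "finite ({0..<L} - \<Union> (set (gluing_arcs L (halving x))))"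
    unfolding arcs by (auto intro: finite_subset)
  moreover have "\<forall>i<2. \<forall>j<2. i \<noteq> j \<longrightarrow> [parc L x (L/2), parc L (x + L/2) (L/2)] ! i \<inter> [parc L x (L/2), parc L (x + L/2) (L/2)] ! j = {}"
    using disj by (auto simp: less_2_cases_iff Int_commute)
  ultimately show ?thesis unfolding is_gluing_def Let_def arcs using L_pos by (auto simp: halving_def numeral_2_eq_2)
qed

text \<open>Gluing steps realise a single reflection. As this is an involution, the transitive
  closure adds nothing but equality.\<close>

lemma halving_pglued:
  assumes s: "s \<in> {0..<L}" and t: "t \<in> {0..<L}"
  shows "pglued n v (halving x) s t \<longleftrightarrow> s = t \<or> modL L (s + t) = modL L (2 * x)"
proof -
  have step: "glue_step L (halving x) s t \<longleftrightarrow> (\<exists>u. 0 \<le> u \<and> u \<le> L/2 \<and> s = modL L (x + u) \<and> t = modL L (x + L - u))" for s t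
    unfolding glue_step_def halving_def by (auto simp: algebra_simps)
  have sum: "modL L (s + t) = modL L (2 * x) \<and> s \<in> {0..<L} \<and> t \<in> {0..<L}" if "glue_step L (halving x) s t" for s t
  proof -
    obtain u where u: "s = modL L (x + u)" "t = modL L (x + L - u)" using \<open>glue_step L (halving x) s t\<close> step by blast
    have "modL L (s + t) = modL L (x + u + (x + L - u))" unfolding u using L_pos by (intro modL_cong_add) auto
    also have "\<dots> = modL L (2 * x + L)" by (simp add: algebra_simps)
    finally show ?thesis using modL_add_self[OF L_pos] u modL_range[OF L_pos] by simp
  qed
  have conv: "glue_step L (halving x) s t \<or> glue_step L (halving x) t s"
    if st: "s \<in> {0..<L}" "t \<in> {0..<L}" "modL L (s + t) = modL L (2 * x)" for s t
  proof -
    \<comment> \<open>A step starts in the half of the boundary following \<open>x\<close>; for the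
      other half the roles of \<open>s\<close> and \<open>t\<close> are exchanged.\<close>
    have main: "glue_step L (halving x) s t"
      if st: "s \<in> {0..<L}" "t \<in> {0..<L}" "modL L (s + t) = modL L (2 * x)" and le: "modL L (s - x) \<le> L/2" for s t
    proof -
      define u where "u = modL L (s - x)"
      have us: "s = modL L (x + u)" using modL_shift[of x s] modL_id[of s L] st unfolding u_def by auto
      have "modL L t = modL L (2 * x - (x + u))"
        using modL_cong_diff[OF L_pos st(3), of s "x + u"] us L_pos by simp
      also have "\<dots> = modL L (x + L - u)" using modL_add_self[OF L_pos, of "x - u"] by (simp add: algebra_simps)
      finally have "t = modL L (x + L - u)" using modL_id[of t L] st by auto
      then show ?thesis unfolding step using us le modL_bounds(1)[OF L_pos] unfolding u_def by blast
    qed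
    show ?thesis
    proof (cases "modL L (s - x) \<le> L/2")
      case True then show ?thesis using main st by blast
    next
      case False
      have "modL L (t - x) = modL L (2 * x - s - x)"
        using modL_cong_diff[OF L_pos st(3), of s s] by (intro modL_cong_diff L_pos) auto
      also have "\<dots> = modL L (0 - modL L (s - x))"
        using modL_cong_diff[OF L_pos, of 0 0 "s - x" "modL L (s - x)"] L_pos by simp
      also have "\<dots> = L - modL L (s - x)"
        using False modL_bounds[OF L_pos, of "s - x"] L_pos by (intro modL_unique[of _ _ "-1"]) auto
      finally have "modL L (t - x) \<le> L/2" using False by linarith
      then have "glue_step L (halving x) t s" using main[of t s] st by (simp add: add.commute)
      then show ?thesis ..
    qed
  qed
  show ?thesis
  proof
    assume "pglued n v (halving x) s t"
    then show "s = t \<or> modL L (s + t) = modL L (2 * x)"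
      unfolding pglued_def
    proof (induction rule: rtranclp_induct)
      case (step y z)
      have yz: "modL L (y + z) = modL L (2 * x)" "y \<in> {0..<L}" "z \<in> {0..<L}"
        using step.hyps(2) sum[of y z] sum[of z y] by (auto simp: add.commute)
      show ?case
      proof (cases "s = y")
        case True then show ?thesis using yz by simp
      next
        case False
        then have "modL L (s + y) = modL L (y + z)" using step.IH yz by simp
        then have "modL L s = modL L z" using modL_cong_diff[OF L_pos, of "s + y" "y + z" y y] by simp
        then show ?thesis using modL_id[of s L] modL_id[of z L] s yz by auto
      qed
    qed simp
  next
    assume "s = t \<or> modL L (s + t) = modL L (2 * x)"
    then show "pglued n v (halving x) s t"
      unfolding pglued_def using conv[OF s t] by (auto intro: r_into_rtranclp)
  qed
qed

lemma cis_param_iff: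
  "cis (2 * pi * y / L) = cis (2 * pi * z / L) \<longleftrightarrow> modL L y = modL L z"
proof -
  have "2 * pi * y / L = 2 * pi * z / L + of_int k * (2 * pi) \<longleftrightarrow> y = z + of_int k * L" for k :: int
  proof -
    have "2 * pi * y / L = 2 * pi * z / L + of_int k * (2 * pi) \<longleftrightarrow> (2 * pi) * y = (2 * pi) * (z + of_int k * L)"
      using L_pos by (simp add: field_simps)
    also have "\<dots> \<longleftrightarrow> y = z + of_int k * L" by (subst mult_left_cancel) auto
    finally show ?thesis .
  qed
  then show ?thesis unfolding cis_eq_iff_int modL_eq_iff[OF L_pos] by simp
qed

text \<open>Rescaled polar coordinates map the polygon to the unit disc, with parameter
  \<open>a\<close> at angle 0. The reflection becomes complex conjugation on the circle, and
  \<open>wrap\<close> performs exactly this identification.\<close>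

lemma halving_sphere:
  "\<exists>q :: complex \<Rightarrow> real^3. continuous_on (polygon n v) q \<and> q ` polygon n v = sphere 0 1
     \<and> (\<forall>x \<in> polygon n v. \<forall>y \<in> polygon n v. q x = q y \<longleftrightarrow> ptglued n v (halving a) x y)"
proof -
  interpret G: glued_poly n v e "halving a" by unfold_locales (rule halving_is_gluing)
  define z where "z r s = of_real r * cis (2 * pi * (s - a) / L)" for r s
  \<comment> \<open>Polar coordinates are ambiguous, in particular at the centre; \<open>zeq\<close>
    shows that the chosen value does not depend on them.\<close>
  define disc where "disc p = (SOME w. \<exists>r s. 0 \<le> r \<and> r \<le> 1 \<and> p = polar r s \<and> w = z r s)" for p
  have zeq: "z r s = z r' s' \<longleftrightarrow> polar r s = polar r' s'" if h: "0 \<le> r" "r \<le> 1" "0 \<le> r'" "r' \<le> 1" for r s r' s'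
  proof
    assume eq: "z r s = z r' s'"
    then have "cmod (z r s) = cmod (z r' s')" by simp
    then have rr: "r = r'" using h unfolding z_def by (simp add: norm_mult)
    show "polar r s = polar r' s'"
    proof (cases "r = 0")
      case False
      then have "cis (2 * pi * (s - a) / L) = cis (2 * pi * (s' - a) / L)" using eq rr unfolding z_def by simp
      then have "modL L (s - a) = modL L (s' - a)" unfolding cis_param_iff .
      then have "modL L s = modL L s'" using modL_cong_add[OF L_pos, of "s - a" "s' - a" a a] by simp
      then show ?thesis using rr polar_cong[of s s' r] by simp
    qed (use rr in simp)
  next
    assume eq: "polar r s = polar r' s'"
    show "z r s = z r' s'"
    proof (cases "r = 0 \<or> r' = 0")
      case True
      moreover have "r = 0 \<longleftrightarrow> r' = 0"
        using polar_eq_ctr[OF h(1), of s] polar_eq_ctr[OF h(3), of s'] unfolding eq by blast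
      ultimately have "r = 0 \<and> r' = 0" by blast
      then show ?thesis unfolding z_def by simp
    next
      case False
      then have i: "r = r' \<and> modL L s = modL L s'" using polar_inj[of r r' s s'] eq h by auto
      then have "modL L (s - a) = modL L (s' - a)" by (intro modL_cong_diff L_pos) auto
      then have "cis (2 * pi * (s - a) / L) = cis (2 * pi * (s' - a) / L)" unfolding cis_param_iff .
      then show ?thesis using i unfolding z_def by simp
    qed
  qed
  have disc: "disc (polar r s) = z r s" if h: "0 \<le> r" "r \<le> 1" for r s
  proof -
    have "\<exists>w. \<exists>r' s'. 0 \<le> r' \<and> r' \<le> 1 \<and> polar r s = polar r' s' \<and> w = z r' s'" using h by blast
    from someI_ex[OF this] obtain r' s' where "0 \<le> r'" "r' \<le> 1" "polar r s = polar r' s'" "disc (polar r s) = z r' s'"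
      unfolding disc_def by blast
    then show ?thesis using zeq h by metis
  qed
  have zcont: "continuous_on ({0..1} \<times> {0..L}) (\<lambda>p. z (fst p) (snd p))"
    unfolding z_def cis_conv_exp using L_pos by (intro continuous_intros) auto
  have znorm: "cmod (z r s) = \<bar>r\<bar>" for r s unfolding z_def by (simp add: norm_mult)
  have dcont: "continuous_on (polygon n v) disc"
  proof (rule continuous_on_via_polar)
    show "continuous_on ({0..1} \<times> {0..L}) (\<lambda>p. disc (polar (fst p) (snd p)))"
      using zcont by (rule continuous_on_eq) (auto simp: disc)
  qed
  have dim: "disc ` polygon n v = cball 0 1"
  proof
    show "disc ` polygon n v \<subseteq> cball 0 1"
    proof
      fix w assume "w \<in> disc ` polygon n v"
      then obtain p where "p \<in> polygon n v" "w = disc p" by blast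
      then obtain r s where "0 \<le> r" "r \<le> 1" "w = disc (polar r s)" using polar_surj[of p] by metis
      then show "w \<in> cball 0 1" using disc znorm by simp
    qed
    show "cball 0 1 \<subseteq> disc ` polygon n v"
    proof
      fix w :: complex assume w: "w \<in> cball 0 1"
      have "w = z (cmod w) (a + L * Arg w / (2 * pi))"
        using rcis_cmod_Arg[of w] L_pos unfolding z_def rcis_def by simp
      then have "w = disc (polar (cmod w) (a + L * Arg w / (2 * pi)))" using disc w by simp
      then show "w \<in> disc ` polygon n v" using polar_in_P[of "cmod w"] w by auto
    qed
  qed
  have "sphere (0 :: real \<times> complex) 1 homeomorphic sphere (0 :: real^3) 1"
    by (rule homeomorphic_spheres_gen) auto
  then obtain \<phi> \<psi> where hom: "homeomorphism (sphere (0 :: real \<times> complex) 1) (sphere (0 :: real^3) 1) \<phi> \<psi>"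
    unfolding homeomorphic_def by blast
  define q where "q = \<phi> \<circ> (wrap \<circ> disc)"
  have wd: "(wrap \<circ> disc) ` polygon n v = sphere 0 1" using dim wrap_image by (metis image_comp)
  have "continuous_on (polygon n v) (wrap \<circ> disc)"
    using dcont continuous_wrap dim by (intro continuous_on_compose) auto
  then have 1: "continuous_on (polygon n v) q"
    unfolding q_def
  proof (rule continuous_on_compose)
    show "continuous_on ((wrap \<circ> disc) ` polygon n v) \<phi>" unfolding wd by (rule homeomorphism_cont1[OF hom])
  qed
  have "q ` polygon n v = \<phi> ` (wrap \<circ> disc) ` polygon n v"
    unfolding q_def by (rule image_comp[symmetric])
  then have 2: "q ` polygon n v = sphere 0 1" unfolding wd using homeomorphism_image1[OF hom] by simp
  have 3: "q x = q y \<longleftrightarrow> ptglued n v (halving a) x y" if xy: "x \<in> polygon n v" "y \<in> polygon n v" for x y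
  proof -
    obtain r s where r: "0 \<le> r" "r \<le> 1" "s \<in> {0..<L}" "x = polar r s" using polar_surj xy by metis
    obtain r' s' where r': "0 \<le> r'" "r' \<le> 1" "s' \<in> {0..<L}" "y = polar r' s'" using polar_surj xy by metis
    have "q x = q y \<longleftrightarrow> wrap (disc x) = wrap (disc y)"
    proof -
      have "wrap (disc x) \<in> sphere 0 1" "wrap (disc y) \<in> sphere 0 1" using wd xy by auto
      then show ?thesis unfolding q_def comp_def using homeomorphism_apply1[OF hom] by metis
    qed
    also have "\<dots> \<longleftrightarrow> z r s = z r' s' \<or> (r = 1 \<and> z r' s' = cnj (z r s))"
      using wrap_fibres[of "z r s" "z r' s'"] znorm r r' disc by simp
    also have "\<dots> \<longleftrightarrow> x = y \<or> (r = 1 \<and> r' = 1 \<and> modL L (s + s') = modL L (2 * a))"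
    proof -
      have "z r' s' = cnj (z r s) \<longleftrightarrow> r' = 1 \<and> modL L (s + s') = modL L (2 * a)" if "r = 1"
      proof -
        have c: "cnj (z r s) = cis (2 * pi * (a - s) / L)"
        proof -
          have "- (2 * pi * (s - a) / L) = 2 * pi * (a - s) / L" using L_pos by (simp add: field_simps)
          then show ?thesis using that unfolding z_def by (simp add: cis_cnj)
        qed
        have "cmod (z r' s') = cmod (cnj (z r s)) \<longleftrightarrow> r' = 1" using znorm r' that by simp
        moreover have "z 1 s' = cnj (z r s) \<longleftrightarrow> modL L (s' - a) = modL L (a - s)"
          unfolding c by (simp add: z_def cis_param_iff)
        moreover have "modL L (s' - a) = modL L (a - s) \<longleftrightarrow> modL L (s + s') = modL L (2 * a)"
          using modL_cong_add[OF L_pos, of "s' - a" "a - s" "s + a" "s + a"]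
            modL_cong_diff[OF L_pos, of "s + s'" "2 * a" "s + a" "s + a"] by (auto simp: algebra_simps)
        ultimately show ?thesis by metis
      qed
      then show ?thesis using zeq[of r r' s s'] r r' by auto
    qed
    also have "\<dots> \<longleftrightarrow> ptglued n v (halving a) x y"
    proof (cases "r = 1 \<and> r' = 1")
      case True
      then show ?thesis using r r' G.ptglued_bpt[of s s'] halving_pglued[OF r(3) r'(3)] modL_id[of s L] modL_id[of s' L]
          bpt_eq_iff[of s s'] by auto
    next
      case False
      then have "x \<in> interior (polygon n v) \<or> y \<in> interior (polygon n v)"
        using polar_interior r r' by (metis order_le_less)
      then have "ptglued n v (halving a) x y \<longleftrightarrow> x = y"
        unfolding ptglued_def using bpt_not_interior by metis
      then show ?thesis using False by auto
    qed
    finally show ?thesis .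
  qed
  show ?thesis using 1 2 3 by blast
qed

text \<open>The angle condition is automatic: each class has at most two points, and every face
  angle is at most pi.\<close>

lemma halving_aleksandrov: "aleksandrov_gluing n v (halving x)"
proof -
  have fa: "face_angle n v t \<le> pi" if t: "t \<in> {0..<L}" for t
  proof (cases "t \<in> vp ` {..<n}")
    case True
    then show ?thesis using face_angle_vertex interior_angle_bounds(2) by (auto simp: less_imp_le)
  next
    case False
    then show ?thesis using face_angle_other[OF t] by simp
  qed
  have "(\<Sum>t\<in>pclass n v (halving x) s. face_angle n v t) \<le> 2 * pi" if s: "s \<in> {0..<L}" for s
  proof -
    have sub: "pclass n v (halving x) s \<subseteq> {s, modL L (2 * x - s)}"
    proof
      fix t assume "t \<in> pclass n v (halving x) s"
      then have t: "t \<in> {0..<L}" "t = s \<or> modL L (s + t) = modL L (2 * x)"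
        using halving_pglued[OF s] unfolding pclass_def by auto
      have "modL L t = modL L (2 * x - s)" if "modL L (s + t) = modL L (2 * x)"
        using modL_cong_diff[OF L_pos that, of s s] by simp
      then show "t \<in> {s, modL L (2 * x - s)}" using t modL_id[of t L] by auto
    qed
    have "card (pclass n v (halving x) s) \<le> card {s, modL L (2 * x - s)}" using sub by (intro card_mono) auto
    also have "\<dots> \<le> 2" by (simp add: card_insert_if)
    finally have c: "card (pclass n v (halving x) s) \<le> 2" .
    have "(\<Sum>t\<in>pclass n v (halving x) s. face_angle n v t) \<le> of_nat (card (pclass n v (halving x) s)) * pi"
      by (rule sum_bounded_above) (use fa in \<open>auto simp: pclass_def\<close>)
    also have "\<dots> \<le> 2 * pi" using c by (intro mult_right_mono) auto
    finally show ?thesis .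
  qed
  then show ?thesis unfolding aleksandrov_gluing_def using halving_is_gluing halving_sphere by blast
qed

text \<open>An isomorphism would yield a node of the second tree with both \<open>i\<close> and
  \<open>j\<close> in its label. These vertices are then glued by the second halving too, which
  determines \<open>2 * y\<close> modulo \<open>L\<close>.\<close>

lemma halving_trees_distinct:
  assumes ij: "i < n" "j < n" "i \<noteq> j" and x: "modL L (vp i + vp j) = modL L (2 * x)"
    and y: "modL L (2 * x) \<noteq> modL L (2 * y)"
  shows "\<not> ltree_iso (gluing_tree n v (halving x)) (gluing_tree n v (halving y))"
proof
  assume iso: "ltree_iso (gluing_tree n v (halving x)) (gluing_tree n v (halving y))"
  define C where "C = pclass n v (halving x) (vp i)"
  have r: "vp i \<in> {0..<L}" "vp j \<in> {0..<L}" using plen_range ij by auto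
  have C: "vp i \<in> C" "vp j \<in> C" using halving_pglued[OF r(1)] r x unfolding C_def pclass_def by auto
  have "special_param n v (halving x) (vp i)"
    unfolding special_param_def using r C(1) vertex_param_iff[OF r(1)] ij unfolding C_def by auto
  then have CN: "C \<in> fst (gluing_tree n v (halving x))" unfolding gluing_tree_def C_def by auto
  obtain f where f: "bij_betw f (fst (gluing_tree n v (halving x))) (fst (gluing_tree n v (halving y)))"
    "\<And>X. X \<in> fst (gluing_tree n v (halving x)) \<Longrightarrow>
       snd (snd (gluing_tree n v (halving y))) (f X) = snd (snd (gluing_tree n v (halving x))) X"
    using iso unfolding ltree_iso_def by (auto split: prod.splits)
  have "f C \<in> fst (gluing_tree n v (halving y))" using f(1) CN by (auto simp: bij_betw_def)
  then obtain s where s: "f C = pclass n v (halving y) s" unfolding gluing_tree_def by auto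
  have lab: "k \<in> fst (snd (snd (gluing_tree n v g)) D) \<longleftrightarrow> k < n \<and> (\<exists>t\<in>D. bpt n v t = v k)" for g k D
    unfolding gluing_tree_def by simp
  have "i \<in> fst (snd (snd (gluing_tree n v (halving x))) C)" "j \<in> fst (snd (snd (gluing_tree n v (halving x))) C)"
    unfolding lab using C bpt_plen ij by auto
  then have "i \<in> fst (snd (snd (gluing_tree n v (halving y))) (f C))" "j \<in> fst (snd (snd (gluing_tree n v (halving y))) (f C))"
    using f(2)[OF CN] by auto
  then obtain t t' where t: "t \<in> f C" "bpt n v t = v i" "t' \<in> f C" "bpt n v t' = v j" unfolding lab by blast
  have tr: "t \<in> {0..<L}" "t' \<in> {0..<L}" using t s unfolding pclass_def by auto
  then have eq: "t = vp i" "t' = vp j" using t bpt_eq_vertex ij by auto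
  interpret G: glued_poly n v e "halving y" by unfold_locales (rule halving_is_gluing)
  have "pglued n v (halving y) t t'"
    using t s G.pglued_sym G.pglued_trans unfolding pclass_def by blast
  then have "modL L (vp i + vp j) = modL L (2 * y)"
    using halving_pglued[OF r] eq plen_eq_iff[of i j] ij by auto
  then show False using x y by simp
qed

end

section \<open>The quadratic lower bound\<close>

text \<open>A convex chain with m edges of length 1 followed by m edges of length m + 1, closed up by one
  more edge. The sums of a vertex parameter i of the first part and m + j (m + 1) of the second are
  pairwise distinct, and less than the perimeter for i < m and 0 < j < m.\<close>

definition chain_len :: "nat \<Rightarrow> nat \<Rightarrow> real" where
  "chain_len m i = (if i < m then 1 else real m + 1)"

text \<open>Unit vectors of slopes 0, 1, 2, and so on. They turn left but stay in the right half
  plane, so the closing edge leaves the polygon convex.\<close>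

definition chain_dir :: "nat \<Rightarrow> complex" where
  "chain_dir i = Complex 1 (real i) / of_real (cmod (Complex 1 (real i)))"

definition chain :: "nat \<Rightarrow> nat \<Rightarrow> complex" where
  "chain m k = (\<Sum>i<k. of_real (chain_len m i) * chain_dir i)"

lemma chain_len_pos: "chain_len m i > 0"
  unfolding chain_len_def by auto

lemma Complex_1_nz: "Complex 1 x \<noteq> 0"
  by (simp add: complex_eq_iff)

lemma norm_chain_dir: "cmod (chain_dir i) = 1"
  unfolding chain_dir_def using Complex_1_nz[of "real i"] by (simp add: norm_divide)

lemma cross_chain_dir: "i < k \<Longrightarrow> cross (chain_dir i) (chain_dir k) > 0"
proof -
  assume "i < k"
  define a where "a = inverse (cmod (Complex 1 (real i)))"
  define b where "b = inverse (cmod (Complex 1 (real k)))"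
  have "a > 0" "b > 0" unfolding a_def b_def using Complex_1_nz by auto
  moreover have "chain_dir i = a *\<^sub>R Complex 1 (real i)" "chain_dir k = b *\<^sub>R Complex 1 (real k)"
    unfolding chain_dir_def a_def b_def by (simp_all add: scaleR_conv_of_real field_simps)
  ultimately show ?thesis using \<open>i < k\<close> by (simp add: cross_simps) (simp add: cross_def)
qed

lemma cross_sum_left: "cross (\<Sum>i\<in>A. f i) b = (\<Sum>i\<in>A. cross (f i) b)"
  by (induction A rule: infinite_finite_induct) (auto simp: cross_simps)

lemma cross_sum_right: "cross b (\<Sum>i\<in>A. f i) = (\<Sum>i\<in>A. cross b (f i))"
  by (induction A rule: infinite_finite_induct) (auto simp: cross_simps)

lemma chain_diff: "j \<le> k \<Longrightarrow> chain m k - chain m j = (\<Sum>i=j..<k. of_real (chain_len m i) * chain_dir i)"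
  unfolding chain_def by (simp add: lessThan_atLeast0 sum_diff_nat_ivl)

lemma chain_Suc: "chain m (Suc k) - chain m k = of_real (chain_len m k) * chain_dir k"
  unfolding chain_def by simp

text \<open>Each side condition expands into cross products of an earlier with a later edge vector
  of the chain, all of them positive.\<close>

lemma chain_oriented:
  assumes n: "n \<ge> 3"
  shows "oriented 1 n (chain m)"
  unfolding oriented_def
proof (intro conjI allI impI)
  fix k j assume kj: "k < n" "j < n" "j \<noteq> k" "j \<noteq> nxt n k"
  have pos: "cross (of_real (chain_len m i) * chain_dir i) (of_real (chain_len m k) * chain_dir k) > 0"
    if "i < k" for i k using cross_chain_dir[OF that] chain_len_pos by (simp add: cross_simps)
  have "cross (chain m (nxt n k) - chain m k) (chain m j - chain m k) > 0"
    using nxt_cases[OF kj(1)]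
  proof (elim disjE conjE)
    assume h: "nxt n k = Suc k" "Suc k < n"
    show ?thesis
    proof (cases "j < k")
      case True
      have "0 < (\<Sum>i=j..<k. cross (of_real (chain_len m i) * chain_dir i) (of_real (chain_len m k) * chain_dir k))"
        using True pos by (intro sum_pos) auto
      also have "\<dots> = cross (chain m k - chain m j) (chain m (Suc k) - chain m k)"
        unfolding chain_diff[OF less_imp_le[OF True]] chain_Suc cross_sum_left ..
      also have "\<dots> = cross (chain m (nxt n k) - chain m k) (chain m j - chain m k)"
        unfolding h by (simp add: cross_def algebra_simps)
      finally show ?thesis .
    next
      case False
      then have j: "Suc k < j" using kj h by auto
      have "0 < (\<Sum>i=Suc k..<j. cross (of_real (chain_len m k) * chain_dir k) (of_real (chain_len m i) * chain_dir i))"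
        using j pos by (intro sum_pos) auto
      also have "\<dots> = cross (chain m (Suc k) - chain m k) (chain m j - chain m (Suc k))"
        unfolding chain_diff[OF less_imp_le[OF j]] chain_Suc cross_sum_right ..
      also have "\<dots> = cross (chain m (nxt n k) - chain m k) (chain m j - chain m k)"
        unfolding h by (simp add: cross_def algebra_simps)
      finally show ?thesis .
    qed
  next
    assume h: "nxt n k = 0" "Suc k = n"
    then have j: "0 < j" "j < k" using kj by auto
    \<comment> \<open>Twice the area of the triangle on the vertices with indices 0,
      \<open>j\<close>, \<open>k\<close>, expanded over the edges before and after
      \<open>j\<close>.\<close>
    have "0 < (\<Sum>i=0..<j. \<Sum>l=j..<k. cross (of_real (chain_len m i) * chain_dir i) (of_real (chain_len m l) * chain_dir l))"
      using j pos by (intro sum_pos) auto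
    also have "\<dots> = cross (chain m j - chain m 0) (chain m k - chain m j)"
      using j unfolding chain_diff[OF less_imp_le[OF j(1)]] chain_diff[OF less_imp_le[OF j(2)]] cross_sum_left
      by (simp add: cross_sum_right)
    also have "\<dots> = cross (chain m (nxt n k) - chain m k) (chain m j - chain m k)"
      unfolding h by (simp add: cross_def algebra_simps)
    finally show ?thesis .
  qed
  then show "0 < 1 * cross (chain m (nxt n k) - chain m k) (chain m j - chain m k)" by simp
qed (use n in auto)

lemma halving_family:
  assumes m: "m \<ge> 2" and n: "n = 2 * m + 1"
  shows "\<exists>G. G \<subseteq> {gl. aleksandrov_gluing n (chain m) gl} \<and> finite G \<and> card G = m * (m - 1)
     \<and> (\<forall>g1\<in>G. \<forall>g2\<in>G. g1 \<noteq> g2 \<longrightarrow> \<not> ltree_iso (gluing_tree n (chain m) g1) (gluing_tree n (chain m) g2))"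
proof -
  interpret opoly n "chain m" 1
    by unfold_locales (use chain_oriented n m in auto)
  have vp: "vp k = (\<Sum>i<k. chain_len m i)" if "k \<le> 2 * m" for k
    unfolding plen_def
  proof (intro sum.cong refl)
    fix i assume "i \<in> {..<k}"
    then have "nxt n i = Suc i" using that n by (intro nxt_Suc) auto
    then show "cmod (edgev n (chain m) i) = chain_len m i"
      unfolding edgev_def using chain_len_pos[of m i] by (simp add: chain_Suc norm_mult norm_chain_dir)
  qed
  have vp1: "vp i = real i" if "i \<le> m" for i
  proof -
    have "vp i = (\<Sum>i<i. (1::real))" using that vp[of i] by (auto simp: chain_len_def intro!: sum.cong)
    then show ?thesis by simp
  qed
  have vp2: "vp (m + j) = real m + real j * (real m + 1)" if "j \<le> m" for j
    using that
  proof (induction j)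
    case 0
    then show ?case using vp1[of m] by simp
  next
    case (Suc j)
    have "vp (m + Suc j) = vp (m + j) + chain_len m (m + j)"
      using Suc.prems vp[of "m + Suc j"] vp[of "m + j"] by simp
    then show ?case using Suc by (simp add: chain_len_def algebra_simps)
  qed
  define I where "I = {..<m} \<times> {1..<m}"
  define sm where "sm = (\<lambda>(i, j). vp i + vp (m + j))"
  define g where "g = (\<lambda>p. halving (sm p / 2))"
  have sm: "sm (i, j) = real i + real m + real j * (real m + 1)" if "(i, j) \<in> I" for i j
    using that vp1[of i] vp2[of j] unfolding I_def sm_def by auto
  have Lbig: "real m + real m * (real m + 1) < L"
    using plen_less[of "m + m" n] vp2[of m] n plen_n by simp
  \<comment> \<open>All sums stay below the perimeter, so different sums are different modulo
    \<open>L\<close>.\<close>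
  have sm_range: "0 \<le> sm p \<and> sm p < L" if p: "p \<in> I" for p
  proof -
    obtain i j where ij: "p = (i, j)" by (cases p)
    have b: "real i \<le> real m" "real j + 1 \<le> real m" using p unfolding ij I_def by auto
    have "(real j + 1) * (real m + 1) \<le> real m * (real m + 1)" using b by (intro mult_right_mono) auto
    then have "real i + real m + real j * (real m + 1) < L" using b(1) Lbig by (simp add: algebra_simps)
    then show ?thesis using sm p unfolding ij by simp
  qed
  have sm_inj: "p = p'" if p: "p \<in> I" "p' \<in> I" "sm p = sm p'" for p p'
  proof -
    obtain i j where ij: "p = (i, j)" by (cases p)
    obtain i' j' where ij': "p' = (i', j')" by (cases p')
    have "real i + real j * (real m + 1) = real i' + real j' * (real m + 1)"
      using p sm unfolding ij ij' by simp
    then have "real (i + j * (m + 1)) = real (i' + j' * (m + 1))"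
      by (simp only: of_nat_add of_nat_mult of_nat_1)
    \<comment> \<open>Two-digit numbers in base \<open>m + 1\<close> with last digits
      \<open>i\<close> and \<open>i'\<close>.\<close>
    then have eq: "i + j * (m + 1) = i' + j' * (m + 1)" by (simp only: of_nat_eq_iff)
    have lt: "i < m + 1" "i' < m + 1" using p unfolding ij ij' I_def by auto
    have "i = (i + j * (m + 1)) mod (m + 1)" using lt by (simp only: mod_mult_self1 mod_less)
    also have "\<dots> = i'" using lt unfolding eq by (simp only: mod_mult_self1 mod_less)
    finally have "i = i'" .
    then have "j * (m + 1) = j' * (m + 1)" using eq by simp
    then have "j = j'" by (simp only: mult_cancel2) simp
    then show ?thesis using \<open>i = i'\<close> unfolding ij ij' by simp
  qed
  have modne: "modL L (sm p) \<noteq> modL L (sm p')" if "p \<in> I" "p' \<in> I" "p \<noteq> p'" for p p'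
    using sm_inj[of p p'] that sm_range[OF that(1)] sm_range[OF that(2)] modL_id[of "sm p" L] modL_id[of "sm p'" L]
    by auto
  have dist: "\<not> ltree_iso (gluing_tree n (chain m) (g p)) (gluing_tree n (chain m) (g p'))"
    if p: "p \<in> I" "p' \<in> I" "p \<noteq> p'" for p p'
  proof -
    obtain i j where ij: "p = (i, j)" by (cases p)
    have b: "i < n" "m + j < n" "i \<noteq> m + j" using p(1) n unfolding ij I_def by auto
    have half: "2 * (x / 2) = x" for x :: real by simp
    have "modL L (vp i + vp (m + j)) = modL L (2 * (sm p / 2))" unfolding half unfolding ij sm_def by simp
    moreover have "modL L (2 * (sm p / 2)) \<noteq> modL L (2 * (sm p' / 2))" unfolding half by (rule modne[OF p])
    ultimately show ?thesis unfolding g_def by (rule halving_trees_distinct[OF b])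
  qed
  have inj: "inj_on g I"
  proof (rule inj_onI)
    fix p p' assume "p \<in> I" "p' \<in> I" "g p = g p'"
    moreover from this have "sm p = sm p'" unfolding g_def halving_def by simp
    ultimately show "p = p'" using sm_inj by blast
  qed
  have "g1 = g2 \<or> \<not> ltree_iso (gluing_tree n (chain m) g1) (gluing_tree n (chain m) g2)"
    if "g1 \<in> g ` I" "g2 \<in> g ` I" for g1 g2
    using that dist by blast
  moreover have "card (g ` I) = m * (m - 1)"
    using card_image[OF inj] unfolding I_def by (simp add: card_cartesian_product)
  moreover have "g ` I \<subseteq> {gl. aleksandrov_gluing n (chain m) gl}"
    unfolding g_def using halving_aleksandrov by auto
  moreover have "finite (g ` I)" unfolding I_def by simp
  ultimately show ?thesis by (intro exI[of _ "g ` I"]) blast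
qed

lemma gluing_trees_lower_bound:
  "\<exists>c > 0. \<forall>N. \<exists>n v G. n \<ge> N \<and> convex_polygon n v
            \<and> G \<subseteq> {gl. aleksandrov_gluing n v gl} \<and> finite G
            \<and> (\<forall>g1\<in>G. \<forall>g2\<in>G. g1 \<noteq> g2 \<longrightarrow> \<not> ltree_iso (gluing_tree n v g1) (gluing_tree n v g2))
            \<and> real (card G) \<ge> c * real n ^ 2"
\<comment> \<open>With n = 2 m + 1 and m (m - 1) halvings, the constant 1/18 requires 14 m^2 - 22 m
  - 1 to be nonnegative, which holds for m at least 2.\<close>
proof (intro exI[of _ "1/18 :: real"] conjI allI)
  fix N :: nat
  define m where "m = N + 2"
  define n where "n = 2 * m + 1"
  have o: "oriented 1 n (chain m)" using chain_oriented[of n m] unfolding n_def m_def by simp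
  interpret opoly n "chain m" 1 by unfold_locales (rule o)
  obtain G where G: "G \<subseteq> {gl. aleksandrov_gluing n (chain m) gl}" "finite G" "card G = m * (m - 1)"
    "\<forall>g1\<in>G. \<forall>g2\<in>G. g1 \<noteq> g2 \<longrightarrow> \<not> ltree_iso (gluing_tree n (chain m) g1) (gluing_tree n (chain m) g2)"
    using halving_family[of m n] unfolding n_def m_def by auto
  have "1/18 * real n ^ 2 \<le> real (card G)"
  proof -
    have m2: "2 \<le> real m" unfolding m_def by simp
    have "real (m - 1) = real m - 1" unfolding m_def by simp
    then have c: "real (card G) = real m * (real m - 1)" unfolding G(3) by simp
    define M where "M = real m * real m"
    have "2 * real m \<le> M" unfolding M_def using m2 by (intro mult_right_mono) auto
    moreover have "real n ^ 2 = 4 * M + 4 * real m + 1"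
      unfolding n_def M_def by (simp add: power2_eq_square algebra_simps)
    moreover have "real (card G) = M - real m" unfolding c M_def by (simp add: algebra_simps)
    ultimately show ?thesis using m2 by linarith
  qed
  moreover have "n \<ge> N" unfolding n_def m_def by simp
  ultimately show "\<exists>n v G. n \<ge> N \<and> convex_polygon n v
            \<and> G \<subseteq> {gl. aleksandrov_gluing n v gl} \<and> finite G
            \<and> (\<forall>g1\<in>G. \<forall>g2\<in>G. g1 \<noteq> g2 \<longrightarrow> \<not> ltree_iso (gluing_tree n v g1) (gluing_tree n v g2))
            \<and> real (card G) \<ge> 1/18 * real n ^ 2"
    using G convex_polygon by blast
qed simp

theorem theorem9:
  shows "(\<exists>C N0. \<forall>n v. n \<ge> N0 \<and> convex_polygon n v \<longrightarrow>
            (\<exists>T :: ltree set. finite T \<and> real (card T) \<le> C * real n ^ 3 \<and>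
               (\<forall>gl. aleksandrov_gluing n v gl \<longrightarrow> (\<exists>T'\<in>T. ltree_iso (gluing_tree n v gl) T'))))
       \<and> (\<exists>c > 0. \<forall>N. \<exists>n v G. n \<ge> N \<and> convex_polygon n v
            \<and> G \<subseteq> {gl. aleksandrov_gluing n v gl} \<and> finite G
            \<and> (\<forall>g1\<in>G. \<forall>g2\<in>G. g1 \<noteq> g2 \<longrightarrow> \<not> ltree_iso (gluing_tree n v g1) (gluing_tree n v g2))
            \<and> real (card G) \<ge> c * real n ^ 2)"
proof
  show "\<exists>C N0. \<forall>n v. n \<ge> N0 \<and> convex_polygon n v \<longrightarrow>
            (\<exists>T :: ltree set. finite T \<and> real (card T) \<le> C * real n ^ 3 \<and>
               (\<forall>gl. aleksandrov_gluing n v gl \<longrightarrow> (\<exists>T'\<in>T. ltree_iso (gluing_tree n v gl) T')))"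
    using gluing_trees_upper_bound by blast
qed (rule gluing_trees_lower_bound)

end
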